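(* Let $(P,\bar P)$ be dressing operators of the strongly coupled extended Toda hierarchy (SCETH), with Lax operator $\mathcal L$ and Orlov–Schulman operators $\mathcal M,\bar{\mathcal M}$, and for $l\ge 0$ let the additional flows $\partial_{t^*_l}=\frac{\partial}{\partial t^*_l}$ be defined by $$\frac{\partial P}{\partial t^*_l}=-\big((\mathcal M-\bar{\mathcal M})\mathcal L^l\big)_-P,\qquad \frac{\partial \bar P}{\partial t^*_l}=\big((\mathcal M-\bar{\mathcal M})\mathcal L^l\big)_+\bar P .$$ Then the additional flows $\partial_{t^*_l}$ of the SCETH form a Virasoro type Lie algebra with the relation $$[\partial_{t^*_l},\partial_{t^*_k}]=(k-l)\,\partial_{t^*_{k+l-1}},$$ which holds in the sense of acting on $P$, $\bar P$ or $\mathcal L$, for $l,k\ge0$.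
   Context: Coefficient algebra: $S_2=\mathbb C[J]=\{aI_2+bJ: a,b\in\mathbb C\}$ with $J=\begin{bmatrix}0&1\\1&0\end{bmatrix}$, a commutative subalgebra of $gl(2,\mathbb C)$. All coefficients are $S_2$-valued functions of $x$ and of the times $t=(t_j)_{j\ge0}$, $y=(y_j)_{j\ge 0}$; $\epsilon$ is a parameter, $\partial=\partial/\partial x$, and $\Lambda$ is the shift $(\Lambda f)(x)=f(x+\epsilon)$. For an operator $\sum_k A_k\Lambda^k$, put $(\cdot)_+=\sum_{k\ge0}A_k\Lambda^k$ and $(\cdot)_-=\sum_{k<0}A_k\Lambda^k$. Dressing operators: $P=I_2+\omega_1(x)\Lambda^{-1}+\omega_2(x)\Lambda^{-2}+\cdots$ and $\bar P=\bar\omega_0(x)+\bar\omega_1(x)\Lambda+\bar\omega_2(x)\Lambda^2+\cdots$ (invertible), subject to the constraint $\mathcal L:=P\Lambda P^{-1}=\bar P\Lambda^{-1}\bar P^{-1}$, so that $\mathcal L=\Lambda+u(x)+v(x)\Lambda^{-1}$. Logarithms: $\log_+\mathcal L=P\,\epsilon\partial\,P^{-1}$, $\log_-\mathcal L=-\bar P\,\epsilon\partial\,\bar P^{-1}$, $\log\mathcal L=\tfrac12(\log_+\mathcal L+\log_-\mathcal L)$. With $c_j=\sum_{i=1}^j\frac1i$ ($c_0=0$), put for $j\ge0$: $B_j=\frac{\mathcal L^{j+1}}{(j+1)!}$ and $F_j=\frac{2\mathcal L^j}{j!}(\log\mathcal L-c_j)$. SCETH: the hierarchy of Sato equations, for all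 $j\ge0$, $\epsilon\partial_{t_j}P=-(B_j)_-P$, $\epsilon\partial_{t_j}\bar P=(B_j)_+\bar P$, $\epsilon\partial_{y_j}P=-(F_j)_-P$, $\epsilon\partial_{y_j}\bar P=(F_j)_+\bar P$. Orlov–Schulman operators: $\mathcal M=P\,\Gamma\,P^{-1}$, $\bar{\mathcal M}=\bar P\,\bar\Gamma\,\bar P^{-1}$ with $$\Gamma=\frac{x}{\epsilon}\Lambda^{-1}+\sum_{n\ge0}n\Lambda^{n-1}t_n+\sum_{n\ge0}\frac{1}{(n-1)!}\Lambda^{n-1}(\epsilon\partial-c_{n-1})y_n,$$ $$\bar\Gamma=\frac{-x}{\epsilon}\Lambda-\sum_{n\ge0}\frac{1}{(n-1)!}\Lambda^{-n+1}(-\epsilon\partial-c_n)y_n,$$ where $\frac{1}{(-1)!}=0$, so the $n=0$ terms vanish. The difference $\mathcal M-\bar{\mathcal M}$ is a pure difference operator (it contains no $\partial$). The $t^*_l$ are additional independent variables. *)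

theory Defs
  imports
    "HOL-Analysis.Analysis"
    "HOL-Library.Groups_Big_Fun"
    "HOL-Library.Function_Algebras"
begin

section \<open>The coefficient algebra\<close>

type_synonym mat2 = "complex^2^2"

definition exchange_matrix :: mat2 where
  "exchange_matrix = vector [vector [0, 1], vector [1, 0]]"

definition S2 :: "mat2 set" where
  "S2 = {mat a + mat b ** exchange_matrix | a b :: complex. True}"


section \<open>Difference-differential operators\<close>

text \<open>An element \<open>A\<close> of the following type stands for the formal, possibly two-sided infinite sum
  of the terms \<open>A k m \<Lambda>^k \<partial>^m\<close> over all \<open>k\<close> and \<open>m\<close>, with coefficients that are
  functions of \<open>x\<close>. The additive structure is the pointwise one.\<close>

type_synonym oper = "int \<Rightarrow> nat \<Rightarrow> real \<Rightarrow> mat2"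

definition mono_op :: "int \<Rightarrow> nat \<Rightarrow> (real \<Rightarrow> mat2) \<Rightarrow> oper" where
  "mono_op k m a = (\<lambda>k' m'. if k' = k \<and> m' = m then a else 0)"

definition one_op :: oper where
  "one_op = mono_op 0 0 (\<lambda>x. mat 1)"

definition Lam :: "int \<Rightarrow> oper" where
  "Lam k = mono_op k 0 (\<lambda>x. mat 1)"

definition eps_d :: "real \<Rightarrow> oper" where
  "eps_d \<epsilon> = mono_op 0 1 (\<lambda>x. \<epsilon> *\<^sub>R mat 1)"

definition scale_op :: "real \<Rightarrow> oper \<Rightarrow> oper" where
  "scale_op c A = (\<lambda>k m x. c *\<^sub>R A k m x)"

definition Dx :: "(real \<Rightarrow> mat2) \<Rightarrow> real \<Rightarrow> mat2" where
  "Dx f = (\<lambda>x. vector_derivative f (at x))"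

text \<open>The product is determined by
  \<open>(a \<Lambda>^k \<partial>^m) (b \<Lambda>^j \<partial>^n) = (\<Sum>r\<le>m. (m choose r) a (\<Lambda>^k \<partial>^r b) \<Lambda>^(k+j) \<partial>^(m-r+n))\<close>.
  In the coefficient of \<open>\<Lambda>^N \<partial>^q\<close> we thus have \<open>j = N - k\<close> and \<open>n = q - (m - r)\<close>.
  \<open>Sum_any\<close> sums over the nonzero summands; it is used only where, at each point, there
  are finitely many of them.\<close>

definition mult_op :: "oper \<Rightarrow> real \<Rightarrow> oper \<Rightarrow> oper"
    (\<open>(_ \<odot>\<^bsub>_\<^esub> _)\<close> [70, 0, 71] 70) where
  "A \<odot>\<^bsub>\<epsilon>\<^esub> B = (\<lambda>N q x. Sum_any (\<lambda>(k, m, r).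
     if r \<le> m \<and> m - r \<le> q
     then real (m choose r) *\<^sub>R
            (A k m x ** (Dx ^^ r) (B (N - k) (q - (m - r))) (x + of_int k * \<epsilon>))
     else 0))"

fun pow_op :: "real \<Rightarrow> oper \<Rightarrow> nat \<Rightarrow> oper" where
  "pow_op \<epsilon> A 0 = one_op"
| "pow_op \<epsilon> A (Suc n) = pow_op \<epsilon> A n \<odot>\<^bsub>\<epsilon>\<^esub> A"

definition plus_part :: "oper \<Rightarrow> oper" where
  "plus_part A = (\<lambda>k m. if k \<ge> 0 then A k m else 0)"

definition minus_part :: "oper \<Rightarrow> oper" where
  "minus_part A = (\<lambda>k m. if k < 0 then A k m else 0)"

text \<open>Pure difference operators containing only powers \<open>\<Lambda>^k\<close> with \<open>k \<le> 0\<close>, respectively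
  \<open>k \<ge> 0\<close>. Inverses of dressing operators are taken within these two classes.\<close>

definition lower_op :: "oper \<Rightarrow> bool" where
  "lower_op A \<longleftrightarrow> (\<forall>k m. k > 0 \<or> m > 0 \<longrightarrow> A k m = 0)"

definition upper_op :: "oper \<Rightarrow> bool" where
  "upper_op A \<longleftrightarrow> (\<forall>k m. k < 0 \<or> m > 0 \<longrightarrow> A k m = 0)"

definition inverse_of :: "real \<Rightarrow> oper \<Rightarrow> oper \<Rightarrow> bool" where
  "inverse_of \<epsilon> A Q \<longleftrightarrow> A \<odot>\<^bsub>\<epsilon>\<^esub> Q = one_op \<and> Q \<odot>\<^bsub>\<epsilon>\<^esub> A = one_op"

definition inv_lower :: "real \<Rightarrow> oper \<Rightarrow> oper" where
  "inv_lower \<epsilon> A = (THE Q. lower_op Q \<and> inverse_of \<epsilon> A Q)"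

definition inv_upper :: "real \<Rightarrow> oper \<Rightarrow> oper" where
  "inv_upper \<epsilon> A = (THE Q. upper_op Q \<and> inverse_of \<epsilon> A Q)"


section \<open>Dressing operators, Lax operator and logarithms\<close>

definition dressing :: "real \<Rightarrow> oper \<Rightarrow> oper \<Rightarrow> bool" where
  "dressing \<epsilon> P Pb \<longleftrightarrow>
     lower_op P \<and> P 0 0 = (\<lambda>x. mat 1) \<and>
     upper_op Pb \<and> (\<exists>Q. upper_op Q \<and> inverse_of \<epsilon> Pb Q) \<and>
     (\<forall>k m x. P k m x \<in> S2 \<and> Pb k m x \<in> S2) \<and>
     P \<odot>\<^bsub>\<epsilon>\<^esub> Lam 1 \<odot>\<^bsub>\<epsilon>\<^esub> inv_lower \<epsilon> P = Pb \<odot>\<^bsub>\<epsilon>\<^esub> Lam (-1) \<odot>\<^bsub>\<epsilon>\<^esub> inv_upper \<epsilon> Pb"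

definition Lax :: "real \<Rightarrow> oper \<Rightarrow> oper" where
  "Lax \<epsilon> P = P \<odot>\<^bsub>\<epsilon>\<^esub> Lam 1 \<odot>\<^bsub>\<epsilon>\<^esub> inv_lower \<epsilon> P"

definition log_plus :: "real \<Rightarrow> oper \<Rightarrow> oper" where
  "log_plus \<epsilon> P = P \<odot>\<^bsub>\<epsilon>\<^esub> eps_d \<epsilon> \<odot>\<^bsub>\<epsilon>\<^esub> inv_lower \<epsilon> P"

definition log_minus :: "real \<Rightarrow> oper \<Rightarrow> oper" where
  "log_minus \<epsilon> Pb = - (Pb \<odot>\<^bsub>\<epsilon>\<^esub> eps_d \<epsilon> \<odot>\<^bsub>\<epsilon>\<^esub> inv_upper \<epsilon> Pb)"

definition log_Lax :: "real \<Rightarrow> oper \<Rightarrow> oper \<Rightarrow> oper" where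
  "log_Lax \<epsilon> P Pb = scale_op (1/2) (log_plus \<epsilon> P + log_minus \<epsilon> Pb)"

definition B_op :: "real \<Rightarrow> oper \<Rightarrow> nat \<Rightarrow> oper" where
  "B_op \<epsilon> P j = scale_op (1 / fact (j + 1)) (pow_op \<epsilon> (Lax \<epsilon> P) (j + 1))"

definition F_op :: "real \<Rightarrow> oper \<Rightarrow> oper \<Rightarrow> nat \<Rightarrow> oper" where
  "F_op \<epsilon> P Pb j =
     scale_op (2 / fact j) (pow_op \<epsilon> (Lax \<epsilon> P) j)
       \<odot>\<^bsub>\<epsilon>\<^esub> (log_Lax \<epsilon> P Pb - scale_op (harm j) one_op)"


section \<open>The hierarchy\<close>

text \<open>Time sequences have finite support, so that the sums over all times in the Orlov--Schulman
  operators below are finite.\<close>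

type_synonym time_seq = "nat \<Rightarrow> real"

definition finite_supp :: "time_seq \<Rightarrow> bool" where
  "finite_supp t \<longleftrightarrow> finite {n. t n \<noteq> 0}"

definition has_op_derivative :: "(real \<Rightarrow> oper) \<Rightarrow> oper \<Rightarrow> real \<Rightarrow> bool" where
  "has_op_derivative A D s \<longleftrightarrow>
     (\<forall>k m x. ((\<lambda>s. A s k m x) has_vector_derivative D k m x) (at s))"

definition SCETH ::
    "real \<Rightarrow> (time_seq \<Rightarrow> time_seq \<Rightarrow> oper) \<Rightarrow> (time_seq \<Rightarrow> time_seq \<Rightarrow> oper) \<Rightarrow> bool" where
  "SCETH \<epsilon> P Pb \<longleftrightarrow> (\<forall>t y. finite_supp t \<and> finite_supp y \<longrightarrow>
     dressing \<epsilon> (P t y) (Pb t y) \<and>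
     (\<forall>j.
       has_op_derivative (\<lambda>s. scale_op \<epsilon> (P (t(j := s)) y))
         (- minus_part (B_op \<epsilon> (P t y) j) \<odot>\<^bsub>\<epsilon>\<^esub> P t y) (t j) \<and>
       has_op_derivative (\<lambda>s. scale_op \<epsilon> (Pb (t(j := s)) y))
         (plus_part (B_op \<epsilon> (P t y) j) \<odot>\<^bsub>\<epsilon>\<^esub> Pb t y) (t j) \<and>
       has_op_derivative (\<lambda>s. scale_op \<epsilon> (P t (y(j := s))))
         (- minus_part (F_op \<epsilon> (P t y) (Pb t y) j) \<odot>\<^bsub>\<epsilon>\<^esub> P t y) (y j) \<and>
       has_op_derivative (\<lambda>s. scale_op \<epsilon> (Pb t (y(j := s))))
         (plus_part (F_op \<epsilon> (P t y) (Pb t y) j) \<odot>\<^bsub>\<epsilon>\<^esub> Pb t y) (y j)))"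


section \<open>Orlov--Schulman operators\<close>

definition inv_fact_pred :: "nat \<Rightarrow> real" where  \<comment> \<open>\<open>1 / (n - 1)!\<close> with \<open>1 / (-1)! = 0\<close>\<close>
  "inv_fact_pred n = (if n = 0 then 0 else 1 / fact (n - 1))"

definition x_over_eps :: "real \<Rightarrow> real \<Rightarrow> mat2" where
  "x_over_eps \<epsilon> = (\<lambda>x. (x / \<epsilon>) *\<^sub>R mat 1)"

text \<open>In \<open>Gam\<close> the index of \<open>harm (n - 1)\<close> is truncated for \<open>n = 0\<close>, where the summand
  vanishes.\<close>

definition Gam :: "real \<Rightarrow> time_seq \<Rightarrow> time_seq \<Rightarrow> oper" where
  "Gam \<epsilon> t y =
     mono_op (-1) 0 (x_over_eps \<epsilon>)
     + Sum_any (\<lambda>n. scale_op (real n * t n) (Lam (int n - 1)))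
     + Sum_any (\<lambda>n. scale_op (inv_fact_pred n * y n)
         (Lam (int n - 1) \<odot>\<^bsub>\<epsilon>\<^esub> (eps_d \<epsilon> - scale_op (harm (n - 1)) one_op)))"

definition Gam_bar :: "real \<Rightarrow> time_seq \<Rightarrow> oper" where
  "Gam_bar \<epsilon> y =
     mono_op 1 0 (- x_over_eps \<epsilon>)
     - Sum_any (\<lambda>n. scale_op (inv_fact_pred n * y n)
         (Lam (- int n + 1) \<odot>\<^bsub>\<epsilon>\<^esub> (- eps_d \<epsilon> - scale_op (harm n) one_op)))"

definition OS :: "real \<Rightarrow> time_seq \<Rightarrow> time_seq \<Rightarrow> oper \<Rightarrow> oper" where
  "OS \<epsilon> t y P = P \<odot>\<^bsub>\<epsilon>\<^esub> Gam \<epsilon> t y \<odot>\<^bsub>\<epsilon>\<^esub> inv_lower \<epsilon> P"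

definition OS_bar :: "real \<Rightarrow> time_seq \<Rightarrow> oper \<Rightarrow> oper" where
  "OS_bar \<epsilon> y Pb = Pb \<odot>\<^bsub>\<epsilon>\<^esub> Gam_bar \<epsilon> y \<odot>\<^bsub>\<epsilon>\<^esub> inv_upper \<epsilon> Pb"


section \<open>Additional flows\<close>

text \<open>The additional flows do not commute, so smooth dressing operators cannot in general
  depend on all the \<open>t*_l\<close> jointly: the mixed partial derivatives would agree. The flows are
  therefore vector fields on a phase space \<open>'s\<close>, whose points \<open>\<sigma>\<close> parametrise pairs of
  dressing operators, and
  \<open>\<Phi> l s \<sigma>\<close> is the point reached from \<open>\<sigma>\<close> along the \<open>l\<close>-th flow
  after the increment \<open>s\<close> of \<open>t*_l\<close>. The partial derivative with respect to \<open>t*_l\<close> is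
  differentiation along that curve; \<open>x\<close> and the times of the hierarchy are kept fixed. Functions of
  \<open>x\<close>, \<open>t\<close>, \<open>y\<close> and \<open>t*\<close> are the case \<open>'s = nat \<Rightarrow> real\<close>,
  \<open>\<Phi> l s \<sigma> = \<sigma>(l := \<sigma> l + s)\<close>.

  The constraint between \<open>P\<close> and \<open>Pb\<close> is meant to hold at all points of the phase space. The
  Sato equations are only required at the point at which the commutator is taken: whether
  the flows preserve them is a different question.\<close>

definition flow_differentiable ::
    "(nat \<Rightarrow> real \<Rightarrow> 's \<Rightarrow> 's) \<Rightarrow> nat \<Rightarrow> ('s \<Rightarrow> oper) \<Rightarrow> 's \<Rightarrow> bool" where
  "flow_differentiable \<Phi> l A \<sigma> \<longleftrightarrow>
     (\<forall>k m x. (\<lambda>s. A (\<Phi> l s \<sigma>) k m x) differentiable (at 0))"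

definition flow_deriv ::
    "(nat \<Rightarrow> real \<Rightarrow> 's \<Rightarrow> 's) \<Rightarrow> nat \<Rightarrow> ('s \<Rightarrow> oper) \<Rightarrow> 's \<Rightarrow> oper" where
  "flow_deriv \<Phi> l A = (\<lambda>\<sigma> k m x. vector_derivative (\<lambda>s. A (\<Phi> l s \<sigma>) k m x) (at 0))"

text \<open>\<open>[\<partial>_l, \<partial>_k] A = (k - l) \<partial>_(k+l-1) A\<close>, including the existence of all
  derivatives that occur. For \<open>k = l = 0\<close> the factor \<open>k - l\<close> vanishes and the truncated index
  \<open>k + l - 1\<close> is irrelevant.\<close>

definition virasoro_relation ::
    "(nat \<Rightarrow> real \<Rightarrow> 's \<Rightarrow> 's) \<Rightarrow> nat \<Rightarrow> nat \<Rightarrow> ('s \<Rightarrow> oper) \<Rightarrow> 's \<Rightarrow> bool" where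
  "virasoro_relation \<Phi> l k A \<sigma> \<longleftrightarrow>
     (\<forall>i \<tau>. flow_differentiable \<Phi> i A \<tau>) \<and>
     flow_differentiable \<Phi> l (flow_deriv \<Phi> k A) \<sigma> \<and>
     flow_differentiable \<Phi> k (flow_deriv \<Phi> l A) \<sigma> \<and>
     flow_deriv \<Phi> l (flow_deriv \<Phi> k A) \<sigma> - flow_deriv \<Phi> k (flow_deriv \<Phi> l A) \<sigma>
       = scale_op (real k - real l) (flow_deriv \<Phi> (k + l - 1) A \<sigma>)"

fun Ck_on :: "nat \<Rightarrow> (real \<times> real) set \<Rightarrow> (real \<times> real \<Rightarrow> mat2) \<Rightarrow> bool" where
  "Ck_on 0 U f \<longleftrightarrow> continuous_on U f"
| "Ck_on (Suc n) U f \<longleftrightarrow> (\<exists>f1 f2.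
     (\<forall>z\<in>U. (f has_derivative (\<lambda>h. fst h *\<^sub>R f1 z + snd h *\<^sub>R f2 z)) (at z)) \<and>
     Ck_on n U f1 \<and> Ck_on n U f2)"

text \<open>The coefficients are smooth functions of \<open>(x, t*_l)\<close> along each flow, near
  \<open>t*_l = 0\<close>. Hence differentiation along the flow commutes with \<open>\<partial>\<close>.\<close>

definition smooth_along_flows ::
    "(nat \<Rightarrow> real \<Rightarrow> 's \<Rightarrow> 's) \<Rightarrow> ('s \<Rightarrow> oper) \<Rightarrow> bool" where
  "smooth_along_flows \<Phi> A \<longleftrightarrow>
     (\<forall>l \<sigma> k m. \<exists>U. open U \<and> UNIV \<times> {0} \<subseteq> U \<and>
        (\<forall>n. Ck_on n U (\<lambda>(x, s). A (\<Phi> l s \<sigma>) k m x)))"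

definition additional_generator ::
    "real \<Rightarrow> time_seq \<Rightarrow> time_seq \<Rightarrow> oper \<Rightarrow> oper \<Rightarrow> nat \<Rightarrow> oper" where
  "additional_generator \<epsilon> t y P Pb l =
     (OS \<epsilon> t y P - OS_bar \<epsilon> y Pb) \<odot>\<^bsub>\<epsilon>\<^esub> pow_op \<epsilon> (Lax \<epsilon> P) l"

definition additional_flows ::
    "real \<Rightarrow> time_seq \<Rightarrow> time_seq \<Rightarrow> ('s \<Rightarrow> oper) \<Rightarrow> ('s \<Rightarrow> oper)
      \<Rightarrow> (nat \<Rightarrow> real \<Rightarrow> 's \<Rightarrow> 's) \<Rightarrow> bool" where
  "additional_flows \<epsilon> t y P Pb \<Phi> \<longleftrightarrow> (\<forall>l \<sigma>.
     has_op_derivative (\<lambda>s. P (\<Phi> l s \<sigma>))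
       (- minus_part (additional_generator \<epsilon> t y (P \<sigma>) (Pb \<sigma>) l) \<odot>\<^bsub>\<epsilon>\<^esub> P \<sigma>) 0 \<and>
     has_op_derivative (\<lambda>s. Pb (\<Phi> l s \<sigma>))
       (plus_part (additional_generator \<epsilon> t y (P \<sigma>) (Pb \<sigma>) l) \<odot>\<^bsub>\<epsilon>\<^esub> Pb \<sigma>) 0)"

end

theory Submission
  imports Defs
begin

text \<open>Conjugation by the dressing operators turns \<open>[\<Lambda>, \<Gamma>] = 1\<close> and
  \<open>[\<Lambda>^(-1), \<Gamma>-bar] = 1\<close> into \<open>[L, M] = [L, M-bar] = 1\<close>, so that \<open>A l = M L^l\<close>
  satisfies \<open>[A l, A k] = (l - k) A (k + l - 1)\<close>, and likewise \<open>Ab l = M-bar L^l\<close>. The first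
  family lives in the ring of operators with powers of \<open>\<Lambda>\<close> bounded above, the second in the
  ring with powers bounded below; the generator \<open>W l = A l - Ab l\<close> is two-sided and lies in
  neither. The flows act as \<open>P' = g P\<close> and \<open>Pb' = gb Pb\<close> with \<open>g = - (W l)_-\<close> and
  \<open>gb = (W l)_+\<close>, hence by commutators with \<open>g\<close> and \<open>gb\<close> on \<open>A k\<close> and \<open>Ab k\<close>. Since
  \<open>A l + g l = Ab l + gb l\<close> is banded, the computation splits into legitimate ones in the two rings
  and yields a zero curvature equation for \<open>g\<close> and for \<open>gb\<close>, which gives the relation on \<open>P\<close>,
  \<open>Pb\<close> and \<open>L\<close>.

  On the analytic side, differentiation along a flow has to commute with \<open>\<partial>\<close>, because the
  coefficients of \<open>M\<close> contain \<open>x\<close>-derivatives of those of the inverse of \<open>P\<close>; this is the symmetry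
  of the mixed second derivatives.\<close>

section \<open>Calculus of smooth matrix functions\<close>

text \<open>\<open>mult_op\<close> is total: a coefficient with infinitely many nonzero
  contributions is 0 by the convention of \<open>Sum_any\<close>. Ring laws can therefore fail for
  two-sided series, and every identity has to name a direction. The bridge between the two rings is
  the constraint: L is both P \<Lambda> P^(-1) and Pb \<Lambda>^(-1) Pb^(-1), so it is bounded on
  both sides, and M - Mb may be multiplied by its powers. The parts W_- and W_+ occupy one side
  each, and so do the brackets of the g's and of the gb's; hence one two-sided identity, projected
  onto negative and nonnegative powers, separates into the two zero curvature equations. As to the
  sign, g l and gb l agree with - A l and - Ab l up to a common banded operator, and passing to the
  negatives turns the structure constant l - k into k - l. \<Phi> is not assumed to be a
  one-parameter group, so derivatives along it are taken at increment 0 only.\<close>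

lemma bounded_bilinear_mat2: "bounded_bilinear ((**) :: mat2 \<Rightarrow> mat2 \<Rightarrow> mat2)"
proof -
  have "bilinear ((**) :: mat2 \<Rightarrow> mat2 \<Rightarrow> mat2)"
    unfolding bilinear_def
    by (auto intro!: linearI simp: matrix_matrix_mult_def vec_eq_iff UNIV_2 algebra_simps)
  then show ?thesis
    by (simp add: bilinear_conv_bounded_bilinear)
qed

interpretation mat2: bounded_bilinear "(**) :: mat2 \<Rightarrow> mat2 \<Rightarrow> mat2"
  by (rule bounded_bilinear_mat2)

section \<open>Functions with derivatives of all orders in x\<close>

lemma has_vector_derivative_Dx:
  "f differentiable (at x) \<Longrightarrow> (f has_vector_derivative Dx f x) (at x)"
  by (simp add: Dx_def vector_derivative_works)

lemma Dx_eqI: "(\<And>x. (f has_vector_derivative f' x) (at x)) \<Longrightarrow> Dx f = f'"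
  by (auto simp: Dx_def fun_eq_iff intro: vector_derivative_at)

lemma Dx_const [simp]: "Dx (\<lambda>x. a) = (\<lambda>x. 0)"
  by (rule Dx_eqI) (rule has_vector_derivative_const)

lemma Dx_zero [simp]: "Dx 0 = 0"
  by (simp add: zero_fun_def)

fun n_diff :: "nat \<Rightarrow> (real \<Rightarrow> mat2) \<Rightarrow> bool" where
  "n_diff 0 f \<longleftrightarrow> True"
| "n_diff (Suc n) f \<longleftrightarrow> (\<forall>x. f differentiable (at x)) \<and> n_diff n (Dx f)"

definition smooth :: "(real \<Rightarrow> mat2) \<Rightarrow> bool" where
  "smooth f \<longleftrightarrow> (\<forall>n. n_diff n f)"

lemma n_diff_SucD: "n_diff (Suc n) f \<Longrightarrow> n_diff n f"
  by (induction n arbitrary: f) auto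

lemma n_diff_add: "n_diff n f \<Longrightarrow> n_diff n g \<Longrightarrow> n_diff n (\<lambda>x. f x + g x)"
proof (induction n arbitrary: f g)
  case (Suc n)
  have "Dx (\<lambda>x. f x + g x) = (\<lambda>x. Dx f x + Dx g x)"
    using Suc.prems by (intro Dx_eqI has_vector_derivative_add has_vector_derivative_Dx) auto
  then show ?case using Suc by simp
qed simp

lemma n_diff_scaleR: "n_diff n f \<Longrightarrow> n_diff n (\<lambda>x. c *\<^sub>R f x)"
proof (induction n arbitrary: f)
  case (Suc n)
  have *: "((\<lambda>x. c *\<^sub>R f x) has_vector_derivative c *\<^sub>R Dx f x) (at x)" for x
    using bounded_linear.has_vector_derivative[OF bounded_linear_scaleR_right
        has_vector_derivative_Dx, of f x c] Suc.prems
    by simp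
  then have "Dx (\<lambda>x. c *\<^sub>R f x) = (\<lambda>x. c *\<^sub>R Dx f x)"
    by (rule Dx_eqI)
  then show ?case using Suc * by (auto intro: differentiableI_vector)
qed simp

lemma n_diff_mult: "n_diff n f \<Longrightarrow> n_diff n g \<Longrightarrow> n_diff n (\<lambda>x. f x ** g x)"
proof (induction n arbitrary: f g)
  case (Suc n)
  have *: "((\<lambda>x. f x ** g x) has_vector_derivative f x ** Dx g x + Dx f x ** g x) (at x)" for x
    using Suc.prems by (intro mat2.has_vector_derivative has_vector_derivative_Dx) auto
  then have "Dx (\<lambda>x. f x ** g x) = (\<lambda>x. f x ** Dx g x + Dx f x ** g x)"
    by (rule Dx_eqI)
  moreover have "n_diff n (\<lambda>x. f x ** Dx g x + Dx f x ** g x)"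
    using Suc n_diff_SucD by (intro n_diff_add) auto
  ultimately show ?case using * by (auto intro: differentiableI_vector)
qed simp

lemma has_vector_derivative_shift:
  fixes f :: "real \<Rightarrow> 'a::real_normed_vector"
  shows "(f has_vector_derivative D) (at (x + c)) \<Longrightarrow>
    ((\<lambda>x. f (x + c)) has_vector_derivative D) (at x)"
  using vector_diff_chain_at[of "\<lambda>x. x + c" 1 x f D]
  by (simp add: o_def has_vector_derivative_add_const)

lemma n_diff_shift: "n_diff n f \<Longrightarrow> n_diff n (\<lambda>x. f (x + c))"
proof (induction n arbitrary: f)
  case (Suc n)
  have *: "((\<lambda>x. f (x + c)) has_vector_derivative Dx f (x + c)) (at x)" for x
    using Suc.prems by (intro has_vector_derivative_shift has_vector_derivative_Dx) auto
  then have "Dx (\<lambda>x. f (x + c)) = (\<lambda>x. Dx f (x + c))"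
    by (rule Dx_eqI)
  then show ?case using Suc * by (auto intro: differentiableI_vector)
qed simp

lemma n_diff_const: "n_diff n (\<lambda>x. a)"
  by (induction n arbitrary: a) auto

lemma smooth_Dx: "smooth f \<Longrightarrow> smooth (Dx f)"
  unfolding smooth_def by (metis n_diff.simps(2))

lemma smooth_differentiable: "smooth f \<Longrightarrow> f differentiable (at x)"
  unfolding smooth_def by (metis n_diff.simps(2))

lemma smooth_has_derivative: "smooth f \<Longrightarrow> (f has_vector_derivative Dx f x) (at x)"
  by (simp add: has_vector_derivative_Dx smooth_differentiable)

lemma smoothI: "(\<And>x. f differentiable (at x)) \<Longrightarrow> smooth (Dx f) \<Longrightarrow> smooth f"
  unfolding smooth_def by (metis n_diff.simps not0_implies_Suc)

lemma smooth_const: "smooth (\<lambda>x. a)"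
  by (simp add: smooth_def n_diff_const)

lemma smooth_zero [simp]: "smooth 0"
  using smooth_const[of 0] by (simp add: zero_fun_def)

lemma smooth_add: "smooth f \<Longrightarrow> smooth g \<Longrightarrow> smooth (\<lambda>x. f x + g x)"
  by (simp add: smooth_def n_diff_add)

lemma smooth_scaleR: "smooth f \<Longrightarrow> smooth (\<lambda>x. c *\<^sub>R f x)"
  by (simp add: smooth_def n_diff_scaleR)

lemma smooth_mult: "smooth f \<Longrightarrow> smooth g \<Longrightarrow> smooth (\<lambda>x. f x ** g x)"
  by (simp add: smooth_def n_diff_mult)

lemma smooth_shift: "smooth f \<Longrightarrow> smooth (\<lambda>x. f (x + c))"
  by (simp add: smooth_def n_diff_shift)

lemma smooth_uminus: "smooth f \<Longrightarrow> smooth (\<lambda>x. - f x)"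
  using smooth_scaleR[of f "-1"] by simp

lemma smooth_sum: "(\<And>i. i \<in> I \<Longrightarrow> smooth (f i)) \<Longrightarrow> smooth (\<lambda>x. \<Sum>i\<in>I. f i x)"
  by (induction I rule: infinite_finite_induct) (auto intro: smooth_add smooth_const)

lemma smooth_Dx_pow: "smooth f \<Longrightarrow> smooth ((Dx ^^ r) f)"
  by (induction r) (auto intro: smooth_Dx)

text \<open>Differentiation in the parameter at \<open>0\<close> commutes with the first \<open>n\<close> derivatives in \<open>x\<close>.\<close>

fun family_deriv :: "nat \<Rightarrow> (real \<Rightarrow> real \<Rightarrow> mat2) \<Rightarrow> (real \<Rightarrow> mat2) \<Rightarrow> bool" where
  "family_deriv 0 f f' \<longleftrightarrow> (\<forall>x. ((\<lambda>s. f s x) has_vector_derivative f' x) (at 0))"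
| "family_deriv (Suc n) f f' \<longleftrightarrow> (\<forall>x. ((\<lambda>s. f s x) has_vector_derivative f' x) (at 0)) \<and>
     family_deriv n (\<lambda>s. Dx (f s)) (Dx f')"

text \<open>Smoothness in x is required for every s, because each \<open>f s\<close> will be a
  coefficient at some point of the phase space; the derivative in s is required only at 0, where the
  flows supply it.\<close>

definition smooth_family :: "(real \<Rightarrow> real \<Rightarrow> mat2) \<Rightarrow> (real \<Rightarrow> mat2) \<Rightarrow> bool" where
  "smooth_family f f' \<longleftrightarrow> (\<forall>s. smooth (f s)) \<and> smooth f' \<and> (\<forall>n. family_deriv n f f')"

lemma family_deriv_SucD: "family_deriv (Suc n) f f' \<Longrightarrow> family_deriv n f f'"
  by (induction n arbitrary: f f') auto

lemma family_derivD: "family_deriv n f f' \<Longrightarrow> ((\<lambda>s. f s x) has_vector_derivative f' x) (at 0)"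
  by (cases n) auto

lemma family_deriv_const: "family_deriv n (\<lambda>s. f) (\<lambda>x. 0)"
  by (induction n arbitrary: f) auto

lemma Dx_add: "smooth f \<Longrightarrow> smooth g \<Longrightarrow> Dx (\<lambda>x. f x + g x) = (\<lambda>x. Dx f x + Dx g x)"
  by (intro Dx_eqI has_vector_derivative_add smooth_has_derivative)

lemma Dx_scaleR: "smooth f \<Longrightarrow> Dx (\<lambda>x. c *\<^sub>R f x) = (\<lambda>x. c *\<^sub>R Dx f x)"
  by (intro Dx_eqI bounded_linear.has_vector_derivative[OF bounded_linear_scaleR_right]
      smooth_has_derivative)

lemma Dx_mult: "smooth f \<Longrightarrow> smooth g \<Longrightarrow>
    Dx (\<lambda>x. f x ** g x) = (\<lambda>x. f x ** Dx g x + Dx f x ** g x)"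
  by (intro Dx_eqI mat2.has_vector_derivative smooth_has_derivative)

lemma Dx_shift: "smooth f \<Longrightarrow> Dx (\<lambda>x. f (x + c)) = (\<lambda>x. Dx f (x + c))"
  by (intro Dx_eqI has_vector_derivative_shift smooth_has_derivative)

lemma Dx_sum: "(\<And>i. i \<in> I \<Longrightarrow> smooth (f i)) \<Longrightarrow>
    Dx (\<lambda>x. \<Sum>i\<in>I. f i x) = (\<lambda>x. \<Sum>i\<in>I. Dx (f i) x)"
  by (intro Dx_eqI has_vector_derivative_sum smooth_has_derivative)

lemma family_deriv_add:
  "family_deriv n f f' \<Longrightarrow> family_deriv n g g' \<Longrightarrow> (\<And>s. smooth (f s)) \<Longrightarrow> (\<And>s. smooth (g s)) \<Longrightarrow>
   smooth f' \<Longrightarrow> smooth g' \<Longrightarrow> family_deriv n (\<lambda>s x. f s x + g s x) (\<lambda>x. f' x + g' x)"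
proof (induction n arbitrary: f f' g g')
  case (Suc n)
  then show ?case
    by (auto simp: Dx_add intro!: has_vector_derivative_add Suc.IH smooth_Dx)
qed (auto intro!: has_vector_derivative_add)

text \<open>The x-derivative of a product is a sum of two products, each with one factor
  differentiated. The induction therefore keeps both factors arbitrary and applies its hypothesis to
  (f, Dx g) and to (Dx f, g).\<close>

lemma family_deriv_mult:
  "family_deriv n f f' \<Longrightarrow> family_deriv n g g' \<Longrightarrow> (\<And>s. smooth (f s)) \<Longrightarrow> (\<And>s. smooth (g s)) \<Longrightarrow>
   smooth f' \<Longrightarrow> smooth g' \<Longrightarrow>
   family_deriv n (\<lambda>s x. f s x ** g s x) (\<lambda>x. f 0 x ** g' x + f' x ** g 0 x)"
proof (induction n arbitrary: f f' g g')
  case 0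
  then show ?case
    by (auto intro!: mat2.has_vector_derivative)
next
  case (Suc n)
  have f: "family_deriv n f f'" and g: "family_deriv n g g'"
    and f1: "family_deriv n (\<lambda>s. Dx (f s)) (Dx f')" and g1: "family_deriv n (\<lambda>s. Dx (g s)) (Dx g')"
    using Suc.prems family_deriv_SucD by auto
  have "family_deriv n (\<lambda>s x. f s x ** Dx (g s) x + Dx (f s) x ** g s x)
      (\<lambda>x. (f 0 x ** Dx g' x + f' x ** Dx (g 0) x) + (Dx (f 0) x ** g' x + Dx f' x ** g 0 x))"
    by (intro family_deriv_add Suc.IH f g f1 g1 smooth_add smooth_mult smooth_Dx Suc.prems)
  moreover have "Dx (\<lambda>x. f 0 x ** g' x + f' x ** g 0 x) =
      (\<lambda>x. (f 0 x ** Dx g' x + f' x ** Dx (g 0) x) + (Dx (f 0) x ** g' x + Dx f' x ** g 0 x))"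
    using Suc.prems by (simp add: Dx_add Dx_mult smooth_mult algebra_simps)
  moreover have "((\<lambda>s. f s x ** g s x) has_vector_derivative f 0 x ** g' x
      + f' x ** g 0 x) (at 0)" for x
    using Suc.prems by (auto intro!: mat2.has_vector_derivative)
  ultimately show ?case
    using Suc.prems by (simp add: Dx_mult)
qed

lemma family_deriv_shift:
  "family_deriv n f f' \<Longrightarrow> (\<And>s. smooth (f s)) \<Longrightarrow> smooth f' \<Longrightarrow> family_deriv n (\<lambda>s x. f s (x
      + c)) (\<lambda>x. f' (x + c))"
proof (induction n arbitrary: f f')
  case (Suc n)
  then show ?case by (auto simp: Dx_shift intro!: Suc.IH smooth_Dx)
qed auto

lemma smooth_familyD: "smooth_family f f' \<Longrightarrow> ((\<lambda>s. f s x) has_vector_derivative f' x) (at 0)"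
  by (auto simp: smooth_family_def intro: family_derivD[of 0])

lemma smooth_family_const: "smooth f \<Longrightarrow> smooth_family (\<lambda>s. f) (\<lambda>x. 0)"
  by (simp add: smooth_family_def family_deriv_const smooth_const)

lemma smooth_family_add: "smooth_family f f' \<Longrightarrow> smooth_family g g' \<Longrightarrow> smooth_family (\<lambda>s x. f s x
    + g s x) (\<lambda>x. f' x + g' x)"
  by (simp add: smooth_family_def smooth_add family_deriv_add)

lemma smooth_family_mult: "smooth_family f f' \<Longrightarrow> smooth_family g g' \<Longrightarrow>
    smooth_family (\<lambda>s x. f s x ** g s x) (\<lambda>x. f 0 x ** g' x + f' x ** g 0 x)"
  by (simp add: smooth_family_def smooth_add smooth_mult family_deriv_mult)

lemma smooth_family_shift: "smooth_family f f' \<Longrightarrow> smooth_family (\<lambda>s x. f s (x + c)) (\<lambda>x. f' (x + c))"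
  by (simp add: smooth_family_def smooth_shift family_deriv_shift)

lemma smooth_family_Dx: "smooth_family f f' \<Longrightarrow> smooth_family (\<lambda>s. Dx (f s)) (Dx f')"
  unfolding smooth_family_def by (metis family_deriv.simps(2) smooth_Dx)

lemma smooth_family_scaleR:
  assumes "smooth_family f f'" shows "smooth_family (\<lambda>s x. c *\<^sub>R f s x) (\<lambda>x. c *\<^sub>R f' x)"
  using smooth_family_mult[OF smooth_family_const[OF smooth_const, of "c *\<^sub>R mat 1"] assms]
  by (simp add: mat2.scaleR_left)

lemma smooth_family_uminus: "smooth_family f f' \<Longrightarrow> smooth_family (\<lambda>s x. - f s x) (\<lambda>x. - f' x)"
  using smooth_family_scaleR[of f f' "-1"] by simp

lemma smooth_family_sum: "(\<And>i. i \<in> I \<Longrightarrow> smooth_family (f i) (f' i)) \<Longrightarrow>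
    smooth_family (\<lambda>s x. \<Sum>i\<in>I. f i s x) (\<lambda>x. \<Sum>i\<in>I. f' i x)"
proof (induction I rule: infinite_finite_induct)
  case (insert i I)
  then show ?case using smooth_family_add[of "f i" "f' i"] by simp
qed (auto intro: smooth_family_const smooth_const)

section \<open>Derivatives of inverse matrix functions\<close>

text \<open>By Cramer's rule the entries of \<open>G\<close> are rational functions of those of
  \<open>F\<close> with the nonvanishing denominator det F, so \<open>G\<close> is differentiable;
  the value of the derivative then follows by differentiating F G = 1.\<close>

lemma mat2_inverse_has_vector_derivative:
  fixes F G :: "real \<Rightarrow> mat2"
  assumes F: "(F has_vector_derivative F') (at u)"
    and inv: "\<And>v. F v ** G v = mat 1" "\<And>v. G v ** F v = mat 1"
  shows "(G has_vector_derivative - (G u ** F' ** G u)) (at u)"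
proof -
  have det: "det (F v) \<noteq> 0" for v
    using det_mul[of "F v" "G v"] inv by auto
  have Fij: "((\<lambda>v. F v $ i $ j) has_vector_derivative F' $ i $ j) (at u)" for i j
    using bounded_linear.has_vector_derivative[OF bounded_linear_compose[OF bounded_linear_vec_nth
        bounded_linear_vec_nth] F]
    by simp
  have eqs: "F v $ 1 $ 1 * G v $ 1 $ 1 + F v $ 1 $ 2 * G v $ 2 $ 1 = 1"
     "F v $ 1 $ 1 * G v $ 1 $ 2 + F v $ 1 $ 2 * G v $ 2 $ 2 = 0"
     "F v $ 2 $ 1 * G v $ 1 $ 1 + F v $ 2 $ 2 * G v $ 2 $ 1 = 0"
     "F v $ 2 $ 1 * G v $ 1 $ 2 + F v $ 2 $ 2 * G v $ 2 $ 2 = 1" for v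
    using inv(1)[of v] by (auto simp: vec_eq_iff matrix_matrix_mult_def mat_def UNIV_2)
  \<comment> \<open>The entries of the 2x2 adjugate, written uniformly in the indices: the diagonal
    ones are swapped, the others change sign.\<close>
  define adj :: "real \<Rightarrow> 2 \<Rightarrow> 2 \<Rightarrow> complex" where
    "adj v i j = (if i = j then F v $ (if i = 1 then 2 else 1) $ (if i =
        1 then 2 else 1) else - F v $ i $ j)" for v i j
  have G: "G v $ i $ j = adj v i j / det (F v)" for v i j
  proof -
    have "det (F v) * G v $ i $ j = adj v i j"
    proof -
      have "det (F v) * G v $ 1 $ 1 = F v $ 2 $ 2" "det (F v) * G v $ 1 $ 2 = - F v $ 1 $ 2"
        "det (F v) * G v $ 2 $ 1 = - F v $ 2 $ 1" "det (F v) * G v $ 2 $ 2 = F v $ 1 $ 1"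
        unfolding det_2 using eqs[of v] by algebra+
      then show ?thesis
        using exhaust_2[of i] exhaust_2[of j] unfolding adj_def by auto
    qed
    then show ?thesis using det[of v] by (simp add: field_simps)
  qed
  have "(\<lambda>v. F v $ i $ j) differentiable (at u)" for i j
    using Fij differentiableI_vector by blast
  then have d: "(\<lambda>v. G v $ i $ j) differentiable (at u)" for i j
    using det[of u] exhaust_2[of i] exhaust_2[of j] unfolding G adj_def det_2
    by (intro derivative_intros; (elim disjE)?; simp)
  \<comment> \<open>\<open>axis i (axis j z)\<close> is the matrix with the single entry z, so
    differentiability passes from the entries to the matrix.\<close>
  then have "(\<lambda>v. \<Sum>i\<in>UNIV. \<Sum>j\<in>UNIV. axis i (axis j (G v $ i $ j)) :: mat2) differentiable (at u)"
  proof (intro differentiable_sum finite ballI)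
    fix i j :: 2
    have "bounded_linear (\<lambda>z::complex. axis i (axis j z) :: mat2)"
      by (intro linear_conv_bounded_linear[THEN iffD1] linearI) (auto simp: axis_def vec_eq_iff)
    moreover obtain D where "((\<lambda>v. G v $ i $ j) has_derivative D) (at u)"
      using d[of i j] by (auto simp: differentiable_def)
    ultimately have "((\<lambda>v. axis i (axis j (G v $ i $ j)) :: mat2) has_derivative
        (\<lambda>h. axis i (axis j (D h)))) (at u)"
      by (rule bounded_linear.has_derivative)
    then show "(\<lambda>v. axis i (axis j (G v $ i $ j)) :: mat2) differentiable (at u)"
      by (rule differentiableI)
  qed
  moreover have "(\<Sum>i\<in>UNIV. \<Sum>j\<in>UNIV. axis i (axis j (G v $ i $ j)) :: mat2) = G v" for v
    by (simp add: vec_eq_iff UNIV_2 forall_2 axis_def)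
  ultimately obtain G' where G': "(G has_vector_derivative G') (at u)"
    using vector_derivative_works by auto
  have "((\<lambda>v. F v ** G v) has_vector_derivative F u ** G' + F' ** G u) (at u)"
    by (rule mat2.has_vector_derivative[OF F G'])
  then have "((\<lambda>v. mat 1 :: mat2) has_vector_derivative F u ** G' + F' ** G u) (at u)"
    by (simp only: inv)
  from vector_derivative_at[OF this] have "F u ** G' + F' ** G u = 0"
    by simp
  then have "F u ** G' = - (F' ** G u)"
    by (simp add: add_eq_0_iff2)
  then have "G u ** (F u ** G') = - (G u ** F' ** G u)"
    by (simp add: mat2.minus_right matrix_mul_assoc)
  then have "G' = - (G u ** F' ** G u)"
    by (simp add: matrix_mul_assoc inv)
  then show ?thesis using G' by simp
qed

text \<open>The derivative - g (Dx f) g is a polynomial in g and Dx f. If g is n times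
  differentiable, so is this derivative, and g gains one order.\<close>

lemma smooth_inverse:
  assumes f: "smooth f" and inv: "\<And>v. f v ** g v = mat 1" "\<And>v. g v ** f v = mat 1"
  shows "smooth g"
proof -
  have *: "(g has_vector_derivative - (g u ** Dx f u ** g u)) (at u)" for u
    using mat2_inverse_has_vector_derivative[OF smooth_has_derivative[OF f] inv] .
  then have Dg: "Dx g = (\<lambda>u. (-1) *\<^sub>R (g u ** Dx f u ** g u))"
    by (simp add: Dx_eqI)
  have "n_diff n g" for n
  proof (induction n)
    case (Suc n)
    then show ?case using * smooth_Dx[OF f] unfolding n_diff.simps Dg smooth_def
      by (intro conjI allI n_diff_scaleR n_diff_mult) (auto intro: differentiableI_vector)
  qed simp
  then show ?thesis by (simp add: smooth_def)
qed

text \<open>The same bootstrap for the interchange of derivatives: order n + 1 asks for order n of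
  Dx (g s) = - g (Dx f) g, a product of families for which order n is already known.\<close>

lemma smooth_family_inverse:
  assumes f: "smooth_family f f'" and inv: "\<And>s v. f s v ** g s v = mat 1" "\<And>s v. g s v ** f s v =
      mat 1"
  shows "smooth_family g (\<lambda>x. - (g 0 x ** f' x ** g 0 x))"
proof -
  have sm: "smooth (f s)" "smooth f'" for s
    using f by (auto simp: smooth_family_def)
  have smg: "smooth (g s)" for s
    using smooth_inverse[OF sm(1) inv] .
  have d: "((\<lambda>s. g s x) has_vector_derivative - (g 0 x ** f' x ** g 0 x)) (at 0)" for x
    using mat2_inverse_has_vector_derivative[OF smooth_familyD[OF f] inv] .
  have Dg: "Dx (g s) = (\<lambda>u. - (g s u ** Dx (f s) u ** g s u))" for s
    by (rule Dx_eqI) (rule mat2_inverse_has_vector_derivative[OF smooth_has_derivative[OF sm(1)]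
        inv])
  let ?g' = "\<lambda>x. - (g 0 x ** f' x ** g 0 x)"
  have smg': "smooth ?g'"
    by (intro smooth_uminus smooth_mult smg sm)
  have "family_deriv n g ?g'" for n
  proof (induction n)
    case (Suc n)
    \<comment> \<open>The sign is written as a constant factor \<open>mat (-1)\<close>, so that the
      product rule covers it; the summand starting with 0 is the derivative of that factor.\<close>
    have "family_deriv n (\<lambda>s x. mat (-1) ** (g s x ** Dx (f s) x ** g s x))
      (\<lambda>x. mat (-1) ** (g 0 x ** Dx (f 0) x ** ?g' x +
              (g 0 x ** Dx f' x + ?g' x ** Dx (f 0) x) ** g 0 x)
                  + 0 ** (g 0 x ** Dx (f 0) x ** g 0 x))"
      using smooth_family_Dx[OF f] Suc
      by (intro family_deriv_mult family_deriv_const smooth_const smooth_mult smooth_add smg sm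
          smg' smooth_Dx)
        (auto simp: smooth_family_def)
    moreover have "mat (-1) ** A = - A" for A :: mat2
      by (simp add: vec_eq_iff matrix_matrix_mult_def mat_def UNIV_2 forall_2)
    moreover have "Dx ?g' = (\<lambda>x. - (g 0 x ** Dx (f 0) x ** ?g' x +
              (g 0 x ** Dx f' x + ?g' x ** Dx (f 0) x) ** g 0 x))"
    proof -
      have "Dx ?g' = Dx (\<lambda>x. (-1) *\<^sub>R (g 0 x ** f' x ** g 0 x))" by simp
      also have "\<dots> = (\<lambda>x. (-1) *\<^sub>R (g 0 x ** f' x ** Dx (g 0) x +
          (g 0 x ** Dx f' x + Dx (g 0) x ** f' x) ** g 0 x))"
        by (simp only: Dx_scaleR Dx_mult smooth_mult smg sm)
      also have "\<dots> = (\<lambda>x. - (g 0 x ** Dx (f 0) x ** ?g' x +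
              (g 0 x ** Dx f' x + ?g' x ** Dx (f 0) x) ** g 0 x))"
        by (simp add: Dg mat2.add_left mat2.diff_left mat2.minus_left mat2.minus_right
            matrix_mul_assoc algebra_simps)
      finally show ?thesis .
    qed
    ultimately show ?case using d by (simp add: Dg)
  qed (use d in simp)
  then show ?thesis by (simp add: smooth_family_def smg smg')
qed

section \<open>Mixed second derivatives and functions of class C^n in two variables\<close>

text \<open>Integrating \<open>f2\<close> in s represents f (x, s) - f (x, c). Differentiating under
  the integral sign in x, and then the resulting integral in its upper limit, gives the claim; that
  \<open>f1\<close> is differentiable in s is part of the conclusion.\<close>

lemma mixed_partials_eq:
  fixes f f1 f2 f21 :: "real \<times> real \<Rightarrow> 'a::banach"
  assumes U: "open U" "(x0, s0) \<in> U"
    and f1: "\<And>x s. (x, s) \<in> U \<Longrightarrow> ((\<lambda>x. f (x, s)) has_vector_derivative f1 (x, s)) (at x)"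
    and f2: "\<And>x s. (x, s) \<in> U \<Longrightarrow> ((\<lambda>s. f (x, s)) has_vector_derivative f2 (x, s)) (at s)"
    and f21: "\<And>x s. (x, s) \<in> U \<Longrightarrow> ((\<lambda>x. f2 (x, s)) has_vector_derivative f21 (x, s)) (at x)"
    and cont: "continuous_on U f2" "continuous_on U f21"
  shows "((\<lambda>s. f1 (x0, s)) has_vector_derivative f21 (x0, s0)) (at s0)"
proof -
  obtain A B where AB: "open A" "open B" "x0 \<in> A" "s0 \<in> B" "A \<times> B \<subseteq> U"
    using U by (metis mem_Sigma_iff open_prod_elim)
  \<comment> \<open>An interval around x0 times a compact interval around s0 inside U; all integrals
    start at the lower end \<open>?c\<close> of the latter.\<close>
  obtain r where r: "r > 0" "ball x0 r \<subseteq> A"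
    using AB by (meson openE)
  obtain q where q: "q > 0" "cball s0 q \<subseteq> B"
    using AB by (meson open_contains_cball)
  let ?c = "s0 - q" and ?d = "s0 + q"
  have sub: "ball x0 r \<times> {?c..?d} \<subseteq> U"
    using AB r q by (auto simp: cball_eq_atLeastAtMost)
  have F: "((\<lambda>t. f2 (x, t)) has_integral f (x, s) - f (x, ?c)) {?c..s}"
    if "x \<in> ball x0 r" "s \<in> {?c..?d}" for x s
  proof (intro fundamental_theorem_of_calculus has_vector_derivative_at_within[OF f2])
    fix t assume "t \<in> {?c..s}"
    with that have "(x, t) \<in> ball x0 r \<times> {?c..?d}" by simp
    then show "(x, t) \<in> U" using sub by blast
  qed (use that in simp)
  have eq: "f1 (x0, s) - f1 (x0, ?c) = integral {?c..s} (\<lambda>t. f21 (x0, t))" if s: "s \<in> {?c..?d}"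
      for s
  proof -
    have box: "cbox ?c s \<subseteq> {?c..?d}" using s by auto
    have "((\<lambda>x. integral (cbox ?c s) (\<lambda>t. f2 (x, t))) has_vector_derivative
        integral (cbox ?c s) (\<lambda>t. f21 (x0, t))) (at x0 within ball x0 r)"
    proof (rule leibniz_rule_vector_derivative)
      show "((\<lambda>x. f2 (x, t)) has_vector_derivative f21 (x, t)) (at x within ball x0 r)"
        if "x \<in> ball x0 r" "t \<in> cbox ?c s" for x t
      proof (intro has_vector_derivative_at_within[OF f21])
        have "(x, t) \<in> ball x0 r \<times> {?c..?d}" using that box by blast
        then show "(x, t) \<in> U" using sub by blast
      qed
      show "(\<lambda>t. f2 (x, t)) integrable_on cbox ?c s" if "x \<in> ball x0 r" for x
        using F[OF that s] by (auto simp: integrable_on_def)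
      show "continuous_on (ball x0 r \<times> cbox ?c s) (\<lambda>(x, t). f21 (x, t))"
      proof -
        have "ball x0 r \<times> cbox ?c s \<subseteq> U"
          using Sigma_mono[OF subset_refl box] sub by (rule order_trans)
        then show ?thesis using continuous_on_subset[OF cont(2)] by simp
      qed
    qed (use r in auto)
    then have "((\<lambda>x. integral (cbox ?c s) (\<lambda>t. f2 (x, t))) has_vector_derivative
        integral (cbox ?c s) (\<lambda>t. f21 (x0, t))) (at x0)"
      using r by (simp add: at_within_open[of x0 "ball x0 r"])
    then have "((\<lambda>x. f (x, s) - f (x, ?c)) has_vector_derivative
        integral (cbox ?c s) (\<lambda>t. f21 (x0, t))) (at x0)"
      by (rule has_vector_derivative_transform_within_open[of _ _ _ "ball x0 r"])
        (use r F[OF _ s] in \<open>auto intro!: integral_unique\<close>)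
    moreover have "((\<lambda>x. f (x, s) - f (x, ?c)) has_vector_derivative f1 (x0, s) - f1 (x0, ?c))
        (at x0)"
    proof (intro has_vector_derivative_diff f1)
      have "(x0, s) \<in> ball x0 r \<times> {?c..?d}" "(x0, ?c) \<in> ball x0 r \<times> {?c..?d}"
        using r q s by auto
      then show "(x0, s) \<in> U" "(x0, ?c) \<in> U" using sub by blast+
    qed
    ultimately show ?thesis
      using vector_derivative_unique_at by fastforce
  qed
  have "((\<lambda>s. integral {?c..s} (\<lambda>t. f21 (x0, t))) has_vector_derivative f21 (x0, s0))
      (at s0 within {?c..?d})"
  proof (rule integral_has_vector_derivative)
    show "continuous_on {?c..?d} (\<lambda>t. f21 (x0, t))"
    proof (intro continuous_on_compose2[OF cont(2)] continuous_intros)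
      show "(\<lambda>t. (x0, t)) ` {?c..?d} \<subseteq> U" using sub r by force
    qed
  qed (use q in auto)
  then have "((\<lambda>s. integral {?c..s} (\<lambda>t. f21 (x0, t))) has_vector_derivative f21 (x0, s0)) (at s0)"
    using q by (simp add: at_within_Icc_at)
  then have "((\<lambda>s. f1 (x0, s) - f1 (x0, ?c)) has_vector_derivative f21 (x0, s0)) (at s0)"
    by (rule has_vector_derivative_transform_within_open[of _ _ _ "{?c<..<?d}"])
      (use q eq in auto)
  then have "((\<lambda>s. f1 (x0, s) - f1 (x0, ?c) + f1 (x0, ?c)) has_vector_derivative f21 (x0, s0))
      (at s0)"
    by (subst has_vector_derivative_add_const)
  then show ?thesis by simp
qed

lemma Ck_on_cong:
  assumes "open U" "\<And>z. z \<in> U \<Longrightarrow> f z = g z" "Ck_on n U f"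
  shows "Ck_on n U g"
proof (cases n)
  case 0
  then show ?thesis using assms continuous_on_cong by (metis Ck_on.simps(1))
next
  case (Suc m)
  then show ?thesis
    using assms has_derivative_transform_within_open[OF _ assms(1)]
    by (simp only: Ck_on.simps) blast
qed

lemma Ck_on_SucD: "Ck_on (Suc n) U f \<Longrightarrow> Ck_on n U f"
proof (induction n arbitrary: f)
  case 0
  then show ?case
    by (auto intro!: continuous_at_imp_continuous_on dest: has_derivative_continuous)
next
  case (Suc n)
  then show ?case unfolding Ck_on.simps(2) by blast
qed

lemma Ck_on_continuous: "Ck_on n U f \<Longrightarrow> continuous_on U f"
  by (induction n) (auto simp del: Ck_on.simps(2) dest: Ck_on_SucD)

lemma has_derivative_partials:
  fixes f :: "real \<times> real \<Rightarrow> 'a::real_normed_vector"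
  assumes "(f has_derivative (\<lambda>h. fst h *\<^sub>R a + snd h *\<^sub>R b)) (at (x, s))"
  shows "((\<lambda>x. f (x, s)) has_vector_derivative a) (at x)"
    and "((\<lambda>s. f (x, s)) has_vector_derivative b) (at s)"
proof -
  have "((\<lambda>x. (x, s)) has_derivative (\<lambda>h. (h, 0))) (at x)"
    "((\<lambda>s. (x, s)) has_derivative (\<lambda>h. (0, h))) (at s)"
    by (auto intro!: derivative_eq_intros)
  from this[THEN has_derivative_compose, OF assms] show
    "((\<lambda>x. f (x, s)) has_vector_derivative a) (at x)"
    "((\<lambda>s. f (x, s)) has_vector_derivative b) (at s)"
    by (simp_all add: has_vector_derivative_def)
qed

lemma Ck_on_imp_n_diff:
  assumes "UNIV \<times> {0} \<subseteq> U"
  shows "Ck_on n U f \<Longrightarrow> n_diff n (\<lambda>x. f (x, 0))"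
proof (induction n arbitrary: f)
  case (Suc n)
  then obtain f1 f2 where d: "\<And>z. z \<in> U \<Longrightarrow> (f has_derivative (\<lambda>h. fst h *\<^sub>R f1 z
      + snd h *\<^sub>R f2 z)) (at z)"
    and C: "Ck_on n U f1"
    by auto
  have d1: "((\<lambda>x. f (x, 0)) has_vector_derivative f1 (x, 0)) (at x)" for x
    using assms by (intro has_derivative_partials(1)[OF d]) auto
  then have "Dx (\<lambda>x. f (x, 0)) = (\<lambda>x. f1 (x, 0))"
    by (rule Dx_eqI)
  then show ?case
    using d1 Suc.IH[OF C] by (auto intro: differentiableI_vector)
qed simp

text \<open>Each step replaces f by its x-derivative, which costs one order of differentiability.
  The spare orders keep the s-derivative \<open>f2\<close> and its x-derivative \<open>f21\<close>
  continuous, as the symmetry of mixed derivatives requires.\<close>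

lemma Ck_on_imp_family_deriv:
  assumes U: "open U" "UNIV \<times> {0} \<subseteq> U"
  shows "Ck_on (Suc (Suc n)) U f \<Longrightarrow> (\<And>x. ((\<lambda>s. f (x, s)) has_vector_derivative f' x) (at 0)) \<Longrightarrow>
    family_deriv n (\<lambda>s x. f (x, s)) f'"
proof (induction n arbitrary: f f')
  case (Suc n)
  from Suc.prems(1) obtain f1 f2 where
    d: "\<And>z. z \<in> U \<Longrightarrow> (f has_derivative (\<lambda>h. fst h *\<^sub>R f1 z + snd h *\<^sub>R f2 z)) (at z)"
    and C1: "Ck_on (Suc (Suc n)) U f1" and C2: "Ck_on (Suc (Suc n)) U f2"
    by (subst (asm) Ck_on.simps(2)) blast
  from C2 obtain f21 f22 where
    d2: "\<And>z. z \<in> U \<Longrightarrow> (f2 has_derivative (\<lambda>h. fst h *\<^sub>R f21 z + snd h *\<^sub>R f22 z)) (at z)"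
    and C21: "Ck_on (Suc n) U f21"
    by (subst (asm) Ck_on.simps(2)) blast
  have p1: "((\<lambda>x. f (x, s)) has_vector_derivative f1 (x, s)) (at x)" if "(x, s) \<in> U" for x s
    using d[OF that] by (rule has_derivative_partials)
  have p2: "((\<lambda>s. f (x, s)) has_vector_derivative f2 (x, s)) (at s)" if "(x, s) \<in> U" for x s
    using d[OF that] by (rule has_derivative_partials)
  have p21: "((\<lambda>x. f2 (x, s)) has_vector_derivative f21 (x, s)) (at x)" if "(x, s) \<in> U" for x s
    using d2[OF that] by (rule has_derivative_partials)
  have line: "(x, 0) \<in> U" for x using U by auto
  have f': "f' x = f2 (x, 0)" for x
    using vector_derivative_unique_at[OF Suc.prems(2) p2[OF line]] .
  have Df': "Dx f' = (\<lambda>x. f21 (x, 0))"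
    by (rule Dx_eqI) (simp add: f'[abs_def] p21[OF line])
  have Df: "f1 (x, s) = Dx (\<lambda>x. f (x, s)) x" if "(x, s) \<in> U" for x s
    using p1[OF that] by (simp add: Dx_def vector_derivative_at)
  \<comment> \<open>The recursion of \<open>family_deriv\<close> sees \<open>Dx\<close>, whereas
    \<open>f1\<close> is controlled only on U; the two agree there, and U is open.\<close>
  let ?F = "\<lambda>(x, s). Dx (\<lambda>x. f (x, s)) x"
  have "Ck_on (Suc (Suc n)) U ?F"
    by (rule Ck_on_cong[OF U(1) _ C1]) (auto simp: Df)
  moreover have "((\<lambda>s. ?F (x, s)) has_vector_derivative Dx f' x) (at 0)" for x
  proof -
    have "((\<lambda>s. f1 (x, s)) has_vector_derivative f21 (x, 0)) (at 0)"
      by (rule mixed_partials_eq[OF U(1) line p1 p2 p21])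
        (assumption | fact Ck_on_continuous[OF C2] Ck_on_continuous[OF C21])+
    moreover obtain B where "open B" "0 \<in> B" "\<And>s. s \<in> B \<Longrightarrow> (x, s) \<in> U"
      using U(1) line[of x] by (metis mem_Sigma_iff open_prod_elim subsetD)
    ultimately show ?thesis
      using Df by (auto simp: Df' intro: has_vector_derivative_transform_within_open)
  qed
  ultimately have "family_deriv n (\<lambda>s x. ?F (x, s)) (Dx f')"
    by (rule Suc.IH)
  then show ?case using Suc.prems(2) by simp
qed simp

section \<open>The product of operators\<close>

text \<open>The left multiple \<open>\<partial>^m B\<close>, expanded by the Leibniz rule. In these terms \<open>mult_op\<close> becomes the
  double sum of lemma \<open>mult_op_eq\<close>, and associativity reduces to
  \<open>\<partial> (B C) = (\<partial> B) C\<close>.\<close>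

definition dmult :: "nat \<Rightarrow> oper \<Rightarrow> oper" where
  "dmult m B = (\<lambda>N q x. \<Sum>r\<le>m. if m - r \<le> q
     then real (m choose r) *\<^sub>R (Dx ^^ r) (B N (q - (m - r))) x else 0)"

lemma Dx_pow_zero [simp]: "(Dx ^^ r) 0 = 0"
  by (induction r) auto

lemma dmult_0 [simp]: "dmult 0 B = B"
  by (simp add: dmult_def)

lemma dmult_eq_sum:
  "dmult m B N q = (\<lambda>x. \<Sum>r\<le>m. (if m - r \<le> q
     then (\<lambda>x. real (m choose r) *\<^sub>R (Dx ^^ r) (B N (q - (m - r))) x) else (\<lambda>x. 0)) x)"
  by (simp add: dmult_def if_distribR cong: if_cong)

lemma smooth_dmult:
  assumes "\<And>q. smooth (B N q)" shows "smooth (dmult m B N q)"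
  unfolding dmult_eq_sum using assms
  by (auto intro!: smooth_sum smooth_scaleR smooth_Dx_pow smooth_const)

text \<open>This is \<partial>^(m+1) B = \<partial> (\<partial>^m B). Pascal's rule splits the
  binomial coefficient: one half moves the new \<partial> past the coefficient, the other
  differentiates the coefficient once more.\<close>

lemma dmult_Suc:
  assumes "\<And>q. smooth (B N q)"
  shows "dmult (Suc m) B N q x =
    Dx (dmult m B N q) x + (if q = 0 then 0 else dmult m B N (q - 1) x)"
proof -
  define g where "g r j = (Dx ^^ r) (B N j) x" for r j
  have g_Suc: "Dx ((Dx ^^ r) (B N j)) x = g (Suc r) j" for r j
    by (simp add: g_def)
  \<comment> \<open>The guard \<open>r > 0\<close> protects the truncated \<open>r - 1\<close>: at r
    = 0 Pascal's rule has only one summand.\<close>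
  have "dmult (Suc m) B N q x =
      (\<Sum>r\<le>Suc m. (if Suc m - r \<le> q then real (m choose r) *\<^sub>R g r (q - (Suc m - r)) else 0)
        + (if Suc m - r \<le> q \<and> r > 0 then real (m choose (r - 1)) *\<^sub>R g r (q - (Suc m - r)) else 0))"
    unfolding dmult_def g_def[symmetric]
  proof (rule sum.cong[OF refl])
    fix r
    show "(if Suc m - r \<le> q then real (Suc m choose r) *\<^sub>R g r (q - (Suc m - r)) else 0) =
       (if Suc m - r \<le> q then real (m choose r) *\<^sub>R g r (q - (Suc m - r)) else 0)
        + (if Suc m - r \<le> q \<and> r > 0 then real (m choose (r - 1)) *\<^sub>R g r (q - (Suc m - r)) else 0)"
      by (cases r) (auto simp: scaleR_add_left)
  qed
  also have "\<dots> = (\<Sum>r\<le>m. if Suc m - r \<le> q then real (m choose r) *\<^sub>R g r (q - (Suc m - r)) else 0)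
      + (\<Sum>r\<le>m. if m - r \<le> q then real (m choose r) *\<^sub>R g (Suc r) (q - (m - r)) else 0)"
    unfolding sum.distrib
    by (subst (2) sum.atMost_Suc_shift) (simp add: binomial_eq_0 cong: if_cong)
  also have "(\<Sum>r\<le>m. if Suc m - r \<le> q then real (m choose r) *\<^sub>R g r (q - (Suc m - r)) else 0) =
      (if q = 0 then 0 else dmult m B N (q - 1) x)"
  proof (cases q)
    case (Suc p)
    then show ?thesis
      by (auto simp: dmult_def g_def Suc_diff_le intro!: sum.cong)
  qed (auto intro!: sum.neutral)
  also have "(\<Sum>r\<le>m. if m - r \<le> q then real (m choose r) *\<^sub>R g (Suc r) (q - (m - r)) else 0) =
      Dx (dmult m B N q) x"
    unfolding dmult_eq_sum using assms
    by (subst Dx_sum)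
      (auto simp: Dx_scaleR smooth_Dx_pow g_Suc intro!: sum.cong smooth_scaleR smooth_Dx_pow
          smooth_const)
  finally show ?thesis by (simp add: add.commute)
qed

text \<open>Turns \<open>Sum_any\<close> into a finite sum over any window that covers the
  contributing exponents. \<open>A\<close> enters only through its values at x, while
  \<open>B\<close> is differentiated and shifted, so its coefficients must vanish as
  functions.\<close>

lemma mult_op_eq:
  assumes D: "\<And>k m. m > D \<Longrightarrow> A k m x = 0" and I: "finite I"
    "\<And>k m. k \<notin> I \<Longrightarrow> A k m x = 0 \<or> B (N - k) = 0"
  shows "(A \<odot>\<^bsub>\<epsilon>\<^esub> B) N q x =
    (\<Sum>k\<in>I. \<Sum>m\<le>D. A k m x ** dmult m B (N - k) q (x + of_int k * \<epsilon>))"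
proof -
  let ?g = "\<lambda>(k, m, r). if r \<le> m \<and> m - r \<le> q
     then real (m choose r) *\<^sub>R
            (A k m x ** (Dx ^^ r) (B (N - k) (q - (m - r))) (x + of_int k * \<epsilon>))
     else 0"
  have "(A \<odot>\<^bsub>\<epsilon>\<^esub> B) N q x = sum ?g (I \<times> {..D} \<times> {..D})"
    unfolding mult_op_def
  proof (rule Sum_any.expand_superset)
    show "finite (I \<times> {..D} \<times> {..D})" using I by simp
    show "{a. ?g a \<noteq> 0} \<subseteq> I \<times> {..D} \<times> {..D}"
    proof (rule subsetI, rule ccontr)
      fix a assume a: "a \<in> {a. ?g a \<noteq> 0}" "a \<notin> I \<times> {..D} \<times> {..D}"
      obtain k m r where "a = (k, m, r)" by (cases a)
      with a have nz: "?g (k, m, r) \<noteq> 0" and "(k, m, r) \<notin> I \<times> {..D} \<times> {..D}" by auto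
      then have "k \<notin> I \<or> m > D \<or> r > D" by auto
      with nz have "k \<notin> I \<or> m > D" by (auto split: if_splits)
      with I(2)[of k m] D[of m k] have "A k m x = 0 \<or> B (N - k) = 0" by auto
      with nz show False by (auto split: if_splits)
    qed
  qed
  also have "\<dots> = (\<Sum>k\<in>I. \<Sum>m\<le>D. \<Sum>r\<le>D. ?g (k, m, r))"
  proof -
    have "sum g (I \<times> {..D} \<times> {..D}) = (\<Sum>k\<in>I. \<Sum>m\<le>D. \<Sum>r\<le>D. g (k, m, r))"
      for g :: "int \<times> nat \<times> nat \<Rightarrow> mat2"
      by (simp add: sum.cartesian_product case_prod_unfold)
    then show ?thesis .
  qed
  also have "\<dots> = (\<Sum>k\<in>I. \<Sum>m\<le>D. A k m x ** dmult m B (N - k) q (x + of_int k * \<epsilon>))"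
  proof (intro sum.cong refl)
    fix k m assume "m \<in> {..D}"
    then have "(\<Sum>r\<le>D. ?g (k, m, r)) = (\<Sum>r\<le>m. ?g (k, m, r))"
      by (intro sum.mono_neutral_right) auto
    also have "\<dots> = A k m x ** dmult m B (N - k) q (x + of_int k * \<epsilon>)"
      by (auto simp: dmult_def mat2.sum_right mat2.scaleR_right intro!: sum.cong)
    finally show "(\<Sum>r\<le>D. ?g (k, m, r)) = \<dots>" .
  qed
  finally show ?thesis .
qed

text \<open>The direction \<open>d = 1\<close> stands for operators whose powers of \<open>\<Lambda>\<close> are bounded above, and
  \<open>d = -1\<close> for operators whose powers of \<open>\<Lambda>\<close> are bounded below. Within each of the two
  classes the products are locally finite.\<close>

definition supported :: "int \<Rightarrow> int \<Rightarrow> nat \<Rightarrow> oper \<Rightarrow> bool" where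
  "supported d K D A \<longleftrightarrow> (\<forall>k m. d * k > K \<or> m > D \<longrightarrow> A k m = 0)"

definition bounded_op :: "int \<Rightarrow> oper \<Rightarrow> bool" where
  "bounded_op d A \<longleftrightarrow> (\<exists>K D. supported d K D A)"

definition smooth_op :: "oper \<Rightarrow> bool" where
  "smooth_op A \<longleftrightarrow> (\<forall>k m. smooth (A k m))"

definition diff_op :: "int \<Rightarrow> oper \<Rightarrow> bool" where
  "diff_op d A \<longleftrightarrow> bounded_op d A \<and> smooth_op A"

definition band :: "int \<Rightarrow> int \<Rightarrow> int \<Rightarrow> int set" where
  "band d K N = {k. d * k \<le> K \<and> d * k \<ge> N}"

lemma finite_band: "d = 1 \<or> d = -1 \<Longrightarrow> finite (band d K N)"
proof (elim disjE)
  show "d = 1 \<Longrightarrow> finite (band d K N)"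
    by (rule finite_subset[of _ "{N..K}"]) (auto simp: band_def)
  show "d = -1 \<Longrightarrow> finite (band d K N)"
    by (rule finite_subset[of _ "{-K..-N}"]) (auto simp: band_def)
qed

lemma supported_mono: "supported d K D A \<Longrightarrow> K \<le> K' \<Longrightarrow> D \<le> D' \<Longrightarrow> supported d K' D' A"
  by (auto simp: supported_def)

text \<open>A contributing k satisfies d * k \<le> K and d * (N - k) \<le> K', which leaves a finite
  window. It may be enlarged at will, so that several products can be expanded over a common
  one.\<close>

lemma mult_op_band:
  assumes d: "d = 1 \<or> d = -1" and A: "supported d K D A" and B: "supported d K' D' B"
    and IK: "K \<le> I" and IN: "J \<le> d * N - K'" and D: "D \<le> E"
  shows "(A \<odot>\<^bsub>\<epsilon>\<^esub> B) N q x =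
    (\<Sum>k\<in>band d I J. \<Sum>m\<le>E. A k m x ** dmult m B (N - k) q (x + of_int k * \<epsilon>))"
proof (rule mult_op_eq)
  show "A k m x = 0" if "m > E" for k m
    using that A D by (auto simp: supported_def)
  show "finite (band d I J)" using finite_band[OF d] .
  show "A k m x = 0 \<or> B (N - k) = 0" if "k \<notin> band d I J" for k m
  proof -
    have "d * k > I \<or> d * k < J" using that by (auto simp: band_def)
    then show ?thesis
    proof
      assume "d * k > I"
      then have "d * k > K" using IK by simp
      then show ?thesis using A by (auto simp: supported_def)
    next
      assume "d * k < J"
      then have "d * (N - k) > K'" using IN by (simp add: right_diff_distrib)
      then show ?thesis using B by (auto simp: supported_def fun_eq_iff)
    qed
  qed
qed

lemma supported_dmult:
  assumes B: "supported d K D B" shows "supported d K (D + m) (dmult m B)"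
  unfolding supported_def
proof (intro allI impI ext)
  fix k q x assume *: "d * k > K \<or> q > D + m"
  have B0: "B k (q - (m - r)) = 0" if "m - r \<le> q" for r
    using B * that by (auto simp: supported_def)
  show "dmult m B k q x = 0 x"
    unfolding dmult_def
    by (simp only: B0 Dx_pow_zero zero_fun_apply scaleR_zero_right if_cancel sum.neutral_const
        cong: if_cong)
qed

lemma supported_mult:
  assumes d: "d = 1 \<or> d = -1" and A: "supported d K D A" and B: "supported d K' D' B"
  shows "supported d (K + K') (D + D') (A \<odot>\<^bsub>\<epsilon>\<^esub> B)"
  unfolding supported_def
proof (intro allI impI ext)
  fix N q x assume *: "d * N > K + K' \<or> q > D + D'"
  have "A k m x ** dmult m B (N - k) q (x + of_int k * \<epsilon>) = 0" for k m
  proof (cases "d * k > K \<or> m > D")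
    case True
    then show ?thesis using A by (auto simp: supported_def)
  next
    case False
    with * have "d * (N - k) > K' \<or> q > D' + m" by (auto simp: right_diff_distrib)
    then show ?thesis using supported_dmult[OF B, of m] by (auto simp: supported_def)
  qed
  then show "(A \<odot>\<^bsub>\<epsilon>\<^esub> B) N q x = 0 x"
    by (simp add: mult_op_band[OF d A B order_refl order_refl order_refl] del: zero_fun_apply)
      (simp)
qed

lemma bounded_op_mult: "d = 1 \<or> d = -1 \<Longrightarrow> bounded_op d A \<Longrightarrow> bounded_op d B \<Longrightarrow> bounded_op d (A \<odot>\<^bsub>\<epsilon>\<^esub> B)"
  unfolding bounded_op_def using supported_mult by blast

lemma smooth_mult_op_coeff:
  assumes "d = 1 \<or> d = -1" "bounded_op d A" "bounded_op d B" "smooth_op A" "smooth_op B"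
  shows "smooth ((A \<odot>\<^bsub>\<epsilon>\<^esub> B) N q)"
proof -
  obtain K D K' D' where A: "supported d K D A" and B: "supported d K' D' B"
    using assms by (auto simp: bounded_op_def)
  have "(A \<odot>\<^bsub>\<epsilon>\<^esub> B) N q = (\<lambda>x. \<Sum>k\<in>band d K (d * N - K'). \<Sum>m\<le>D. A k m x ** dmult m B (N - k) q (x
      + of_int k * \<epsilon>))"
    using mult_op_band[OF assms(1) A B order_refl order_refl order_refl] by (intro ext)
  then show ?thesis
    using assms by (auto simp: smooth_op_def intro!: smooth_sum smooth_mult smooth_shift
        smooth_dmult)
qed

lemma diff_op_mult: "d = 1 \<or> d = -1 \<Longrightarrow> diff_op d A \<Longrightarrow> diff_op d B \<Longrightarrow> diff_op d (A \<odot>\<^bsub>\<epsilon>\<^esub> B)"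
  by (auto simp: diff_op_def bounded_op_mult smooth_mult_op_coeff smooth_op_def)

section \<open>Associativity\<close>

text \<open>Left multiplication by \<partial>, in coefficients: \<partial> either differentiates the
  coefficient or moves past it and raises the order.\<close>

definition del :: "oper \<Rightarrow> oper" where
  "del B = (\<lambda>N q x. Dx (B N q) x + (if q = 0 then 0 else B N (q - 1) x))"

lemma dmult_Suc_del: "smooth_op B \<Longrightarrow> dmult (Suc m) B = del (dmult m B)"
  by (intro ext) (auto simp: dmult_Suc del_def smooth_op_def)

lemma smooth_op_dmult: "smooth_op B \<Longrightarrow> smooth_op (dmult m B)"
  by (simp add: smooth_op_def smooth_dmult)

lemma bounded_op_dmult: "bounded_op d B \<Longrightarrow> bounded_op d (dmult m B)"
  unfolding bounded_op_def using supported_dmult by blast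

lemma supported_del: "supported d K D B \<Longrightarrow> supported d K (Suc D) (del B)"
  unfolding supported_def del_def by (intro allI impI ext) auto

text \<open>By the Leibniz rule \<partial> meets either a coefficient of \<open>B\<close> or the
  factor \<partial>^n C. In the second case it raises n, which is the index shift in
  \<open>del B\<close>.\<close>

lemma del_mult:
  assumes d: "d = 1 \<or> d = -1" and B: "diff_op d B" and C: "diff_op d C"
  shows "del (B \<odot>\<^bsub>\<epsilon>\<^esub> C) = del B \<odot>\<^bsub>\<epsilon>\<^esub> C"
proof (intro ext)
  fix N q x
  obtain K D K' D' where supported: "supported d K D B" "supported d K' D' C"
    using B C by (auto simp: diff_op_def bounded_op_def)
  have sB: "smooth (B j n)" for j n using B by (simp add: diff_op_def smooth_op_def)
  have sC: "smooth (dmult n C j q)" for n j q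
    using C by (simp add: diff_op_def smooth_op_def smooth_dmult)
  let ?I = "band d K (d * N - K')"
  let ?y = "\<lambda>j. x + of_int j * \<epsilon>"
  have exp: "(B \<odot>\<^bsub>\<epsilon>\<^esub> C) N q = (\<lambda>x. \<Sum>j\<in>?I. \<Sum>n\<le>D. B j n x ** dmult n C (N - j) q (x
      + of_int j * \<epsilon>))" for q
    using mult_op_band[OF d supported order_refl order_refl order_refl] by (intro ext)
  have "Dx ((B \<odot>\<^bsub>\<epsilon>\<^esub> C) N q) x = (\<Sum>j\<in>?I. \<Sum>n\<le>D. Dx (B j n) x ** dmult n C (N - j) q (?y j)
      + B j n x ** Dx (dmult n C (N - j) q) (?y j))"
    unfolding exp by (simp add: Dx_sum Dx_mult Dx_shift smooth_sum smooth_mult smooth_shift sB sC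
        add.commute)
  moreover have "(if q = 0 then 0 else (B \<odot>\<^bsub>\<epsilon>\<^esub> C) N (q - 1) x) =
      (\<Sum>j\<in>?I. \<Sum>n\<le>D. B j n x ** (if q = 0 then 0 else dmult n C (N - j) (q - 1) (?y j)))"
    by (auto simp: exp)
  ultimately have "del (B \<odot>\<^bsub>\<epsilon>\<^esub> C) N q x = (\<Sum>j\<in>?I. \<Sum>n\<le>D. Dx (B j n) x ** dmult n C (N - j) q (?y j)
      + B j n x ** dmult (Suc n) C (N - j) q (?y j))"
    using C by (simp add: del_def dmult_Suc mat2.add_right sum.distrib diff_op_def smooth_op_def
        add.assoc)
  \<comment> \<open>\<open>del B\<close> can have order D + 1, so the range is extended: the
    coefficient of \<open>B\<close> of that order vanishes, and the shifted sum has no summand at n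
    = 0.\<close>
  also have "\<dots> = (\<Sum>j\<in>?I. \<Sum>n\<le>Suc D. Dx (B j n) x ** dmult n C (N - j) q (?y j)
      + (if n = 0 then 0 else B j (n - 1) x) ** dmult n C (N - j) q (?y j))"
  proof (rule sum.cong[OF refl])
    fix j
    have "(\<Sum>n\<le>Suc D. Dx (B j n) x ** dmult n C (N - j) q (?y j)) =
        (\<Sum>n\<le>D. Dx (B j n) x ** dmult n C (N - j) q (?y j))"
      using supported by (simp add: supported_def)
    moreover have "(\<Sum>n\<le>Suc D. (if n = 0 then 0 else B j (n - 1) x) ** dmult n C (N - j) q (?y j)) =
       (\<Sum>n\<le>D. B j n x ** dmult (Suc n) C (N - j) q (?y j))"
      by (subst sum.atMost_Suc_shift) simp
    ultimately show "(\<Sum>n\<le>D. Dx (B j n) x ** dmult n C (N - j) q (?y j)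
      + B j n x ** dmult (Suc n) C (N - j) q (?y j)) =
          (\<Sum>n\<le>Suc D. Dx (B j n) x ** dmult n C (N - j) q (?y j)
      + (if n = 0 then 0 else B j (n - 1) x) ** dmult n C (N - j) q (?y j))"
      by (simp only: sum.distrib)
  qed
  also have "\<dots> = (del B \<odot>\<^bsub>\<epsilon>\<^esub> C) N q x"
    by (subst mult_op_band[OF d supported_del[OF supported(1)] supported(2) order_refl order_refl
        order_refl])
      (simp add: del_def mat2.add_left del: sum.atMost_Suc)
  finally show "del (B \<odot>\<^bsub>\<epsilon>\<^esub> C) N q x = (del B \<odot>\<^bsub>\<epsilon>\<^esub> C) N q x" .
qed

lemma diff_op_dmult: "diff_op d B \<Longrightarrow> diff_op d (dmult m B)"
  by (simp add: diff_op_def bounded_op_dmult smooth_op_dmult)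

lemma dmult_mult:
  assumes "d = 1 \<or> d = -1" "diff_op d B" "diff_op d C"
  shows "dmult n (B \<odot>\<^bsub>\<epsilon>\<^esub> C) = dmult n B \<odot>\<^bsub>\<epsilon>\<^esub> C"
proof (induction n)
  case (Suc n)
  have "dmult (Suc n) (B \<odot>\<^bsub>\<epsilon>\<^esub> C) = del (dmult n B \<odot>\<^bsub>\<epsilon>\<^esub> C)"
    using diff_op_mult[OF assms] Suc by (simp add: dmult_Suc_del diff_op_def)
  also have "\<dots> = dmult (Suc n) B \<odot>\<^bsub>\<epsilon>\<^esub> C"
    using assms by (simp add: del_mult[OF assms(1) diff_op_dmult[OF assms(2)] assms(3)]
        dmult_Suc_del diff_op_def)
  finally show ?case .
qed simp

text \<open>The leftmost factor is never differentiated, hence the weaker condition on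
  \<open>A\<close>; it matters where inverses of unknown smoothness are compared. After expansion,
  each term of \<open>A\<close> needs only \<partial>^n (B C) = (\<partial>^n B) C.\<close>

lemma mult_op_assoc:
  assumes d: "d = 1 \<or> d = -1" and A: "bounded_op d A" and B: "diff_op d B" and C: "diff_op d C"
  shows "A \<odot>\<^bsub>\<epsilon>\<^esub> B \<odot>\<^bsub>\<epsilon>\<^esub> C = A \<odot>\<^bsub>\<epsilon>\<^esub> (B \<odot>\<^bsub>\<epsilon>\<^esub> C)"
proof (intro ext)
  fix N q x
  obtain KA DA KB DB KC DC where supported: "supported d KA DA A" "supported d KB DB B"
      "supported d KC DC C"
    using A B C by (auto simp: diff_op_def bounded_op_def)
  \<comment> \<open>Each window is independent of the other summation index and large enough for
    every inner product, so the sums can be exchanged.\<close>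
  let ?I = "band d KA (d * N - (KB + KC))"
  let ?J = "band d (KA + KB) (d * N - KC)"
  let ?y = "\<lambda>j. x + of_int j * \<epsilon>"
  let ?T = "\<lambda>i n k m. A i n x ** (dmult n B (k - i) m (?y i) ** dmult m C (N - k) q (?y k))"
  have "(A \<odot>\<^bsub>\<epsilon>\<^esub> B \<odot>\<^bsub>\<epsilon>\<^esub> C) N q x =
      (\<Sum>k\<in>?J. \<Sum>m\<le>DA + DB. (A \<odot>\<^bsub>\<epsilon>\<^esub> B) k m x ** dmult m C (N - k) q (?y k))"
    by (rule mult_op_band[OF d supported_mult[OF d supported(1,2)] supported(3)]) auto
  also have "\<dots> = (\<Sum>k\<in>?J. \<Sum>m\<le>DA + DB. \<Sum>i\<in>?I. \<Sum>n\<le>DA. ?T i n k m)"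
  proof (intro sum.cong refl)
    fix k m assume "k \<in> ?J"
    then have "(A \<odot>\<^bsub>\<epsilon>\<^esub> B) k m x = (\<Sum>i\<in>?I. \<Sum>n\<le>DA. A i n x ** dmult n B (k - i) m (?y i))"
      by (intro mult_op_band[OF d supported(1,2)]) (auto simp: band_def)
    then show "(A \<odot>\<^bsub>\<epsilon>\<^esub> B) k m x ** dmult m C (N - k) q (?y k) = (\<Sum>i\<in>?I. \<Sum>n\<le>DA. ?T i n k m)"
      by (simp add: mat2.sum_left matrix_mul_assoc)
  qed
  also have "\<dots> = (\<Sum>i\<in>?I. \<Sum>n\<le>DA. \<Sum>k\<in>?J. \<Sum>m\<le>DA + DB. ?T i n k m)"
  proof -
    have "(\<Sum>k\<in>?J. \<Sum>m\<le>DA + DB. \<Sum>i\<in>?I. \<Sum>n\<le>DA. ?T i n k m) =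
        (\<Sum>(k, m)\<in>?J \<times> {..DA + DB}. \<Sum>(i, n)\<in>?I \<times> {..DA}. ?T i n k m)"
      by (simp only: sum.cartesian_product[symmetric])
    also have "\<dots> = (\<Sum>(i, n)\<in>?I \<times> {..DA}. \<Sum>(k, m)\<in>?J \<times> {..DA + DB}. ?T i n k m)"
      by (simp only: case_prod_unfold) (rule sum.swap)
    finally show ?thesis
      by (simp only: sum.cartesian_product[symmetric])
  qed
  also have "\<dots> = (\<Sum>i\<in>?I. \<Sum>n\<le>DA. A i n x ** dmult n (B \<odot>\<^bsub>\<epsilon>\<^esub> C) (N - i) q (?y i))"
  proof (intro sum.cong refl)
    fix i n assume i: "i \<in> ?I" and n: "n \<in> {..DA}"
    \<comment> \<open>\<open>?J\<close> translated by i: the exponent within the inner product is j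
      = k - i.\<close>
    let ?J' = "band d (KA + KB - d * i) (d * N - KC - d * i)"
    have "(dmult n B \<odot>\<^bsub>\<epsilon>\<^esub> C) (N - i) q (?y i) =
        (\<Sum>j\<in>?J'. \<Sum>m\<le>DA + DB. dmult n B j m (?y i) ** dmult m C (N - i - j) q (?y i + of_int j * \<epsilon>))"
      using i n by (intro mult_op_band[OF d supported_dmult[OF supported(2)] supported(3)])
        (auto simp: band_def right_diff_distrib)
    also have "\<dots> = (\<Sum>k\<in>?J. \<Sum>m\<le>DA + DB. dmult n B (k - i) m (?y i) ** dmult m C (N - k) q (?y k))"
      by (rule sum.reindex_bij_witness[of _ "\<lambda>k. k - i" "\<lambda>j. j + i"])
        (auto simp: band_def algebra_simps)
    finally show "(\<Sum>k\<in>?J. \<Sum>m\<le>DA + DB. ?T i n k m) = A i n x ** dmult n (B \<odot>\<^bsub>\<epsilon>\<^esub> C) (N - i) q (?y i)"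
      by (simp add: dmult_mult[OF d B C] mat2.sum_right)
  qed
  also have "\<dots> = (A \<odot>\<^bsub>\<epsilon>\<^esub> (B \<odot>\<^bsub>\<epsilon>\<^esub> C)) N q x"
    by (rule mult_op_band[OF d supported(1) supported_mult[OF d supported(2,3)], symmetric]) auto
  finally show "(A \<odot>\<^bsub>\<epsilon>\<^esub> B \<odot>\<^bsub>\<epsilon>\<^esub> C) N q x = (A \<odot>\<^bsub>\<epsilon>\<^esub> (B \<odot>\<^bsub>\<epsilon>\<^esub> C)) N q x" .
qed

section \<open>Linearity of the product\<close>

lemma smooth_plus: "smooth f \<Longrightarrow> smooth g \<Longrightarrow> smooth (f + g)"
  using smooth_add by (simp add: func_plus)

lemma Dx_pow_add: "smooth f \<Longrightarrow> smooth g \<Longrightarrow> (Dx ^^ r) (f + g) = (Dx ^^ r) f + (Dx ^^ r) g"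
  by (induction r) (simp_all add: func_plus Dx_add smooth_Dx_pow)

lemma Dx_pow_scaleR: "smooth f \<Longrightarrow> (Dx ^^ r) (\<lambda>x. c *\<^sub>R f x) = (\<lambda>x. c *\<^sub>R (Dx ^^ r) f x)"
  by (induction r) (simp_all add: Dx_scaleR smooth_Dx_pow)

lemma scale_op_apply: "scale_op c A k m x = c *\<^sub>R A k m x"
  by (simp add: scale_op_def)

lemma dmult_add: "smooth_op B \<Longrightarrow> smooth_op C \<Longrightarrow> dmult m (B + C) = dmult m B + dmult m C"
  by (intro ext) (auto simp: dmult_def smooth_op_def Dx_pow_add scaleR_add_right
      simp flip: sum.distrib intro!: sum.cong)

lemma dmult_scale: "smooth_op B \<Longrightarrow> dmult m (scale_op c B) = scale_op c (dmult m B)"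
  by (intro ext) (auto simp: dmult_def scale_op_def smooth_op_def Dx_pow_scaleR scaleR_sum_right
      intro!: sum.cong)

lemma supported_add: "supported d K D A \<Longrightarrow> supported d K D B \<Longrightarrow> supported d K D (A + B)"
  by (simp add: supported_def)

lemma supported_scale: "supported d K D A \<Longrightarrow> supported d K D (scale_op c A)"
  by (auto simp: supported_def scale_op_def fun_eq_iff)

lemma bounded_op_common:
  assumes "bounded_op d A" "bounded_op d B"
  obtains K D where "supported d K D A" "supported d K D B"
proof -
  obtain K D K' D' where "supported d K D A" "supported d K' D' B"
    using assms by (auto simp: bounded_op_def)
  then have "supported d (max K K') (max D D') A" "supported d (max K K') (max D D') B"
    by (auto elim: supported_mono)
  then show ?thesis by (rule that)
qed

lemma bounded_op_add: "bounded_op d A \<Longrightarrow> bounded_op d B \<Longrightarrow> bounded_op d (A + B)"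
  by (elim bounded_op_common[of d A B]) (auto simp: bounded_op_def intro: supported_add)

lemma bounded_op_scale: "bounded_op d A \<Longrightarrow> bounded_op d (scale_op c A)"
  unfolding bounded_op_def using supported_scale by blast

lemma smooth_op_add: "smooth_op A \<Longrightarrow> smooth_op B \<Longrightarrow> smooth_op (A + B)"
  by (simp add: smooth_op_def smooth_plus)

lemma smooth_op_scale: "smooth_op A \<Longrightarrow> smooth_op (scale_op c A)"
  by (simp add: smooth_op_def scale_op_def smooth_scaleR)

lemma uminus_eq_scale: "- A = scale_op (-1) A"
  by (simp add: scale_op_def fun_eq_iff)

lemma diff_op_add: "diff_op d A \<Longrightarrow> diff_op d B \<Longrightarrow> diff_op d (A + B)"
  by (simp add: diff_op_def bounded_op_add smooth_op_add)

lemma diff_op_scale: "diff_op d A \<Longrightarrow> diff_op d (scale_op c A)"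
  by (simp add: diff_op_def bounded_op_scale smooth_op_scale)

lemma diff_op_uminus: "diff_op d A \<Longrightarrow> diff_op d (- A)"
  by (simp add: uminus_eq_scale diff_op_scale)

lemma diff_op_diff: "diff_op d A \<Longrightarrow> diff_op d B \<Longrightarrow> diff_op d (A - B)"
  using diff_op_add[OF _ diff_op_uminus, of d A B] by simp

lemma diff_op_zero: "diff_op d 0"
  by (auto simp: diff_op_def bounded_op_def supported_def smooth_op_def)

lemma mult_add_left_coeff:
  assumes "\<And>k m. m > D \<Longrightarrow> A k m = 0" "\<And>k m. m > D \<Longrightarrow> B k m = 0" "finite I"
    "\<And>k m. k \<notin> I \<Longrightarrow> (A k m = 0 \<and> B k m = 0) \<or> C (N - k) = 0"
  shows "((A + B) \<odot>\<^bsub>\<epsilon>\<^esub> C) N q x = (A \<odot>\<^bsub>\<epsilon>\<^esub> C) N q x + (B \<odot>\<^bsub>\<epsilon>\<^esub> C) N q x"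
proof -
  have e: "(X \<odot>\<^bsub>\<epsilon>\<^esub> C) N q x = (\<Sum>k\<in>I. \<Sum>m\<le>D. X k m x ** dmult m C (N - k) q (x + of_int k * \<epsilon>))"
    if "X = A \<or> X = B \<or> X = A + B" for X
  proof (rule mult_op_eq)
    show "X k m x = 0" if "m > D" for k m
      using \<open>X = A \<or> X = B \<or> X = A + B\<close> assms(1,2)[OF that] by auto
    show "X k m x = 0 \<or> C (N - k) = 0" if "k \<notin> I" for k m
      using \<open>X = A \<or> X = B \<or> X = A + B\<close> assms(4)[OF that, of m] by auto
  qed fact
  show ?thesis by (simp add: e mat2.add_left sum.distrib)
qed

lemma mult_add_left:
  assumes "d = 1 \<or> d = -1" "bounded_op d A" "bounded_op d B" "bounded_op d C"
  shows "(A + B) \<odot>\<^bsub>\<epsilon>\<^esub> C = A \<odot>\<^bsub>\<epsilon>\<^esub> C + B \<odot>\<^bsub>\<epsilon>\<^esub> C"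
proof (intro ext)
  fix N q x
  obtain K D K' D' where s: "supported d K D A" "supported d K D B" "supported d K' D' C"
    using assms bounded_op_common unfolding bounded_op_def by metis
  show "((A + B) \<odot>\<^bsub>\<epsilon>\<^esub> C) N q x = (A \<odot>\<^bsub>\<epsilon>\<^esub> C + B \<odot>\<^bsub>\<epsilon>\<^esub> C) N q x"
    by (simp add: mult_op_band[OF assms(1) s(1,3) order_refl order_refl order_refl]
        mult_op_band[OF assms(1) s(2,3) order_refl order_refl order_refl]
        mult_op_band[OF assms(1) supported_add[OF s(1,2)] s(3) order_refl order_refl order_refl]
        mat2.add_left sum.distrib)
qed

text \<open>Here A + B may be two-sided. For fixed N the two bounds on \<open>C\<close> leave
  finitely many k, so the product is still a finite sum. This is what splits (M - Mb) L^l.\<close>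

lemma mult_add_left_banded:
  assumes "bounded_op d A" "bounded_op e B" "bounded_op 1 C" "bounded_op (-1) C"
  shows "(A + B) \<odot>\<^bsub>\<epsilon>\<^esub> C = A \<odot>\<^bsub>\<epsilon>\<^esub> C + B \<odot>\<^bsub>\<epsilon>\<^esub> C"
proof (intro ext)
  fix N q x
  obtain K D K' D' K1 D1 K2 D2 where s: "supported d K D A" "supported e K' D' B"
      "supported 1 K1 D1 C" "supported (-1) K2 D2 C"
    using assms by (auto simp: bounded_op_def)
  have "((A + B) \<odot>\<^bsub>\<epsilon>\<^esub> C) N q x = (A \<odot>\<^bsub>\<epsilon>\<^esub> C) N q x + (B \<odot>\<^bsub>\<epsilon>\<^esub> C) N q x"
  proof (rule mult_add_left_coeff[of "max D D'" _ _ "{N - K1..N + K2}"])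
    show "A k m = 0 \<and> B k m = 0 \<or> C (N - k) = 0" if "k \<notin> {N - K1..N + K2}" for k m
    proof -
      have "1 * (N - k) > K1 \<or> -1 * (N - k) > K2" using that by auto
      then show ?thesis using s(3,4) by (auto simp: supported_def fun_eq_iff)
    qed
  qed (use s in \<open>auto simp: supported_def\<close>)
  then show "((A + B) \<odot>\<^bsub>\<epsilon>\<^esub> C) N q x = (A \<odot>\<^bsub>\<epsilon>\<^esub> C + B \<odot>\<^bsub>\<epsilon>\<^esub> C) N q x" by simp
qed

lemma mult_scale_left:
  assumes "d = 1 \<or> d = -1" "bounded_op d A" "bounded_op d C"
  shows "scale_op c A \<odot>\<^bsub>\<epsilon>\<^esub> C = scale_op c (A \<odot>\<^bsub>\<epsilon>\<^esub> C)"
proof (intro ext)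
  fix N q x
  obtain K D K' D' where s: "supported d K D A" "supported d K' D' C"
    using assms unfolding bounded_op_def by metis
  show "(scale_op c A \<odot>\<^bsub>\<epsilon>\<^esub> C) N q x = scale_op c (A \<odot>\<^bsub>\<epsilon>\<^esub> C) N q x"
    by (simp add: mult_op_band[OF assms(1) s order_refl order_refl order_refl] scale_op_apply
        mult_op_band[OF assms(1) supported_scale[OF s(1)] s(2) order_refl order_refl order_refl]
        mat2.scaleR_left scaleR_sum_right)
qed

lemma mult_add_right:
  assumes "d = 1 \<or> d = -1" "bounded_op d A" "diff_op d B" "diff_op d C"
  shows "A \<odot>\<^bsub>\<epsilon>\<^esub> (B + C) = A \<odot>\<^bsub>\<epsilon>\<^esub> B + A \<odot>\<^bsub>\<epsilon>\<^esub> C"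
proof (intro ext)
  fix N q x
  obtain K D K' D' where s: "supported d K D A" "supported d K' D' B" "supported d K' D' C"
    using assms bounded_op_common unfolding bounded_op_def diff_op_def by metis
  show "(A \<odot>\<^bsub>\<epsilon>\<^esub> (B + C)) N q x = (A \<odot>\<^bsub>\<epsilon>\<^esub> B + A \<odot>\<^bsub>\<epsilon>\<^esub> C) N q x"
    using assms(3,4)
    by (simp add: mult_op_band[OF assms(1) s(1,2) order_refl order_refl order_refl]
        mult_op_band[OF assms(1) s(1,3) order_refl order_refl order_refl]
        mult_op_band[OF assms(1) s(1) supported_add[OF s(2,3)] order_refl order_refl order_refl]
        dmult_add diff_op_def mat2.add_right sum.distrib)
qed

lemma mult_scale_right:
  assumes "d = 1 \<or> d = -1" "bounded_op d A" "diff_op d C"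
  shows "A \<odot>\<^bsub>\<epsilon>\<^esub> scale_op c C = scale_op c (A \<odot>\<^bsub>\<epsilon>\<^esub> C)"
proof (intro ext)
  fix N q x
  obtain K D K' D' where s: "supported d K D A" "supported d K' D' C"
    using assms unfolding bounded_op_def diff_op_def by metis
  show "(A \<odot>\<^bsub>\<epsilon>\<^esub> scale_op c C) N q x = scale_op c (A \<odot>\<^bsub>\<epsilon>\<^esub> C) N q x"
    using assms(3)
    by (simp add: mult_op_band[OF assms(1) s order_refl order_refl order_refl] scale_op_apply
        mult_op_band[OF assms(1) s(1) supported_scale[OF s(2)] order_refl order_refl order_refl]
        diff_op_def dmult_scale mat2.scaleR_right scaleR_sum_right)
qed

section \<open>Powers of the shift, and the unit\<close>

lemma Dx_pow_const: "(Dx ^^ Suc r) (\<lambda>x. a) = 0"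
  by (induction r) (auto simp: func_zero)

lemma Lam_mult: "(Lam j \<odot>\<^bsub>\<epsilon>\<^esub> A) N q x = A (N - j) q (x + of_int j * \<epsilon>)"
  by (subst mult_op_eq[of 0 _ _ "{j}"]) (auto simp: Lam_def mono_op_def)

lemma dmult_Lam: "dmult m (Lam j) N q = (if N = j \<and> q = m then (\<lambda>x. mat 1) else 0)"
proof (intro ext)
  fix x
  have "dmult m (Lam j) N q x = (\<Sum>r\<in>{0}. if m - r \<le> q
     then real (m choose r) *\<^sub>R (Dx ^^ r) (Lam j N (q - (m - r))) x else 0)"
    unfolding dmult_def
  proof (rule sum.mono_neutral_right)
    show "\<forall>r\<in>{..m} - {0}. (if m - r \<le> q
     then real (m choose r) *\<^sub>R (Dx ^^ r) (Lam j N (q - (m - r))) x else 0) = 0"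
    proof
      fix r assume "r \<in> {..m} - {0}"
      then obtain p where "r = Suc p" by (cases r) auto
      then have "(Dx ^^ r) (Lam j N n) = 0" for n
        using Dx_pow_const[of p "mat 1"] Dx_pow_zero[of r] by (simp add: Lam_def mono_op_def)
      then show "(if m - r \<le> q
     then real (m choose r) *\<^sub>R (Dx ^^ r) (Lam j N (q - (m - r))) x else 0) = 0" by simp
    qed
  qed auto
  then show "dmult m (Lam j) N q x = (if N = j \<and> q = m then (\<lambda>x. mat 1) else 0) x"
    by (auto simp: Lam_def mono_op_def)
qed

lemma mult_Lam:
  assumes "bounded_op d A" shows "(A \<odot>\<^bsub>\<epsilon>\<^esub> Lam j) N q x = A (N - j) q x"
proof -
  obtain K D where s: "supported d K D A" using assms by (auto simp: bounded_op_def)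
  have "(A \<odot>\<^bsub>\<epsilon>\<^esub> Lam j) N q x = (\<Sum>k\<in>{N - j}. \<Sum>m\<le>D. A k m x ** dmult m (Lam j) (N - k) q (x
      + of_int k * \<epsilon>))"
    by (rule mult_op_eq) (use s in \<open>auto simp: supported_def Lam_def mono_op_def fun_eq_iff\<close>)
  also have "\<dots> = (\<Sum>k\<in>{N - j}. \<Sum>m\<le>D. if m = q then A k q x else 0)"
    by (intro sum.cong refl) (auto simp: dmult_Lam)
  also have "\<dots> = A (N - j) q x"
    using s by (auto simp: supported_def)
  finally show ?thesis .
qed

lemma one_op_eq_Lam: "one_op = Lam 0"
  by (simp add: one_op_def Lam_def)

lemma one_mult [simp]: "one_op \<odot>\<^bsub>\<epsilon>\<^esub> A = A"
  by (intro ext) (simp add: one_op_eq_Lam Lam_mult)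

lemma mult_one: "bounded_op d A \<Longrightarrow> A \<odot>\<^bsub>\<epsilon>\<^esub> one_op = A"
  by (intro ext) (simp add: one_op_eq_Lam mult_Lam)

lemma zero_mult [simp]: "0 \<odot>\<^bsub>\<epsilon>\<^esub> A = 0"
  by (intro ext) (subst mult_op_eq[of 0 _ _ "{}"], auto)

lemma bounded_op_mono_op: "bounded_op d (mono_op k m a)"
  unfolding bounded_op_def supported_def by (intro exI[of _ "d * k"] exI[of _ m]) (auto simp:
      mono_op_def)

lemma diff_op_mono_op: "smooth a \<Longrightarrow> diff_op d (mono_op k m a)"
  by (simp add: diff_op_def bounded_op_mono_op) (simp add: smooth_op_def mono_op_def)

lemma diff_op_Lam: "diff_op d (Lam j)"
  by (simp add: Lam_def diff_op_mono_op smooth_const)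

lemma diff_op_one: "diff_op d one_op"
  by (simp add: one_op_eq_Lam diff_op_Lam)

section \<open>Commutators and the ring attached to a direction\<close>

definition comm_op :: "real \<Rightarrow> oper \<Rightarrow> oper \<Rightarrow> oper" where
  "comm_op \<epsilon> A B = A \<odot>\<^bsub>\<epsilon>\<^esub> B - B \<odot>\<^bsub>\<epsilon>\<^esub> A"

lemma scale_op_distrib: "scale_op (a + b) A = scale_op a A + scale_op b A"
  by (simp add: scale_op_def fun_eq_iff scaleR_add_left)

lemma scale_op_diff_distrib: "scale_op (a - b) A = scale_op a A - scale_op b A"
  by (simp add: scale_op_def fun_eq_iff scaleR_diff_left)

lemma scale_op_uminus: "scale_op c (- A) = - scale_op c A"
  by (simp add: scale_op_def fun_eq_iff)

lemma scale_op_one [simp]: "scale_op 1 A = A"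
  by (simp add: scale_op_def)

lemma scale_op_zero [simp]: "scale_op 0 A = 0"
  by (simp add: scale_op_def fun_eq_iff)

text \<open>For either direction the \<open>diff_op d\<close> operators form an associative algebra
  with unit \<open>one_op\<close>. The closure rules are simp rules, so that ring computations
  discharge their membership conditions themselves.\<close>

locale op_ring =
  fixes \<epsilon> :: real and d :: int
  assumes d: "d = 1 \<or> d = -1"
begin

lemma diff_opD: "diff_op d A \<Longrightarrow> bounded_op d A"
  by (simp add: diff_op_def)

lemma closed [simp]:
  "diff_op d A \<Longrightarrow> diff_op d B \<Longrightarrow> diff_op d (A \<odot>\<^bsub>\<epsilon>\<^esub> B)"
  "diff_op d A \<Longrightarrow> diff_op d B \<Longrightarrow> diff_op d (A + B)"
  "diff_op d A \<Longrightarrow> diff_op d B \<Longrightarrow> diff_op d (A - B)"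
  "diff_op d A \<Longrightarrow> diff_op d (- A)"
  "diff_op d A \<Longrightarrow> diff_op d (scale_op c A)"
  "diff_op d 0" "diff_op d one_op" "diff_op d (Lam j)"
  by (simp_all add: diff_op_mult[OF d] diff_op_add diff_op_diff diff_op_uminus diff_op_scale
      diff_op_zero diff_op_one diff_op_Lam)

lemma comm_closed [simp]: "diff_op d A \<Longrightarrow> diff_op d B \<Longrightarrow> diff_op d (comm_op \<epsilon> A B)"
  by (simp add: comm_op_def)

lemma pow_closed [simp]: "diff_op d A \<Longrightarrow> diff_op d (pow_op \<epsilon> A n)"
  by (induction n) simp_all

lemma assoc: "diff_op d A \<Longrightarrow> diff_op d B \<Longrightarrow> diff_op d C \<Longrightarrow> A \<odot>\<^bsub>\<epsilon>\<^esub> B \<odot>\<^bsub>\<epsilon>\<^esub> C = A \<odot>\<^bsub>\<epsilon>\<^esub> (B \<odot>\<^bsub>\<epsilon>\<^esub> C)"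
  by (rule mult_op_assoc[OF d]) (simp_all add: diff_opD)

lemma mult_uminus_left: "diff_op d A \<Longrightarrow> diff_op d B \<Longrightarrow> (- A) \<odot>\<^bsub>\<epsilon>\<^esub> B = - (A \<odot>\<^bsub>\<epsilon>\<^esub> B)"
  by (simp add: uminus_eq_scale mult_scale_left[OF d] diff_opD)

lemma mult_uminus_right: "diff_op d A \<Longrightarrow> diff_op d B \<Longrightarrow> A \<odot>\<^bsub>\<epsilon>\<^esub> (- B) = - (A \<odot>\<^bsub>\<epsilon>\<^esub> B)"
  by (simp add: uminus_eq_scale mult_scale_right[OF d] diff_opD)

lemma distribs:
  "diff_op d A \<Longrightarrow> diff_op d B \<Longrightarrow> diff_op d C \<Longrightarrow> (A + B) \<odot>\<^bsub>\<epsilon>\<^esub> C = A \<odot>\<^bsub>\<epsilon>\<^esub> C + B \<odot>\<^bsub>\<epsilon>\<^esub> C"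
  "diff_op d A \<Longrightarrow> diff_op d B \<Longrightarrow> diff_op d C \<Longrightarrow> A \<odot>\<^bsub>\<epsilon>\<^esub> (B + C) = A \<odot>\<^bsub>\<epsilon>\<^esub> B + A \<odot>\<^bsub>\<epsilon>\<^esub> C"
  "diff_op d A \<Longrightarrow> diff_op d B \<Longrightarrow> diff_op d C \<Longrightarrow> (A - B) \<odot>\<^bsub>\<epsilon>\<^esub> C = A \<odot>\<^bsub>\<epsilon>\<^esub> C - B \<odot>\<^bsub>\<epsilon>\<^esub> C"
  "diff_op d A \<Longrightarrow> diff_op d B \<Longrightarrow> diff_op d C \<Longrightarrow> A \<odot>\<^bsub>\<epsilon>\<^esub> (B - C) = A \<odot>\<^bsub>\<epsilon>\<^esub> B - A \<odot>\<^bsub>\<epsilon>\<^esub> C"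
  "diff_op d A \<Longrightarrow> diff_op d B \<Longrightarrow> scale_op c A \<odot>\<^bsub>\<epsilon>\<^esub> B = scale_op c (A \<odot>\<^bsub>\<epsilon>\<^esub> B)"
  "diff_op d A \<Longrightarrow> diff_op d B \<Longrightarrow> A \<odot>\<^bsub>\<epsilon>\<^esub> scale_op c B = scale_op c (A \<odot>\<^bsub>\<epsilon>\<^esub> B)"
proof -
  show add: "diff_op d A \<Longrightarrow> diff_op d B \<Longrightarrow> diff_op d C \<Longrightarrow> (A + B) \<odot>\<^bsub>\<epsilon>\<^esub> C = A \<odot>\<^bsub>\<epsilon>\<^esub> C + B \<odot>\<^bsub>\<epsilon>\<^esub> C"
    "diff_op d A \<Longrightarrow> diff_op d B \<Longrightarrow> diff_op d C \<Longrightarrow> A \<odot>\<^bsub>\<epsilon>\<^esub> (B + C) = A \<odot>\<^bsub>\<epsilon>\<^esub> B + A \<odot>\<^bsub>\<epsilon>\<^esub> C" for A B C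
    by (simp_all add: mult_add_left[OF d] mult_add_right[OF d] diff_opD)
  show "diff_op d A \<Longrightarrow> diff_op d B \<Longrightarrow> diff_op d C \<Longrightarrow> (A - B) \<odot>\<^bsub>\<epsilon>\<^esub> C = A \<odot>\<^bsub>\<epsilon>\<^esub> C - B \<odot>\<^bsub>\<epsilon>\<^esub> C"
    "diff_op d A \<Longrightarrow> diff_op d B \<Longrightarrow> diff_op d C \<Longrightarrow> A \<odot>\<^bsub>\<epsilon>\<^esub> (B - C) = A \<odot>\<^bsub>\<epsilon>\<^esub> B - A \<odot>\<^bsub>\<epsilon>\<^esub> C"
    using add(1)[of A "- B" C] add(2)[of A B "- C"]
        by (simp_all add: mult_uminus_left mult_uminus_right)
qed (simp_all add: mult_scale_left[OF d] mult_scale_right[OF d] diff_opD)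

lemmas ring_simps = assoc distribs mult_uminus_left mult_uminus_right

lemma mult_one' [simp]: "diff_op d A \<Longrightarrow> A \<odot>\<^bsub>\<epsilon>\<^esub> one_op = A"
  by (rule mult_one) (rule diff_opD)

lemma comm_bilinear:
  "diff_op d A \<Longrightarrow> diff_op d B \<Longrightarrow> diff_op d C \<Longrightarrow> comm_op \<epsilon> (A + B) C = comm_op \<epsilon> A C + comm_op \<epsilon> B C"
  "diff_op d A \<Longrightarrow> diff_op d B \<Longrightarrow> diff_op d C \<Longrightarrow> comm_op \<epsilon> C (A + B) = comm_op \<epsilon> C A + comm_op \<epsilon> C B"
  by (simp_all add: comm_op_def ring_simps algebra_simps)

lemma comm_add_add:
  "diff_op d A \<Longrightarrow> diff_op d B \<Longrightarrow> diff_op d C \<Longrightarrow> diff_op d D \<Longrightarrow> comm_op \<epsilon> (A + B) (C + D) =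
    comm_op \<epsilon> A C + comm_op \<epsilon> A D + comm_op \<epsilon> B C + comm_op \<epsilon> B D"
  by (simp add: comm_bilinear add_ac)

lemma comm_swap: "comm_op \<epsilon> A B = - comm_op \<epsilon> B A"
  by (simp add: comm_op_def)

lemma comm_mult:
  assumes "diff_op d A" "diff_op d B" "diff_op d C"
  shows "comm_op \<epsilon> C (A \<odot>\<^bsub>\<epsilon>\<^esub> B) = comm_op \<epsilon> C A \<odot>\<^bsub>\<epsilon>\<^esub> B + A \<odot>\<^bsub>\<epsilon>\<^esub> comm_op \<epsilon> C B"
  using assms by (simp add: comm_op_def ring_simps)

lemma conj_mult:
  assumes "diff_op d P" "diff_op d Q" "diff_op d X" "diff_op d Y" "Q \<odot>\<^bsub>\<epsilon>\<^esub> P = one_op"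
  shows "(P \<odot>\<^bsub>\<epsilon>\<^esub> X \<odot>\<^bsub>\<epsilon>\<^esub> Q) \<odot>\<^bsub>\<epsilon>\<^esub> (P \<odot>\<^bsub>\<epsilon>\<^esub> Y \<odot>\<^bsub>\<epsilon>\<^esub> Q) = P \<odot>\<^bsub>\<epsilon>\<^esub> (X \<odot>\<^bsub>\<epsilon>\<^esub> Y) \<odot>\<^bsub>\<epsilon>\<^esub> Q"
proof -
  have "Q \<odot>\<^bsub>\<epsilon>\<^esub> (P \<odot>\<^bsub>\<epsilon>\<^esub> (Y \<odot>\<^bsub>\<epsilon>\<^esub> Q)) = Y \<odot>\<^bsub>\<epsilon>\<^esub> Q"
    using assms assoc[of Q P "Y \<odot>\<^bsub>\<epsilon>\<^esub> Q"] by simp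
  then show ?thesis using assms by (simp add: assoc)
qed

lemma conj_comm:
  assumes "diff_op d P" "diff_op d Q" "diff_op d X" "diff_op d Y" "Q \<odot>\<^bsub>\<epsilon>\<^esub> P = one_op"
  shows "comm_op \<epsilon> (P \<odot>\<^bsub>\<epsilon>\<^esub> X \<odot>\<^bsub>\<epsilon>\<^esub> Q) (P \<odot>\<^bsub>\<epsilon>\<^esub> Y \<odot>\<^bsub>\<epsilon>\<^esub> Q) = P \<odot>\<^bsub>\<epsilon>\<^esub> comm_op \<epsilon> X Y \<odot>\<^bsub>\<epsilon>\<^esub> Q"
  using assms(1-4)
  by (simp add: comm_op_def conj_mult[OF assms] conj_mult[OF assms(1,2,4,3,5)] distribs)

lemma pow_add: "diff_op d L \<Longrightarrow> pow_op \<epsilon> L (m + n) = pow_op \<epsilon> L m \<odot>\<^bsub>\<epsilon>\<^esub> pow_op \<epsilon> L n"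
  by (induction n) (simp_all add: assoc)

text \<open>Since [L, M] = 1, the bracket with M differentiates powers of L. The truncated index at
  n = 0 is harmless, the factor being 0.\<close>

lemma pow_comm_canonical:
  assumes L: "diff_op d L" and M: "diff_op d M" and LM: "comm_op \<epsilon> L M = one_op"
  shows "pow_op \<epsilon> L n \<odot>\<^bsub>\<epsilon>\<^esub> M = M \<odot>\<^bsub>\<epsilon>\<^esub> pow_op \<epsilon> L n + scale_op (real n) (pow_op \<epsilon> L (n - 1))"
proof (induction n)
  case (Suc n)
  have LM': "L \<odot>\<^bsub>\<epsilon>\<^esub> M = M \<odot>\<^bsub>\<epsilon>\<^esub> L + one_op"
    using LM by (simp add: comm_op_def algebra_simps)
  have pow: "scale_op (real n) (pow_op \<epsilon> L (n - 1)) \<odot>\<^bsub>\<epsilon>\<^esub> L = scale_op (real n) (pow_op \<epsilon> L n)"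
    using L by (cases n) (simp_all add: distribs)
  have "pow_op \<epsilon> L (Suc n) \<odot>\<^bsub>\<epsilon>\<^esub> M = pow_op \<epsilon> L n \<odot>\<^bsub>\<epsilon>\<^esub> M \<odot>\<^bsub>\<epsilon>\<^esub> L + pow_op \<epsilon> L n"
    using L M by (simp add: assoc LM' distribs)
  also have "\<dots> = M \<odot>\<^bsub>\<epsilon>\<^esub> pow_op \<epsilon> L (Suc n) + (scale_op (real n) (pow_op \<epsilon> L n)
      + scale_op 1 (pow_op \<epsilon> L n))"
    unfolding Suc using L M by (simp add: distribs(1) pow[simplified] assoc add.assoc)
  finally show ?case
    by (simp add: scale_op_distrib add.commute)
qed (use assms in simp)

text \<open>M L^l M L^k = M M L^(l+k) + l M L^(l+k-1), and the first term is symmetric in l and k,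
  so it cancels in the commutator.\<close>

lemma virasoro_comm:
  assumes L: "diff_op d L" and M: "diff_op d M" and LM: "comm_op \<epsilon> L M = one_op"
  shows "comm_op \<epsilon> (M \<odot>\<^bsub>\<epsilon>\<^esub> pow_op \<epsilon> L l) (M \<odot>\<^bsub>\<epsilon>\<^esub> pow_op \<epsilon> L k) =
    scale_op (real l - real k) (M \<odot>\<^bsub>\<epsilon>\<^esub> pow_op \<epsilon> L (k + l - 1))"
proof -
  have prod: "(M \<odot>\<^bsub>\<epsilon>\<^esub> pow_op \<epsilon> L l) \<odot>\<^bsub>\<epsilon>\<^esub> (M \<odot>\<^bsub>\<epsilon>\<^esub> pow_op \<epsilon> L k) =
      M \<odot>\<^bsub>\<epsilon>\<^esub> (M \<odot>\<^bsub>\<epsilon>\<^esub> pow_op \<epsilon> L (l + k)) + scale_op (real l) (M \<odot>\<^bsub>\<epsilon>\<^esub> pow_op \<epsilon> L (k + l - 1))"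
          for l k
  proof -
    have "pow_op \<epsilon> L l \<odot>\<^bsub>\<epsilon>\<^esub> (M \<odot>\<^bsub>\<epsilon>\<^esub> pow_op \<epsilon> L k) =
       (M \<odot>\<^bsub>\<epsilon>\<^esub> pow_op \<epsilon> L l + scale_op (real l) (pow_op \<epsilon> L (l - 1))) \<odot>\<^bsub>\<epsilon>\<^esub> pow_op \<epsilon> L k"
      using L M pow_comm_canonical[OF L M LM, of l] by (simp flip: assoc)
    also have "\<dots> = M \<odot>\<^bsub>\<epsilon>\<^esub> pow_op \<epsilon> L (l + k) + scale_op (real l) (pow_op \<epsilon> L (l - 1 + k))"
      using L M by (simp add: ring_simps pow_add)
    \<comment> \<open>At l = 0 the truncated exponents l - 1 + k and k + l - 1 may differ, but then
      the factor \<open>real l\<close> is 0.\<close>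
    also have "\<dots> = M \<odot>\<^bsub>\<epsilon>\<^esub> pow_op \<epsilon> L (l + k) + scale_op (real l) (pow_op \<epsilon> L (k + l - 1))"
      by (cases l) (simp_all add: add.commute)
    finally show ?thesis using L M by (simp add: ring_simps)
  qed
  show ?thesis
    unfolding comm_op_def prod by (simp add: scale_op_diff_distrib add.commute)
qed

end

section \<open>Smooth families of operators\<close>

lemma supported_max:
  "supported d K D A \<Longrightarrow> supported d (max K K') (max D D') A"
  "supported d K D A \<Longrightarrow> supported d (max K' K) (max D' D) A"
  by (auto elim: supported_mono)

text \<open>The bounds are uniform in s: products then expand over one finite window for all s, and
  the derivative passes through the sum.\<close>

definition op_family :: "int \<Rightarrow> (real \<Rightarrow> oper) \<Rightarrow> oper \<Rightarrow> bool" where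
  "op_family d A A' \<longleftrightarrow> (\<exists>K D. (\<forall>s. supported d K D (A s)) \<and> supported d K D A') \<and>
     (\<forall>k m. smooth_family (\<lambda>s. A s k m) (A' k m))"

lemma op_familyI:
  assumes "\<And>s. supported d K D (A s)" "bounded_op d A'" "\<And>k m. smooth_family (\<lambda>s. A s k m) (A' k m)"
  shows "op_family d A A'"
proof -
  obtain K' D' where "supported d K' D' A'" using assms by (auto simp: bounded_op_def)
  then have "(\<forall>s. supported d (max K K') (max D D') (A s)) \<and> supported d (max K K') (max D D') A'"
    using assms(1) by (auto intro: supported_max)
  then show ?thesis using assms(3) by (auto simp: op_family_def)
qed

lemma op_family_diff_op: "op_family d A A' \<Longrightarrow> diff_op d (A s)" "op_family d A A' \<Longrightarrow> diff_op d A'"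
  unfolding op_family_def diff_op_def bounded_op_def smooth_op_def smooth_family_def by blast+

lemma op_family_common:
  assumes "op_family d A A'" "op_family d B B'"
  obtains K D where "\<forall>s. supported d K D (A s)" "supported d K D A'" "\<forall>s. supported d K D (B s)"
      "supported d K D B'"
proof -
  obtain K D K' D' where "\<And>s. supported d K D (A s)" "supported d K D A'"
      "\<And>s. supported d K' D' (B s)" "supported d K' D' B'"
    using assms unfolding op_family_def by metis
  then show ?thesis by (intro that[of "max K K'" "max D D'"]) (auto intro: supported_max)
qed

lemma smooth_family_zero: "smooth_family (\<lambda>s. 0) 0"
  using smooth_family_const[OF smooth_zero] by (simp add: func_zero)

lemma op_family_const: "diff_op d A \<Longrightarrow> op_family d (\<lambda>s. A) 0"
  using smooth_family_const
  by (auto simp: op_family_def diff_op_def bounded_op_def smooth_op_def supported_def func_zero)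

lemma op_family_add:
  assumes "op_family d A A'" "op_family d B B'" shows "op_family d (\<lambda>s. A s + B s) (A' + B')"
proof -
  obtain K D where "\<forall>s. supported d K D (A s)" "supported d K D A'" "\<forall>s. supported d K D (B s)"
      "supported d K D B'"
    by (rule op_family_common[OF assms])
  then have "(\<forall>s. supported d K D (A s + B s)) \<and> supported d K D (A' + B')"
    by (simp add: supported_add)
  moreover have "smooth_family (\<lambda>s. (A s + B s) k m) ((A' + B') k m)" for k m
    using assms smooth_family_add[of "\<lambda>s. A s k m" "A' k m" "\<lambda>s. B s k m" "B' k m"]
    by (auto simp: op_family_def func_plus)
  ultimately show ?thesis by (auto simp: op_family_def)
qed

lemma op_family_uminus:
  assumes "op_family d A A'" shows "op_family d (\<lambda>s. - A s) (- A')"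
proof -
  obtain K D where "\<And>s. supported d K D (A s)" "supported d K D A'"
    using assms by (auto simp: op_family_def)
  then have "(\<forall>s. supported d K D (- A s)) \<and> supported d K D (- A')"
    by (simp add: uminus_eq_scale supported_scale)
  moreover have "smooth_family (\<lambda>s. (- A s) k m) ((- A') k m)" for k m
    using assms smooth_family_uminus[of "\<lambda>s. A s k m" "A' k m"]
    by (auto simp: op_family_def fun_Compl_def)
  ultimately show ?thesis by (auto simp: op_family_def)
qed

lemma op_family_diff: "op_family d A A' \<Longrightarrow> op_family d B B' \<Longrightarrow> op_family d (\<lambda>s. A s - B s) (A' - B')"
  using op_family_add[OF _ op_family_uminus, of d A A' B B'] by simp

lemma smooth_family_Dx_pow: "smooth_family f f' \<Longrightarrow> smooth_family (\<lambda>s. (Dx ^^ r) (f s)) ((Dx ^^ r)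
    f')"
  by (induction r) (auto intro: smooth_family_Dx)

lemma smooth_family_dmult:
  assumes "\<And>q. smooth_family (\<lambda>s. B s N q) (B' N q)"
  shows "smooth_family (\<lambda>s. dmult m (B s) N q) (dmult m B' N q)"
  unfolding dmult_eq_sum
proof (rule smooth_family_sum)
  fix r
  show "smooth_family (\<lambda>s. if m - r \<le> q then \<lambda>x. real (m choose r) *\<^sub>R (Dx ^^ r) (B s N (q -
      (m - r))) x else (\<lambda>x. 0))
     (if m - r \<le> q then \<lambda>x. real (m choose r) *\<^sub>R (Dx ^^ r) (B' N (q - (m - r))) x else (\<lambda>x. 0))"
  proof (cases "m - r \<le> q")
    case True
    have "smooth_family (\<lambda>s x. real (m choose r) *\<^sub>R (Dx ^^ r) (B s N (q - (m - r))) x)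
        (\<lambda>x. real (m choose r) *\<^sub>R (Dx ^^ r) (B' N (q - (m - r))) x)"
      by (intro smooth_family_scaleR smooth_family_Dx_pow assms)
    then show ?thesis by (simp only: True if_True)
  next
    case False
    show ?thesis using smooth_family_const[OF smooth_const] by (simp only: False if_False)
  qed
qed

lemma op_family_mult:
  assumes d: "d = 1 \<or> d = -1" and A: "op_family d A A'" and B: "op_family d B B'"
  shows "op_family d (\<lambda>s. A s \<odot>\<^bsub>\<epsilon>\<^esub> B s) (A 0 \<odot>\<^bsub>\<epsilon>\<^esub> B' + A' \<odot>\<^bsub>\<epsilon>\<^esub> B 0)"
proof -
  obtain K D where KD: "\<forall>s. supported d K D (A s)" "supported d K D A'"
      "\<forall>s. supported d K D (B s)" "supported d K D B'"
    by (rule op_family_common[OF A B])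
  have s: "supported d K D (A s)" "supported d K D A'" "supported d K D (B s)"
      "supported d K D B'" for s
    using KD by auto
  note e = mult_op_band[OF d _ _ order_refl order_refl order_refl, of K D _ K D]
  show ?thesis
    unfolding op_family_def
  proof (intro conjI exI allI)
    show "supported d (K + K) (D + D) (A s \<odot>\<^bsub>\<epsilon>\<^esub> B s)" for s
      by (rule supported_mult[OF d s(1,3)])
    show "supported d (K + K) (D + D) (A 0 \<odot>\<^bsub>\<epsilon>\<^esub> B' + A' \<odot>\<^bsub>\<epsilon>\<^esub> B 0)"
      by (intro supported_add supported_mult[OF d] s)
    fix N q
    have "smooth_family (\<lambda>s x. \<Sum>k\<in>band d K (d * N - K). \<Sum>m\<le>D. A s k m x ** dmult m (B s) (N -
        k) q (x + of_int k * \<epsilon>))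
      (\<lambda>x. \<Sum>k\<in>band d K (d * N - K). \<Sum>m\<le>D. A 0 k m x ** dmult m B' (N - k) q (x + of_int k * \<epsilon>)
         + A' k m x ** dmult m (B 0) (N - k) q (x + of_int k * \<epsilon>))"
      using A B by (intro smooth_family_sum smooth_family_mult smooth_family_shift
          smooth_family_dmult) (auto simp: op_family_def)
    moreover have "(A s \<odot>\<^bsub>\<epsilon>\<^esub> B s) N q = (\<lambda>x. \<Sum>k\<in>band d K (d * N - K). \<Sum>m\<le>D. A s k m x ** dmult m
        (B s) (N - k) q (x + of_int k * \<epsilon>))" for s
      by (intro ext e s)
    moreover have "(A 0 \<odot>\<^bsub>\<epsilon>\<^esub> B' + A' \<odot>\<^bsub>\<epsilon>\<^esub> B 0) N q =
      (\<lambda>x. \<Sum>k\<in>band d K (d * N - K). \<Sum>m\<le>D. A 0 k m x ** dmult m B' (N - k) q (x + of_int k * \<epsilon>)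
         + A' k m x ** dmult m (B 0) (N - k) q (x + of_int k * \<epsilon>))"
      by (simp add: e[OF s(1,4)] e[OF s(2,3)] sum.distrib fun_eq_iff)
    ultimately show "smooth_family (\<lambda>s. (A s \<odot>\<^bsub>\<epsilon>\<^esub> B s) N q) ((A 0 \<odot>\<^bsub>\<epsilon>\<^esub> B' + A' \<odot>\<^bsub>\<epsilon>\<^esub> B 0) N q)"
      by simp
  qed
qed

lemma op_family_unique:
  assumes "op_family d A A'" "op_family e A B'" shows "A' = B'"
proof (intro ext)
  fix k m x
  have "((\<lambda>s. A s k m x) has_vector_derivative A' k m x) (at 0)"
    "((\<lambda>s. A s k m x) has_vector_derivative B' k m x) (at 0)"
    using assms by (auto simp: op_family_def intro: smooth_familyD)
  then show "A' k m x = B' k m x" by (rule vector_derivative_unique_at)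
qed

section \<open>Inverses of pure difference operators\<close>

text \<open>Operators without \<partial> and with d * k \<le> 0 multiply like power series in
  \<Lambda>^(-d), the second factor being shifted. Counting exponents by their distance n from the
  leading one treats both directions at once.\<close>

lemma pure_mult:
  assumes d: "d = 1 \<or> d = -1" and A: "supported d 0 0 A" and B: "supported d 0 0 B"
  shows "(A \<odot>\<^bsub>\<epsilon>\<^esub> B) (- d * int n) 0 x =
    (\<Sum>i\<le>n. A (- d * int i) 0 x ** B (- d * int (n - i)) 0 (x - of_int d * of_nat i * \<epsilon>))"
proof -
  have dd: "d * d = 1" using d by auto
  have dd': "d * (d * z) = z" for z using dd by (simp flip: mult.assoc)
  have "(A \<odot>\<^bsub>\<epsilon>\<^esub> B) (- d * int n) 0 x =
    (\<Sum>k\<in>band d 0 (- int n). \<Sum>m\<le>0. A k m x ** dmult m B (- d * int n - k) 0 (x + of_int k * \<epsilon>))"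
    by (rule mult_op_band[OF d A B]) (simp_all add: dd')
  also have "\<dots> = (\<Sum>k\<in>band d 0 (- int n). A k 0 x ** B (- d * int n - k) 0 (x + of_int k * \<epsilon>))"
    by simp
  also have "\<dots> = (\<Sum>i\<le>n. A (- d * int i) 0 x ** B (- d * int (n - i)) 0 (x - of_int d * of_nat i *
      \<epsilon>))"
  proof (rule sum.reindex_bij_witness[of _ "\<lambda>i. - d * int i" "\<lambda>k. nat (- d * k)"])
    fix k assume k: "k \<in> band d 0 (- int n)"
    then have kn: "0 \<le> - d * k" "- d * k \<le> int n" by (auto simp: band_def)
    then show k': "- d * int (nat (- d * k)) = k" by (simp add: dd')
    show "nat (- d * k) \<in> {..n}" using kn by auto
    have "- d * int (n - nat (- d * k)) = - d * int n - k"
      using kn by (simp add: of_nat_diff nat_le_iff right_diff_distrib distrib_left dd')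
    moreover have "of_int k = - of_int d * real (nat (- d * k))"
      using k' by (metis of_int_minus of_int_mult of_int_of_nat_eq)
    ultimately show "A (- d * int (nat (- d * k))) 0 x ** B (- d * int (n - nat (- d * k))) 0
          (x - of_int d * real (nat (- d * k)) * \<epsilon>) = A k 0 x ** B (- d * int n - k) 0 (x
              + of_int k * \<epsilon>)"
      using k' by simp
  next
    fix i assume "i \<in> {..n}"
    then show "nat (- d * (- d * int i)) = i" "- d * int i \<in> band d 0 (- int n)"
      by (simp_all add: dd' band_def)
  qed
  finally show ?thesis .
qed

lemma one_op_pure: "d = 1 \<or> d = -1 \<Longrightarrow> one_op (- d * int n) 0 x = (if n = 0 then mat 1 else 0)"
  by (auto simp: one_op_def mono_op_def)

text \<open>The coefficient of the inverse at distance \<open>n\<close> from the leading one is a polynomial in the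
  inverse of the leading coefficient of \<open>A\<close>, other coefficients of \<open>A\<close>, and earlier
  coefficients of the inverse.\<close>

lemma op_family_inverse_ex:
  assumes d: "d = 1 \<or> d = -1" and A: "op_family d A A'"
    and sA: "\<And>s. supported d 0 0 (A s)" and sQ: "\<And>s. supported d 0 0 (Q s)"
    and AQ: "\<And>s. A s \<odot>\<^bsub>\<epsilon>\<^esub> Q s = one_op" and QA: "\<And>s. Q s \<odot>\<^bsub>\<epsilon>\<^esub> A s = one_op"
  shows "\<exists>Q'. op_family d Q Q'"
proof -
  have inv: "A s 0 0 x ** Q s 0 0 x = mat 1" "Q s 0 0 x ** A s 0 0 x = mat 1" for s x
    using pure_mult[OF d sA[of s] sQ[of s], of \<epsilon> 0 x] pure_mult[OF d sQ[of s] sA[of s], of \<epsilon> 0 x]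
      one_op_pure[OF d, of 0 x] by (simp_all add: AQ QA)
  have fA: "smooth_family (\<lambda>s. A s k m) (A' k m)" for k m
    using A by (auto simp: op_family_def)
  have fQ0: "\<exists>R. smooth_family (\<lambda>s. Q s 0 0) R"
    using smooth_family_inverse[of "\<lambda>s. A s 0 0" _ "\<lambda>s. Q s 0 0", OF fA inv] by blast
  have fQ: "\<exists>R. smooth_family (\<lambda>s. Q s (- d * int n) 0) R" for n
  proof (induction n rule: less_induct)
    case (less n)
    show ?case
    proof (cases "n = 0")
      case True
      then show ?thesis using fQ0 by simp
    next
      case n: False
      \<comment> \<open>The summands of the n-th coefficient of A Q = 1 other than A_0 Q_n; as A_0
        is invertible, they determine Q_n.\<close>
      define T where "T s x = (\<Sum>i\<in>{1..n}. A s (- d * int i) 0 x ** Q s (- d * int (n - i)) 0 (x -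
          of_int d * of_nat i * \<epsilon>))" for s x
      have "Q s (- d * int n) 0 x = - (Q s 0 0 x ** T s x)" for s x
      proof -
        have "0 = (\<Sum>i\<le>n. A s (- d * int i) 0 x ** Q s (- d * int (n - i)) 0 (x - of_int d * of_nat
            i * \<epsilon>))"
          using pure_mult[OF d sA[of s] sQ[of s], of \<epsilon> n x] one_op_pure[OF d, of n x] n
              by (simp add: AQ)
        also have "\<dots> = A s 0 0 x ** Q s (- d * int n) 0 x + T s x"
        proof -
          have "{..n} = insert 0 {1..n}" by auto
          then show ?thesis by (simp add: T_def)
        qed
        finally have "A s 0 0 x ** Q s (- d * int n) 0 x = - T s x"
          by (simp add: eq_neg_iff_add_eq_0)
        then have "Q s 0 0 x ** (A s 0 0 x ** Q s (- d * int n) 0 x) = - (Q s 0 0 x ** T s x)"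
          by (simp add: mat2.minus_right)
        then show ?thesis by (simp add: matrix_mul_assoc inv)
      qed
      then have Qn: "(\<lambda>s. Q s (- d * int n) 0) = (\<lambda>s x. - (Q s 0 0 x ** T s x))"
        by (intro ext)
      obtain R where R: "smooth_family (\<lambda>s. Q s (- d * int i) 0) (R i)" if "i < n" for i
        using less by metis
      obtain R0 where R0: "smooth_family (\<lambda>s. Q s 0 0) R0" using fQ0 by blast
      have term_i: "smooth_family (\<lambda>s x. A s (- d * int i) 0 x ** Q s (- d * int (n - i)) 0 (x -
          of_int d * of_nat i * \<epsilon>))
         (\<lambda>x. A 0 (- d * int i) 0 x ** R (n - i) (x - of_int d * of_nat i * \<epsilon>)
             + A' (- d * int i) 0 x ** Q 0 (- d * int (n - i)) 0 (x - of_int d * of_nat i * \<epsilon>))"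
        if "i \<in> {1..n}" for i
        using smooth_family_mult[OF fA smooth_family_shift[OF R, of "n - i"
            "- (of_int d * of_nat i * \<epsilon>)"]] that
        by simp
      have "smooth_family T (\<lambda>x. \<Sum>i\<in>{1..n}. A 0 (- d * int i) 0 x ** R (n - i) (x -
          of_int d * of_nat i * \<epsilon>)
             + A' (- d * int i) 0 x ** Q 0 (- d * int (n - i)) 0 (x - of_int d * of_nat i * \<epsilon>))"
        unfolding T_def[abs_def] by (intro smooth_family_sum term_i)
      from smooth_family_uminus[OF smooth_family_mult[OF R0 this]] show ?thesis
        unfolding Qn by (intro exI)
    qed
  qed
  \<comment> \<open>The derivative is chosen to be 0 outside the support, so that the assembled
    \<open>Q'\<close> obeys the same bounds as \<open>Q s\<close>.\<close>
  have "\<exists>R. smooth_family (\<lambda>s. Q s k m) R \<and> (d * k > 0 \<or> m > 0 \<longrightarrow> R = 0)" for k m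
  proof (cases "d * k > 0 \<or> m > 0")
    case True
    then have "Q s k m = 0" for s using sQ[of s] by (auto simp: supported_def)
    then show ?thesis using smooth_family_zero by (intro exI[of _ 0]) simp
  next
    case False
    have "k = - d * int (nat (- d * k))"
      using False d by auto
    then show ?thesis using fQ[of "nat (- d * k)"] False by auto
  qed
  then obtain Q' where Q': "smooth_family (\<lambda>s. Q s k m) (Q' k m)" "d * k > 0 \<or> m > 0 \<longrightarrow> Q' k m = 0"
      for k m
    by metis
  have "op_family d Q Q'"
  proof (rule op_familyI[OF sQ])
    have "supported d 0 0 Q'" using Q' by (simp add: supported_def)
    then show "bounded_op d Q'" by (auto simp: bounded_op_def)
  qed (rule Q'(1))
  then show ?thesis by (intro exI)
qed

text \<open>Once \<open>Q\<close> is known to be a family, differentiating A Q = 1 and multiplying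
  by \<open>Q 0\<close> from the left yields its derivative.\<close>

lemma op_family_inverse:
  assumes d: "d = 1 \<or> d = -1" and A: "op_family d A A'"
    and sA: "\<And>s. supported d 0 0 (A s)" and sQ: "\<And>s. supported d 0 0 (Q s)"
    and AQ: "\<And>s. A s \<odot>\<^bsub>\<epsilon>\<^esub> Q s = one_op" and QA: "\<And>s. Q s \<odot>\<^bsub>\<epsilon>\<^esub> A s = one_op"
  shows "op_family d Q (- (Q 0 \<odot>\<^bsub>\<epsilon>\<^esub> A' \<odot>\<^bsub>\<epsilon>\<^esub> Q 0))"
proof -
  interpret op_ring \<epsilon> d by standard (rule d)
  obtain Q' where Q': "op_family d Q Q'"
    using op_family_inverse_ex[OF assms] by blast
  have diff_op [simp]: "diff_op d (A s)" "diff_op d A'" "diff_op d (Q s)" "diff_op d Q'" for s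
    using op_family_diff_op[OF A] op_family_diff_op[OF Q'] by auto
  have "A 0 \<odot>\<^bsub>\<epsilon>\<^esub> Q' + A' \<odot>\<^bsub>\<epsilon>\<^esub> Q 0 = 0"
    using op_family_mult[OF d A Q', of \<epsilon>] op_family_const[OF diff_op_one, of d]
        by (simp add: AQ op_family_unique)
  then have "A 0 \<odot>\<^bsub>\<epsilon>\<^esub> Q' = - (A' \<odot>\<^bsub>\<epsilon>\<^esub> Q 0)"
    by (simp add: eq_neg_iff_add_eq_0)
  then have "Q 0 \<odot>\<^bsub>\<epsilon>\<^esub> A 0 \<odot>\<^bsub>\<epsilon>\<^esub> Q' = - (Q 0 \<odot>\<^bsub>\<epsilon>\<^esub> A' \<odot>\<^bsub>\<epsilon>\<^esub> Q 0)"
    by (simp add: assoc mult_uminus_right)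
  then show ?thesis using Q' by (simp add: QA)
qed

text \<open>Applied to a family that is constant in s, the statement on families becomes one on
  smoothness in x.\<close>

lemma smooth_op_inverse:
  assumes "d = 1 \<or> d = -1" "smooth_op A" "supported d 0 0 A" "supported d 0 0 Q"
    "A \<odot>\<^bsub>\<epsilon>\<^esub> Q = one_op" "Q \<odot>\<^bsub>\<epsilon>\<^esub> A = one_op"
  shows "diff_op d Q"
proof -
  have "op_family d (\<lambda>s. A) 0"
    using assms(2,3) by (intro op_family_const) (auto simp: diff_op_def bounded_op_def)
  then obtain Q' where "op_family d (\<lambda>s. Q) Q'"
    using op_family_inverse_ex[of d "\<lambda>s. A" 0 "\<lambda>s. Q"] assms by auto
  then show ?thesis by (rule op_family_diff_op)
qed

text \<open>\<open>Q'\<close> is only bounded because the candidates under \<open>THE\<close> in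
  \<open>inv_lower\<close> and \<open>inv_upper\<close> are not known to be smooth; associativity
  allows this for the leftmost factor.\<close>

lemma inverse_unique:
  assumes d: "d = 1 \<or> d = -1" and "diff_op d A" "diff_op d Q" "bounded_op d Q'"
    "A \<odot>\<^bsub>\<epsilon>\<^esub> Q = one_op" "Q' \<odot>\<^bsub>\<epsilon>\<^esub> A = one_op"
  shows "Q' = Q"
proof -
  have "Q' = Q' \<odot>\<^bsub>\<epsilon>\<^esub> (A \<odot>\<^bsub>\<epsilon>\<^esub> Q)"
    using assms by (simp add: mult_one[of d])
  also have "\<dots> = Q' \<odot>\<^bsub>\<epsilon>\<^esub> A \<odot>\<^bsub>\<epsilon>\<^esub> Q"
    using mult_op_assoc[OF d, of Q' A Q \<epsilon>] assms by simp
  finally show ?thesis using assms by simp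
qed

text \<open>The n-th coefficient of P Q = 1, solved for the n-th coefficient of Q when the leading
  coefficient of P is 1.\<close>

fun right_inv :: "real \<Rightarrow> oper \<Rightarrow> nat \<Rightarrow> real \<Rightarrow> mat2" where
  "right_inv \<epsilon> P n = (\<lambda>x. if n = 0 then mat 1 else
     - (\<Sum>i<n. P (- int (n - i)) 0 x ** right_inv \<epsilon> P i (x - real (n - i) * \<epsilon>)))"

declare right_inv.simps [simp del]

lemma right_inverse_ex:
  assumes P: "supported 1 0 0 P" "P 0 0 = (\<lambda>x. mat 1)" "smooth_op P"
  shows "\<exists>Q. supported 1 0 0 Q \<and> Q 0 0 = (\<lambda>x. mat 1) \<and> smooth_op Q \<and> P \<odot>\<^bsub>\<epsilon>\<^esub> Q = one_op"
proof -
  define Q :: oper where "Q k m = (if k \<le> 0 \<and> m = 0 then right_inv \<epsilon> P (nat (- k)) else 0)" for k m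
  have sQ: "supported 1 0 0 Q" by (auto simp: supported_def Q_def)
  have Q0: "Q 0 0 = (\<lambda>x. mat 1)" by (simp add: Q_def right_inv.simps)
  have "smooth (right_inv \<epsilon> P n)" for n
  proof (induction n rule: less_induct)
    case (less n)
    show ?case
    proof (cases "n = 0")
      case False
      have "smooth (\<lambda>x. - (\<Sum>i<n. P (- int (n - i)) 0 x ** right_inv \<epsilon> P i (x
          + - (real (n - i) * \<epsilon>))))"
        using P(3) less by (intro smooth_uminus smooth_sum smooth_mult smooth_shift) (auto simp:
            smooth_op_def)
      then show ?thesis using False by (subst right_inv.simps) simp
    qed (simp add: right_inv.simps smooth_const)
  qed
  then have smQ: "smooth_op Q" by (simp add: smooth_op_def Q_def)
  have Qn: "Q (- int n) 0 = right_inv \<epsilon> P n" for n by (simp add: Q_def)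
  have coeff: "(P \<odot>\<^bsub>\<epsilon>\<^esub> Q) (- int n) 0 x = (if n = 0 then mat 1 else 0)" for n x
  proof -
    have "(P \<odot>\<^bsub>\<epsilon>\<^esub> Q) (- int n) 0 x = (\<Sum>i\<le>n. P (- int i) 0 x ** right_inv \<epsilon> P (n - i) (x -
        real i * \<epsilon>))"
      using pure_mult[OF _ P(1) sQ, of \<epsilon> n x] by (simp add: Qn del: of_nat_diff)
    also have "\<dots> = (\<Sum>i\<le>n. P (- int (n - i)) 0 x ** right_inv \<epsilon> P i (x - real (n - i) * \<epsilon>))"
      by (rule sum.reindex_bij_witness[of _ "\<lambda>i. n - i" "\<lambda>i. n - i"]) auto
    also have "\<dots> = (\<Sum>i<n. P (- int (n - i)) 0 x ** right_inv \<epsilon> P i (x - real (n - i) * \<epsilon>))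
        + right_inv \<epsilon> P n x"
      by (simp add: lessThan_Suc_atMost[symmetric] P(2))
    also have "\<dots> = (if n = 0 then mat 1 else 0)"
      by (subst (2) right_inv.simps) simp
    finally show ?thesis .
  qed
  have sPQ: "supported 1 0 0 (P \<odot>\<^bsub>\<epsilon>\<^esub> Q)"
    using supported_mult[OF _ P(1) sQ, of \<epsilon>] by simp
  have "(P \<odot>\<^bsub>\<epsilon>\<^esub> Q) k m x = one_op k m x" for k m x
  proof (cases "k > 0 \<or> m > 0")
    case True
    then show ?thesis using sPQ by (auto simp: supported_def one_op_def mono_op_def)
  next
    case False
    then show ?thesis using coeff[of "nat (- k)" x] by (auto simp: one_op_def mono_op_def)
  qed
  then have "P \<odot>\<^bsub>\<epsilon>\<^esub> Q = one_op" by (intro ext)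
  then show ?thesis using sQ Q0 smQ by (intro exI[of _ Q]) auto
qed

lemma lower_op_iff: "lower_op A \<longleftrightarrow> supported 1 0 0 A"
  by (simp add: lower_op_def supported_def)

lemma upper_op_iff: "upper_op A \<longleftrightarrow> supported (-1) 0 0 A"
  by (simp add: upper_op_def supported_def)

text \<open>A right inverse \<open>R\<close> of the right inverse \<open>Q\<close> of P equals P, as
  in a group, so \<open>Q\<close> is two-sided; uniqueness identifies it with the operator picked by
  \<open>THE\<close>.\<close>

lemma inv_lower:
  assumes P: "lower_op P" "P 0 0 = (\<lambda>x. mat 1)" "smooth_op P"
  shows "lower_op (inv_lower \<epsilon> P)" "inverse_of \<epsilon> P (inv_lower \<epsilon> P)"
proof -
  have sP: "supported 1 0 0 P" and opP: "diff_op 1 P"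
    using P by (auto simp: lower_op_iff diff_op_def bounded_op_def)
  obtain Q where Q: "supported 1 0 0 Q" "Q 0 0 = (\<lambda>x. mat 1)" "smooth_op Q" "P \<odot>\<^bsub>\<epsilon>\<^esub> Q = one_op"
    using right_inverse_ex[OF sP P(2,3)] by blast
  have opQ: "diff_op 1 Q" using Q by (auto simp: diff_op_def bounded_op_def)
  obtain R where R: "supported 1 0 0 R" "smooth_op R" "Q \<odot>\<^bsub>\<epsilon>\<^esub> R = one_op"
    using right_inverse_ex[OF Q(1-3)] by blast
  have "P = R"
    using R Q(4) opP opQ by (intro inverse_unique[of 1 Q R P \<epsilon>]) (auto simp: diff_op_def
        bounded_op_def)
  then have inv: "inverse_of \<epsilon> P Q"
    using Q R by (simp add: inverse_of_def)
  have "inv_lower \<epsilon> P = Q"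
    unfolding inv_lower_def
  proof (rule the_equality)
    show "lower_op Q \<and> inverse_of \<epsilon> P Q" using Q inv by (simp add: lower_op_iff)
    show "Q' = Q" if "lower_op Q' \<and> inverse_of \<epsilon> P Q'" for Q'
      using that by (intro inverse_unique[of 1 P Q Q' \<epsilon>] opP opQ Q)
        (auto simp: lower_op_iff inverse_of_def bounded_op_def)
  qed
  then show "lower_op (inv_lower \<epsilon> P)" "inverse_of \<epsilon> P (inv_lower \<epsilon> P)"
    using Q inv by (auto simp: lower_op_iff)
qed

text \<open>The leading coefficient of Pb is not normalised, so existence of an inverse is taken
  from \<open>dressing\<close>; what remains is that this inverse is smooth and unique.\<close>

lemma inv_upper:
  assumes P: "upper_op P" "smooth_op P" "\<exists>Q. upper_op Q \<and> inverse_of \<epsilon> P Q"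
  shows "upper_op (inv_upper \<epsilon> P)" "inverse_of \<epsilon> P (inv_upper \<epsilon> P)"
proof -
  have sP: "supported (-1) 0 0 P" and opP: "diff_op (-1) P"
    using P by (auto simp: upper_op_iff diff_op_def bounded_op_def)
  obtain Q where Q: "upper_op Q" "inverse_of \<epsilon> P Q"
    using P(3) by blast
  have opQ: "diff_op (-1) Q"
    using Q by (intro smooth_op_inverse[OF _ P(2) sP, of Q \<epsilon>]) (auto simp: upper_op_iff
        inverse_of_def)
  have "inv_upper \<epsilon> P = Q"
    unfolding inv_upper_def
  proof (rule the_equality)
    show "upper_op Q \<and> inverse_of \<epsilon> P Q" using Q by simp
    show "Q' = Q" if "upper_op Q' \<and> inverse_of \<epsilon> P Q'" for Q'
      using that Q by (intro inverse_unique[of "-1" P Q Q' \<epsilon>] opP opQ)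
        (auto simp: upper_op_iff inverse_of_def bounded_op_def)
  qed
  then show "upper_op (inv_upper \<epsilon> P)" "inverse_of \<epsilon> P (inv_upper \<epsilon> P)"
    using Q by auto
qed

section \<open>Flows and commutators\<close>

context op_ring
begin

lemma op_family_mult' : "op_family d A A' \<Longrightarrow> op_family d B B' \<Longrightarrow>
    op_family d (\<lambda>s. A s \<odot>\<^bsub>\<epsilon>\<^esub> B s) (A 0 \<odot>\<^bsub>\<epsilon>\<^esub> B' + A' \<odot>\<^bsub>\<epsilon>\<^esub> B 0)"
  by (rule op_family_mult[OF d])

text \<open>From P' = g P follows Q' = - Q g for the inverse, hence (P X Q)' = g P X Q - P X Q
  g.\<close>

lemma op_family_conj:
  assumes P: "op_family d P (g \<odot>\<^bsub>\<epsilon>\<^esub> P 0)" and g: "diff_op d g" and X: "diff_op d X"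
    and pure: "\<And>s. supported d 0 0 (P s)" "\<And>s. supported d 0 0 (Q s)"
    and inv: "\<And>s. P s \<odot>\<^bsub>\<epsilon>\<^esub> Q s = one_op" "\<And>s. Q s \<odot>\<^bsub>\<epsilon>\<^esub> P s = one_op"
  shows "op_family d (\<lambda>s. P s \<odot>\<^bsub>\<epsilon>\<^esub> X \<odot>\<^bsub>\<epsilon>\<^esub> Q s) (comm_op \<epsilon> g (P 0 \<odot>\<^bsub>\<epsilon>\<^esub> X \<odot>\<^bsub>\<epsilon>\<^esub> Q 0))"
proof -
  have Q: "op_family d Q (- (Q 0 \<odot>\<^bsub>\<epsilon>\<^esub> (g \<odot>\<^bsub>\<epsilon>\<^esub> P 0) \<odot>\<^bsub>\<epsilon>\<^esub> Q 0))"
    by (rule op_family_inverse[OF d P pure inv])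
  have [simp]: "diff_op d (P s)" "diff_op d (Q s)" for s
    using op_family_diff_op(1)[OF P] op_family_diff_op(1)[OF Q] by auto
  note [simp] = g X inv
  have "op_family d (\<lambda>s. P s \<odot>\<^bsub>\<epsilon>\<^esub> X \<odot>\<^bsub>\<epsilon>\<^esub> Q s)
     ((P 0 \<odot>\<^bsub>\<epsilon>\<^esub> X) \<odot>\<^bsub>\<epsilon>\<^esub> (- (Q 0 \<odot>\<^bsub>\<epsilon>\<^esub> (g \<odot>\<^bsub>\<epsilon>\<^esub> P 0) \<odot>\<^bsub>\<epsilon>\<^esub> Q 0))
       + (P 0 \<odot>\<^bsub>\<epsilon>\<^esub> 0 + (g \<odot>\<^bsub>\<epsilon>\<^esub> P 0) \<odot>\<^bsub>\<epsilon>\<^esub> X) \<odot>\<^bsub>\<epsilon>\<^esub> Q 0)"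
    by (rule op_family_mult'[OF op_family_mult'[OF P op_family_const[OF X]] Q])
  moreover have "P 0 \<odot>\<^bsub>\<epsilon>\<^esub> 0 = 0"
    using distribs(6)[of "P 0" 0 0] by simp
  ultimately show ?thesis
    by (simp add: comm_op_def ring_simps)
qed

lemma op_family_comm_mult:
  assumes "op_family d A (comm_op \<epsilon> g (A 0))" "op_family d B (comm_op \<epsilon> g (B 0))" "diff_op d g"
  shows "op_family d (\<lambda>s. A s \<odot>\<^bsub>\<epsilon>\<^esub> B s) (comm_op \<epsilon> g (A 0 \<odot>\<^bsub>\<epsilon>\<^esub> B 0))"
proof -
  have "diff_op d (A 0)" "diff_op d (B 0)" using assms op_family_diff_op by auto
  then show ?thesis
    using op_family_mult'[OF assms(1,2)] assms(3) by (simp add: comm_mult add.commute)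
qed

lemma comm_one [simp]: "diff_op d g \<Longrightarrow> comm_op \<epsilon> g one_op = 0"
  by (simp add: comm_op_def)

lemma op_family_pow:
  assumes "op_family d L (comm_op \<epsilon> g (L 0))" "diff_op d g"
  shows "op_family d (\<lambda>s. pow_op \<epsilon> (L s) n) (comm_op \<epsilon> g (pow_op \<epsilon> (L 0) n))"
proof (induction n)
  case 0
  show ?case using op_family_const[of d one_op] comm_one[OF assms(2)]
      by (simp only: pow_op.simps closed)
next
  case (Suc n)
  then show ?case using op_family_comm_mult[OF Suc assms(1,2)] by simp
qed

end

lemma op_family_flow:
  assumes "op_family d (\<lambda>s. A (\<Phi> l s \<tau>)) A'"
  shows "flow_deriv \<Phi> l A \<tau> = A'" "flow_differentiable \<Phi> l A \<tau>"
proof -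
  have *: "((\<lambda>s. A (\<Phi> l s \<tau>) k m x) has_vector_derivative A' k m x) (at 0)" for k m x
    using assms by (auto simp: op_family_def intro: smooth_familyD)
  show "flow_deriv \<Phi> l A \<tau> = A'"
    unfolding flow_deriv_def using vector_derivative_at[OF *] by (intro ext)
  show "flow_differentiable \<Phi> l A \<tau>"
    unfolding flow_differentiable_def using * differentiableI_vector by blast
qed

text \<open>The first derivatives are required at every point, because they are themselves
  differentiated along the other flow; the second ones only at \<sigma>.\<close>

lemma virasoro_relationI:
  assumes A: "\<And>i \<tau>. op_family d (\<lambda>s. A (\<Phi> i s \<tau>)) (A' i \<tau>)"
    and lk: "op_family d (\<lambda>s. A' k (\<Phi> l s \<sigma>)) D" and kl: "op_family d (\<lambda>s. A' l (\<Phi> k s \<sigma>)) E"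
    and "D - E = scale_op (real k - real l) (A' (k + l - 1) \<sigma>)"
  shows "virasoro_relation \<Phi> l k A \<sigma>"
proof -
  have "flow_deriv \<Phi> i A = A' i" for i
    by (rule ext) (rule op_family_flow(1)[where A = A and \<Phi> = \<Phi>, OF A])
  then show ?thesis
    using assms(4) op_family_flow(2)[where A = A and \<Phi> = \<Phi>, OF A]
      op_family_flow[where A = "A' k" and \<Phi> = \<Phi>, OF lk] op_family_flow[where A = "A' l"
          and \<Phi> = \<Phi>, OF kl]
    by (simp add: virasoro_relation_def)
qed

context op_ring
begin

text \<open>\<open>D\<close> and \<open>E\<close> are the derivatives of g k along flow l and of g l
  along flow k. Differentiating (g k) P along flow l gives (D + g k g l) P, so the commutator of the
  flows acts on P as left multiplication by D - E + [g k, g l], and on L as the bracket with that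
  same operator.\<close>

lemma zero_curvature_virasoro:
  fixes g :: "nat \<Rightarrow> 's \<Rightarrow> oper"
  assumes \<Phi>0: "\<And>i \<tau>. \<Phi> i 0 \<tau> = \<tau>"
    and g: "\<And>i \<tau>. diff_op d (g i \<tau>)"
    and lk: "op_family d (\<lambda>s. g k (\<Phi> l s \<sigma>)) D" and kl: "op_family d (\<lambda>s. g l (\<Phi> k s \<sigma>)) E"
    and zc: "D - E + comm_op \<epsilon> (g k \<sigma>) (g l \<sigma>) = scale_op (real k - real l) (g (k + l - 1) \<sigma>)"
  shows "(\<And>i \<tau>. op_family d (\<lambda>s. P (\<Phi> i s \<tau>)) (g i \<tau> \<odot>\<^bsub>\<epsilon>\<^esub> P \<tau>)) \<Longrightarrow> virasoro_relation \<Phi> l k P \<sigma>"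
    and "(\<And>i \<tau>. op_family d (\<lambda>s. L (\<Phi> i s \<tau>)) (comm_op \<epsilon> (g i \<tau>) (L \<tau>))) \<Longrightarrow>
        virasoro_relation \<Phi> l k L \<sigma>"
proof -
  have [simp]: "diff_op d D" "diff_op d E" using op_family_diff_op(2) lk kl by auto
  note [simp] = g \<Phi>0
  have DE: "D - E = scale_op (real k - real l) (g (k + l - 1) \<sigma>) - comm_op \<epsilon> (g k \<sigma>) (g l \<sigma>)"
    using zc by (simp add: algebra_simps)
  show "virasoro_relation \<Phi> l k P \<sigma>" if P: "\<And>i \<tau>. op_family d (\<lambda>s. P (\<Phi> i s \<tau>)) (g i \<tau> \<odot>\<^bsub>\<epsilon>\<^esub> P \<tau>)"
  proof (rule virasoro_relationI[where A = P and \<Phi> = \<Phi> and A' = "\<lambda>i \<tau>. g i \<tau> \<odot>\<^bsub>\<epsilon>\<^esub> P \<tau>", OF P])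
    have [simp]: "diff_op d (P \<sigma>)" using op_family_diff_op(1)[OF P, of l 0] by simp
    show "op_family d (\<lambda>s. g k (\<Phi> l s \<sigma>) \<odot>\<^bsub>\<epsilon>\<^esub> P (\<Phi> l s \<sigma>)) (g k \<sigma> \<odot>\<^bsub>\<epsilon>\<^esub> (g l \<sigma> \<odot>\<^bsub>\<epsilon>\<^esub> P \<sigma>)
        + D \<odot>\<^bsub>\<epsilon>\<^esub> P \<sigma>)"
      using op_family_mult'[OF lk P[of l \<sigma>]] by simp
    show "op_family d (\<lambda>s. g l (\<Phi> k s \<sigma>) \<odot>\<^bsub>\<epsilon>\<^esub> P (\<Phi> k s \<sigma>)) (g l \<sigma> \<odot>\<^bsub>\<epsilon>\<^esub> (g k \<sigma> \<odot>\<^bsub>\<epsilon>\<^esub> P \<sigma>)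
        + E \<odot>\<^bsub>\<epsilon>\<^esub> P \<sigma>)"
      using op_family_mult'[OF kl P[of k \<sigma>]] by simp
    have "g k \<sigma> \<odot>\<^bsub>\<epsilon>\<^esub> (g l \<sigma> \<odot>\<^bsub>\<epsilon>\<^esub> P \<sigma>) + D \<odot>\<^bsub>\<epsilon>\<^esub> P \<sigma> - (g l \<sigma> \<odot>\<^bsub>\<epsilon>\<^esub> (g k \<sigma> \<odot>\<^bsub>\<epsilon>\<^esub> P \<sigma>) + E \<odot>\<^bsub>\<epsilon>\<^esub> P \<sigma>) =
        (D - E + comm_op \<epsilon> (g k \<sigma>) (g l \<sigma>)) \<odot>\<^bsub>\<epsilon>\<^esub> P \<sigma>"
      by (simp add: comm_op_def ring_simps algebra_simps)
    then show "g k \<sigma> \<odot>\<^bsub>\<epsilon>\<^esub> (g l \<sigma> \<odot>\<^bsub>\<epsilon>\<^esub> P \<sigma>) + D \<odot>\<^bsub>\<epsilon>\<^esub> P \<sigma> - (g l \<sigma> \<odot>\<^bsub>\<epsilon>\<^esub> (g k \<sigma> \<odot>\<^bsub>\<epsilon>\<^esub> P \<sigma>)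
        + E \<odot>\<^bsub>\<epsilon>\<^esub> P \<sigma>) =
        scale_op (real k - real l) (g (k + l - 1) \<sigma> \<odot>\<^bsub>\<epsilon>\<^esub> P \<sigma>)"
      unfolding zc by (simp add: distribs)
  qed
  show "virasoro_relation \<Phi> l k L \<sigma>" if L: "\<And>i \<tau>. op_family d (\<lambda>s. L (\<Phi> i s \<tau>)) (comm_op \<epsilon> (g i \<tau>)
      (L \<tau>))"
  proof (rule virasoro_relationI[where A = L and \<Phi> = \<Phi> and A' =
      "\<lambda>i \<tau>. comm_op \<epsilon> (g i \<tau>) (L \<tau>)", OF L])
    have [simp]: "diff_op d (L \<sigma>)" using op_family_diff_op(1)[OF L, of l 0] by simp
    have comm: "op_family d (\<lambda>s. comm_op \<epsilon> (A s) (B s)) (comm_op \<epsilon> (A 0) B' + comm_op \<epsilon> A' (B 0))"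
      if "op_family d A A'" "op_family d B B'" for A A' B B'
      using op_family_diff[OF op_family_mult'[OF that] op_family_mult'[OF that(2,1)]]
          by (simp add: comm_op_def algebra_simps)
    show "op_family d (\<lambda>s. comm_op \<epsilon> (g k (\<Phi> l s \<sigma>)) (L (\<Phi> l s \<sigma>))) (comm_op \<epsilon> (g k \<sigma>) (comm_op \<epsilon>
        (g l \<sigma>) (L \<sigma>)) + comm_op \<epsilon> D (L \<sigma>))"
      using comm[OF lk L[of l \<sigma>]] by simp
    show "op_family d (\<lambda>s. comm_op \<epsilon> (g l (\<Phi> k s \<sigma>)) (L (\<Phi> k s \<sigma>))) (comm_op \<epsilon> (g l \<sigma>) (comm_op \<epsilon>
        (g k \<sigma>) (L \<sigma>)) + comm_op \<epsilon> E (L \<sigma>))"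
      using comm[OF kl L[of k \<sigma>]] by simp
    \<comment> \<open>The Jacobi identity combines the nested brackets into the bracket of
      [g k, g l] with L.\<close>
    have "comm_op \<epsilon> (g k \<sigma>) (comm_op \<epsilon> (g l \<sigma>) (L \<sigma>))
        + comm_op \<epsilon> D (L \<sigma>) - (comm_op \<epsilon> (g l \<sigma>) (comm_op \<epsilon> (g k \<sigma>) (L \<sigma>)) + comm_op \<epsilon> E (L \<sigma>)) =
        comm_op \<epsilon> (D - E + comm_op \<epsilon> (g k \<sigma>) (g l \<sigma>)) (L \<sigma>)"
      by (simp add: comm_op_def ring_simps algebra_simps)
    then show "comm_op \<epsilon> (g k \<sigma>) (comm_op \<epsilon> (g l \<sigma>) (L \<sigma>))
        + comm_op \<epsilon> D (L \<sigma>) - (comm_op \<epsilon> (g l \<sigma>) (comm_op \<epsilon> (g k \<sigma>) (L \<sigma>)) + comm_op \<epsilon> E (L \<sigma>)) =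
        scale_op (real k - real l) (comm_op \<epsilon> (g (k + l - 1) \<sigma>) (L \<sigma>))"
      unfolding zc by (simp add: comm_op_def distribs) (simp add: scale_op_def fun_eq_iff
          scaleR_diff_right)
  qed
qed

end

lemma op_ring_1: "op_ring 1" by standard simp
lemma op_ring_m1: "op_ring (-1)" by standard simp

section \<open>The canonical relations for \<open>Gam\<close> and \<open>Gam_bar\<close>\<close>

text \<open>Captures everything in \<open>Gam\<close> and \<open>Gam_bar\<close> except the term
  containing x. Coefficients independent of x commute with \<Lambda>, and such operators lie in both
  rings.\<close>

definition const_op :: "oper \<Rightarrow> bool" where
  "const_op A \<longleftrightarrow> bounded_op 1 A \<and> bounded_op (-1) A \<and> (\<exists>a. A = (\<lambda>k m x. a k m))"

lemma const_op_add: "const_op A \<Longrightarrow> const_op B \<Longrightarrow> const_op (A + B)"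
  unfolding const_op_def
proof (elim conjE exE, intro conjI exI)
  fix a b assume "A = (\<lambda>k m x. a k m)" "B = (\<lambda>k m x. b k m)"
  then show "A + B = (\<lambda>k m x. a k m + b k m)" by (simp add: fun_eq_iff)
qed (simp_all add: bounded_op_add)

lemma const_op_scale: "const_op A \<Longrightarrow> const_op (scale_op c A)"
  unfolding const_op_def
proof (elim conjE exE, intro conjI exI)
  fix a assume "A = (\<lambda>k m x. a k m)"
  then show "scale_op c A = (\<lambda>k m x. c *\<^sub>R a k m)" by (simp add: fun_eq_iff scale_op_apply)
qed (simp_all add: bounded_op_scale)

lemma const_op_zero: "const_op 0"
  using diff_op_zero[of 1] diff_op_zero[of "-1"] by (auto simp: const_op_def diff_op_def func_zero)

lemma const_op_uminus: "const_op A \<Longrightarrow> const_op (- A)"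
  by (simp add: uminus_eq_scale const_op_scale)

lemma const_op_diff: "const_op A \<Longrightarrow> const_op B \<Longrightarrow> const_op (A - B)"
  using const_op_add[OF _ const_op_uminus, of A B] by simp

lemma const_op_sum: "(\<And>i. i \<in> I \<Longrightarrow> const_op (f i)) \<Longrightarrow> const_op (sum f I)"
  by (induction I rule: infinite_finite_induct) (simp_all add: const_op_add const_op_zero)

text \<open>\<open>Sum_any\<close> is the sum over the nonzero summands, or 0 if there are
  infinitely many; either value is constant in x.\<close>

lemma const_op_Sum_any: "(\<And>i. const_op (f i)) \<Longrightarrow> const_op (Sum_any f)"
  by (simp add: Sum_any.expand_set const_op_sum)

lemma const_op_mono_op: "const_op (mono_op k m (\<lambda>x. a))"
proof -
  have "mono_op k m (\<lambda>x. a) = (\<lambda>k' m' x. if k' = k \<and> m' = m then a else 0)"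
    by (simp add: mono_op_def fun_eq_iff)
  then show ?thesis unfolding const_op_def
    by (intro conjI exI bounded_op_mono_op)
qed

lemma const_op_basic: "const_op (Lam j)" "const_op one_op" "const_op (eps_d \<epsilon>)"
  by (simp_all add: Lam_def one_op_def eps_d_def const_op_mono_op)

lemma const_op_Lam_mult:
  assumes "const_op A" shows "const_op (Lam j \<odot>\<^bsub>\<epsilon>\<^esub> A)"
proof -
  obtain a where a: "A = (\<lambda>k m x. a k m)" using assms by (auto simp: const_op_def)
  then have "Lam j \<odot>\<^bsub>\<epsilon>\<^esub> A = (\<lambda>k m x. a (k - j) m)"
    by (simp add: Lam_mult fun_eq_iff)
  moreover have "bounded_op d (Lam j \<odot>\<^bsub>\<epsilon>\<^esub> A)" if "d = 1 \<or> d = -1" for d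
    using assms that diff_op_Lam by (intro bounded_op_mult) (auto simp: const_op_def diff_op_def)
  ultimately show ?thesis by (auto simp: const_op_def)
qed

lemma const_op_diff_op: "const_op A \<Longrightarrow> d = 1 \<or> d = -1 \<Longrightarrow> diff_op d A"
  by (auto simp: const_op_def diff_op_def smooth_op_def smooth_const)

lemma comm_Lam_const_op:
  assumes "const_op A" shows "comm_op \<epsilon> (Lam j) A = 0"
proof -
  obtain a where a: "A = (\<lambda>k m x. a k m)" and "bounded_op 1 A"
    using assms by (auto simp: const_op_def)
  then show ?thesis
    by (simp add: comm_op_def Lam_mult mult_Lam[of 1] fun_eq_iff)
qed

lemma smooth_x_over_eps: "smooth (x_over_eps \<epsilon>)"
proof (rule smoothI)
  have *: "(x_over_eps \<epsilon> has_vector_derivative (1 / \<epsilon>) *\<^sub>R mat 1) (at x)" for x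
    unfolding x_over_eps_def has_vector_derivative_def
    by (auto intro!: derivative_eq_intros simp: divide_inverse)
  then show "x_over_eps \<epsilon> differentiable (at x)" for x
    by (rule differentiableI_vector)
  have "Dx (x_over_eps \<epsilon>) = (\<lambda>x. (1 / \<epsilon>) *\<^sub>R mat 1)"
    by (rule Dx_eqI) (rule *)
  then show "smooth (Dx (x_over_eps \<epsilon>))"
    by (simp add: smooth_const)
qed

lemma Gam_decomp: "\<exists>C. const_op C \<and> Gam \<epsilon> t y = mono_op (-1) 0 (x_over_eps \<epsilon>) + C"
proof -
  define C where "C = Sum_any (\<lambda>n. scale_op (real n * t n) (Lam (int n - 1)))
     + Sum_any (\<lambda>n. scale_op (inv_fact_pred n * y n)
         (Lam (int n - 1) \<odot>\<^bsub>\<epsilon>\<^esub> (eps_d \<epsilon> - scale_op (harm (n - 1)) one_op)))"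
  have "const_op C"
    unfolding C_def
    by (intro const_op_add const_op_Sum_any const_op_scale const_op_Lam_mult const_op_diff
        const_op_basic)
  then show ?thesis
    by (intro exI[of _ C]) (simp only: Gam_def C_def add.assoc simp_thms)
qed

lemma Gam_bar_decomp: "\<exists>C. const_op C \<and> Gam_bar \<epsilon> y = mono_op 1 0 (- x_over_eps \<epsilon>) + C"
proof -
  define C where "C = - Sum_any (\<lambda>n. scale_op (inv_fact_pred n * y n)
         (Lam (- int n + 1) \<odot>\<^bsub>\<epsilon>\<^esub> (- eps_d \<epsilon> - scale_op (harm n) one_op)))"
  have "const_op C"
    unfolding C_def
    by (intro const_op_uminus const_op_Sum_any const_op_scale const_op_Lam_mult const_op_diff
        const_op_basic)
  then show ?thesis
    by (intro exI[of _ C]) (simp only: Gam_bar_def C_def diff_conv_add_uminus simp_thms)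
qed

lemma smooth_uminus_x_over_eps: "smooth (- x_over_eps \<epsilon>)"
  using smooth_uminus[OF smooth_x_over_eps] by (simp add: fun_Compl_def)

text \<open>The commutator of \<Lambda>^j with a \<Lambda>^(-j) is multiplication by a (x + j
  \<epsilon>) - a x. The opposite signs of x in \<open>Gam\<close> and \<open>Gam_bar\<close> match
  the opposite shifts, so both commutators are 1.\<close>

lemma comm_Lam_mono:
  assumes "\<epsilon> \<noteq> 0" "j = 1 \<and> a = x_over_eps \<epsilon> \<or> j = -1 \<and> a = - x_over_eps \<epsilon>"
  shows "comm_op \<epsilon> (Lam j) (mono_op (- j) 0 a) = one_op"
proof (intro ext)
  fix N q x
  have *: "a (x + of_int j * \<epsilon>) - a x = mat 1"
    using assms by (auto simp: x_over_eps_def add_divide_distrib diff_divide_distrib simp flip: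
        scaleR_diff_left)
  have "comm_op \<epsilon> (Lam j) (mono_op (- j) 0 a) N q x =
     mono_op (- j) 0 a (N - j) q (x + of_int j * \<epsilon>) - mono_op (- j) 0 a (N - j) q x"
    by (simp add: comm_op_def Lam_mult mult_Lam[OF bounded_op_mono_op[of 1]])
  also have "\<dots> = one_op N q x"
    using * by (auto simp: mono_op_def one_op_def)
  finally show "comm_op \<epsilon> (Lam j) (mono_op (- j) 0 a) N q x = one_op N q x" .
qed

lemma Gam_diff_op: "diff_op 1 (Gam \<epsilon> t y)" "\<epsilon> \<noteq> 0 \<Longrightarrow> comm_op \<epsilon> (Lam 1) (Gam \<epsilon> t y) = one_op"
proof -
  interpret op_ring \<epsilon> 1 by (rule op_ring_1)
  obtain C where C: "const_op C" "Gam \<epsilon> t y = mono_op (-1) 0 (x_over_eps \<epsilon>) + C"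
    using Gam_decomp by blast
  have diff_op: "diff_op 1 (mono_op (-1) 0 (x_over_eps \<epsilon>))" "diff_op 1 C"
    using diff_op_mono_op[OF smooth_x_over_eps] const_op_diff_op[OF C(1)] by auto
  then show "diff_op 1 (Gam \<epsilon> t y)" unfolding C(2) by simp
  show "comm_op \<epsilon> (Lam 1) (Gam \<epsilon> t y) = one_op" if "\<epsilon> \<noteq> 0"
    unfolding C(2) using diff_op comm_Lam_mono[OF that, of 1]
    by (simp add: comm_bilinear comm_Lam_const_op[OF C(1)])
qed

lemma Gam_bar_diff_op: "diff_op (-1) (Gam_bar \<epsilon> y)" "\<epsilon> \<noteq> 0 \<Longrightarrow> comm_op \<epsilon> (Lam (-1)) (Gam_bar \<epsilon> y) =
    one_op"
proof -
  interpret op_ring \<epsilon> "-1" by (rule op_ring_m1)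
  obtain C where C: "const_op C" "Gam_bar \<epsilon> y = mono_op 1 0 (- x_over_eps \<epsilon>) + C"
    using Gam_bar_decomp by blast
  have diff_op: "diff_op (-1) (mono_op 1 0 (- x_over_eps \<epsilon>))" "diff_op (-1) C"
    using diff_op_mono_op[OF smooth_uminus_x_over_eps] const_op_diff_op[OF C(1)] by auto
  then show "diff_op (-1) (Gam_bar \<epsilon> y)" unfolding C(2) by simp
  show "comm_op \<epsilon> (Lam (-1)) (Gam_bar \<epsilon> y) = one_op" if "\<epsilon> \<noteq> 0"
    unfolding C(2) using diff_op comm_Lam_mono[OF that, of "-1"]
    by (simp add: comm_bilinear comm_Lam_const_op[OF C(1)])
qed

section \<open>Negative and nonnegative parts\<close>

lemma part_linear:
  "minus_part (A + B) = minus_part A + minus_part B" "plus_part (A + B) = plus_part A + plus_part B"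
  "minus_part (A - B) = minus_part A - minus_part B" "plus_part (A - B) = plus_part A - plus_part B"
  "minus_part (scale_op c A) = scale_op c (minus_part A)" "plus_part (scale_op c A) =
      scale_op c (plus_part A)"
  by (auto simp: minus_part_def plus_part_def scale_op_def fun_eq_iff)

lemma plus_minus_part: "A = plus_part A + minus_part A"
  by (auto simp: minus_part_def plus_part_def fun_eq_iff)

text \<open>The result lies in direction 1 for either d, since negative powers are bounded above
  whatever the operator was. So the negative part of the upper operators \<open>Ab\<close> is
  available in the lower ring.\<close>

lemma op_family_minus_part:
  assumes "op_family d A A'" shows "op_family 1 (\<lambda>s. minus_part (A s)) (minus_part A')"
proof -
  obtain K D where s: "\<And>s. supported d K D (A s)" "supported d K D A'"
    using assms by (auto simp: op_family_def)
  have "(\<forall>s. supported 1 0 D (minus_part (A s))) \<and> supported 1 0 D (minus_part A')"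
    using s by (auto simp: supported_def minus_part_def)
  moreover have "smooth_family (\<lambda>s. minus_part (A s) k m) (minus_part A' k m)" for k m
    using assms smooth_family_zero by (cases "k < 0") (auto simp: minus_part_def op_family_def)
  ultimately show ?thesis by (auto simp: op_family_def)
qed

lemma op_family_plus_part:
  assumes "op_family d A A'" shows "op_family (-1) (\<lambda>s. plus_part (A s)) (plus_part A')"
proof -
  obtain K D where s: "\<And>s. supported d K D (A s)" "supported d K D A'"
    using assms by (auto simp: op_family_def)
  have "(\<forall>s. supported (-1) 0 D (plus_part (A s))) \<and> supported (-1) 0 D (plus_part A')"
    using s by (auto simp: supported_def plus_part_def)
  moreover have "smooth_family (\<lambda>s. plus_part (A s) k m) (plus_part A' k m)" for k m
    using assms smooth_family_zero by (cases "k < 0") (auto simp: plus_part_def op_family_def)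
  ultimately show ?thesis by (auto simp: op_family_def)
qed

lemma diff_op_minus_part: "diff_op d A \<Longrightarrow> diff_op 1 (minus_part A)"
  using op_family_minus_part[OF op_family_const] op_family_diff_op(1) by blast

lemma diff_op_plus_part: "diff_op d A \<Longrightarrow> diff_op (-1) (plus_part A)"
  using op_family_plus_part[OF op_family_const] op_family_diff_op(1) by blast

text \<open>Strictly negative powers and nonnegative powers are each closed under multiplication.
  \<open>A\<close> and \<open>B\<close> may be two-sided; a bound on their order in \<partial> puts
  their parts into the two rings.\<close>

lemma part_comm:
  assumes A: "\<And>k m. m > D \<Longrightarrow> A k m = 0" and B: "\<And>k m. m > E \<Longrightarrow> B k m = 0"
  shows "minus_part (comm_op \<epsilon> (minus_part A) (minus_part B)) =
      comm_op \<epsilon> (minus_part A) (minus_part B)" (is ?g1)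
    and "plus_part (comm_op \<epsilon> (minus_part A) (minus_part B)) = 0" (is ?g2)
    and "plus_part (comm_op \<epsilon> (plus_part A) (plus_part B)) =
        comm_op \<epsilon> (plus_part A) (plus_part B)" (is ?g3)
    and "minus_part (comm_op \<epsilon> (plus_part A) (plus_part B)) = 0" (is ?g4)
proof -
  have m: "supported 1 (-1) D (minus_part A)" "supported 1 (-1) E (minus_part B)"
    and p: "supported (-1) 0 D (plus_part A)" "supported (-1) 0 E (plus_part B)"
    using A B by (auto simp: supported_def minus_part_def plus_part_def)
  have "comm_op \<epsilon> (minus_part A) (minus_part B) k = 0" if "k \<ge> 0" for k
    using that supported_mult[OF _ m, of \<epsilon>] supported_mult[OF _ m(2,1), of \<epsilon>]
    by (auto simp: comm_op_def supported_def fun_eq_iff)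
  then show ?g1 ?g2 by (auto simp: minus_part_def plus_part_def fun_eq_iff)
  have "comm_op \<epsilon> (plus_part A) (plus_part B) k = 0" if "k < 0" for k
    using that supported_mult[OF _ p, of \<epsilon>] supported_mult[OF _ p(2,1), of \<epsilon>]
    by (auto simp: comm_op_def supported_def fun_eq_iff)
  then show ?g3 ?g4 by (auto simp: minus_part_def plus_part_def fun_eq_iff)
qed

section \<open>From smoothness along the flows to families of operators\<close>

lemma smooth_along_flows_smooth:
  assumes "smooth_along_flows \<Phi> A" "\<And>\<tau>. \<Phi> l 0 \<tau> = \<tau>"
  shows "smooth (A \<tau> k m)"
proof -
  obtain U where U: "UNIV \<times> {0} \<subseteq> U" "\<And>n. Ck_on n U (\<lambda>(x, s). A (\<Phi> l s \<tau>) k m x)"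
    using assms(1) unfolding smooth_along_flows_def by meson
  show ?thesis
    unfolding smooth_def using Ck_on_imp_n_diff[OF U(1) U(2)] assms(2) by simp
qed

text \<open>The hypotheses are local near s = 0. Smoothness in x at other s is obtained at the point
  \<open>\<Phi> l s \<tau>\<close>, where the flow starts anew with increment 0.\<close>

lemma smooth_along_flows_op_family:
  assumes sm: "smooth_along_flows \<Phi> A" and \<Phi>0: "\<And>\<tau>. \<Phi> l 0 \<tau> = \<tau>"
    and der: "has_op_derivative (\<lambda>s. A (\<Phi> l s \<tau>)) A' 0" and A': "diff_op d A'"
    and supported: "\<And>\<tau>. supported d K D (A \<tau>)"
  shows "op_family d (\<lambda>s. A (\<Phi> l s \<tau>)) A'"
proof (rule op_familyI)
  show "supported d K D (A (\<Phi> l s \<tau>))" for s by (rule supported)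
  show "bounded_op d A'" using A' by (simp add: diff_op_def)
  show "smooth_family (\<lambda>s. A (\<Phi> l s \<tau>) k m) (A' k m)" for k m
  proof -
    obtain U where U: "open U" "UNIV \<times> {0} \<subseteq> U" "\<And>n. Ck_on n U (\<lambda>(x, s). A (\<Phi> l s \<tau>) k m x)"
      using sm unfolding smooth_along_flows_def by meson
    have "((\<lambda>s. A (\<Phi> l s \<tau>) k m x) has_vector_derivative A' k m x) (at 0)" for x
      using der by (simp add: has_op_derivative_def)
    then have "family_deriv n (\<lambda>s. A (\<Phi> l s \<tau>) k m) (A' k m)" for n
      using Ck_on_imp_family_deriv[OF U(1,2) U(3), where f' = "A' k m" and n = n] by simp
    then show ?thesis
      using A' smooth_along_flows_smooth[OF sm \<Phi>0]
          by (simp add: smooth_family_def diff_op_def smooth_op_def)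
  qed
qed

lemma mult_diff_left_banded:
  assumes "diff_op 1 A" "diff_op (-1) B" "diff_op 1 C" "diff_op (-1) C"
  shows "(A - B) \<odot>\<^bsub>\<epsilon>\<^esub> C = A \<odot>\<^bsub>\<epsilon>\<^esub> C - B \<odot>\<^bsub>\<epsilon>\<^esub> C"
proof -
  interpret op_ring \<epsilon> "-1" by (rule op_ring_m1)
  have "(A + - B) \<odot>\<^bsub>\<epsilon>\<^esub> C = A \<odot>\<^bsub>\<epsilon>\<^esub> C + (- B) \<odot>\<^bsub>\<epsilon>\<^esub> C"
    by (rule mult_add_left_banded[of 1 _ "-1"]) (use assms diff_op_uminus diff_op_def in auto)
  then show ?thesis using assms by (simp add: mult_uminus_left)
qed

section \<open>Zero curvature and the Virasoro relation for the additional flows\<close>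

text \<open>The times t and y are fixed and only the point of the phase space moves, so
  \<open>Gam\<close> and \<open>Gam_bar\<close> are constant along the flows.\<close>

locale additional_flow_setting =
  fixes \<epsilon> :: real and t y :: time_seq and P Pb :: "'s \<Rightarrow> oper"
    and \<Phi> :: "nat \<Rightarrow> real \<Rightarrow> 's \<Rightarrow> 's"
  assumes eps: "\<epsilon> \<noteq> 0"
    and \<Phi>0: "\<And>l \<tau>. \<Phi> l 0 \<tau> = \<tau>"
    and dress: "\<And>\<tau>. dressing \<epsilon> (P \<tau>) (Pb \<tau>)"
    and smP: "smooth_along_flows \<Phi> P" and smPb: "smooth_along_flows \<Phi> Pb"
    and flows: "additional_flows \<epsilon> t y P Pb \<Phi>"
begin

sublocale low: op_ring \<epsilon> 1 by (rule op_ring_1)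
sublocale up: op_ring \<epsilon> "-1" by (rule op_ring_m1)

abbreviation Q where "Q \<tau> \<equiv> inv_lower \<epsilon> (P \<tau>)"
abbreviation Qb where "Qb \<tau> \<equiv> inv_upper \<epsilon> (Pb \<tau>)"
abbreviation L where "L \<tau> \<equiv> Lax \<epsilon> (P \<tau>)"
abbreviation M where "M \<tau> \<equiv> OS \<epsilon> t y (P \<tau>)"
abbreviation Mb where "Mb \<tau> \<equiv> OS_bar \<epsilon> y (Pb \<tau>)"
abbreviation A where "A l \<tau> \<equiv> M \<tau> \<odot>\<^bsub>\<epsilon>\<^esub> pow_op \<epsilon> (L \<tau>) l"
abbreviation Ab where "Ab l \<tau> \<equiv> Mb \<tau> \<odot>\<^bsub>\<epsilon>\<^esub> pow_op \<epsilon> (L \<tau>) l"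
abbreviation W where "W l \<tau> \<equiv> additional_generator \<epsilon> t y (P \<tau>) (Pb \<tau>) l"
abbreviation g where "g l \<tau> \<equiv> - minus_part (W l \<tau>)"
abbreviation gb where "gb l \<tau> \<equiv> plus_part (W l \<tau>)"

lemma supported_P: "supported 1 0 0 (P \<tau>)" and supported_Pb: "supported (-1) 0 0 (Pb \<tau>)"
  using dress[of \<tau>] by (auto simp: dressing_def lower_op_iff upper_op_iff)

lemma diff_op_P [simp]: "diff_op 1 (P \<tau>)" and diff_op_Pb [simp]: "diff_op (-1) (Pb \<tau>)"
  using supported_P supported_Pb smooth_along_flows_smooth[OF smP \<Phi>0] smooth_along_flows_smooth[OF
      smPb \<Phi>0]
  by (auto simp: diff_op_def bounded_op_def smooth_op_def)

lemma Q: "supported 1 0 0 (Q \<tau>)" "P \<tau> \<odot>\<^bsub>\<epsilon>\<^esub> Q \<tau> = one_op" "Q \<tau> \<odot>\<^bsub>\<epsilon>\<^esub> P \<tau> = one_op"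
  using inv_lower[of "P \<tau>" \<epsilon>] dress[of \<tau>] diff_op_P[of \<tau>]
  by (auto simp: dressing_def lower_op_iff inverse_of_def diff_op_def)

lemma Qb: "supported (-1) 0 0 (Qb \<tau>)" "Pb \<tau> \<odot>\<^bsub>\<epsilon>\<^esub> Qb \<tau> = one_op" "Qb \<tau> \<odot>\<^bsub>\<epsilon>\<^esub> Pb \<tau> = one_op"
  using inv_upper[of "Pb \<tau>" \<epsilon>] dress[of \<tau>] diff_op_Pb[of \<tau>]
  by (auto simp: dressing_def upper_op_iff inverse_of_def diff_op_def)

lemma diff_op_Q [simp]: "diff_op 1 (Q \<tau>)" and diff_op_Qb [simp]: "diff_op (-1) (Qb \<tau>)"
  using smooth_op_inverse[OF low.d _ supported_P Q] smooth_op_inverse[OF up.d _ supported_Pb Qb]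
      diff_op_P diff_op_Pb
  by (auto simp: diff_op_def)

lemma L_eq: "L \<tau> = P \<tau> \<odot>\<^bsub>\<epsilon>\<^esub> Lam 1 \<odot>\<^bsub>\<epsilon>\<^esub> Q \<tau>" "L \<tau> = Pb \<tau> \<odot>\<^bsub>\<epsilon>\<^esub> Lam (-1) \<odot>\<^bsub>\<epsilon>\<^esub> Qb \<tau>"
  using dress[of \<tau>] by (auto simp: Lax_def dressing_def)

text \<open>The two expressions for L given by the constraint place it in one ring each. It is
  therefore banded, and so are its powers.\<close>

lemma diff_op_L [simp]: "diff_op 1 (L \<tau>)" "diff_op (-1) (L \<tau>)"
  unfolding L_eq(1) by simp (simp flip: L_eq(1) add: L_eq(2))

lemma diff_op_M [simp]: "diff_op 1 (M \<tau>)" and diff_op_Mb [simp]: "diff_op (-1) (Mb \<tau>)"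
  by (simp_all add: OS_def OS_bar_def Gam_diff_op Gam_bar_diff_op)

lemma canonical: "comm_op \<epsilon> (L \<tau>) (M \<tau>) = one_op" "comm_op \<epsilon> (L \<tau>) (Mb \<tau>) = one_op"
  unfolding OS_def OS_bar_def
   apply (simp add: L_eq(1) low.conj_comm Q Gam_diff_op eps)
  apply (simp add: L_eq(2) up.conj_comm Qb Gam_bar_diff_op eps)
  done

lemma W_eq: "W l \<tau> = A l \<tau> - Ab l \<tau>"
  unfolding additional_generator_def by (simp add: mult_diff_left_banded)

lemma diff_op_g [simp]: "diff_op 1 (g l \<tau>)" and diff_op_gb [simp]: "diff_op (-1) (gb l \<tau>)"
proof -
  have "diff_op 1 (A l \<tau>)" "diff_op (-1) (Ab l \<tau>)" by simp_all
  from this[THEN diff_op_minus_part] this[THEN diff_op_plus_part]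
  show "diff_op 1 (g l \<tau>)" "diff_op (-1) (gb l \<tau>)"
    unfolding W_eq part_linear by simp_all
qed

lemma op_family_P: "op_family 1 (\<lambda>s. P (\<Phi> l s \<tau>)) (g l \<tau> \<odot>\<^bsub>\<epsilon>\<^esub> P \<tau>)"
  and op_family_Pb: "op_family (-1) (\<lambda>s. Pb (\<Phi> l s \<tau>)) (gb l \<tau> \<odot>\<^bsub>\<epsilon>\<^esub> Pb \<tau>)"
proof -
  show "op_family 1 (\<lambda>s. P (\<Phi> l s \<tau>)) (g l \<tau> \<odot>\<^bsub>\<epsilon>\<^esub> P \<tau>)"
  proof (rule smooth_along_flows_op_family[OF smP \<Phi>0 _ _ supported_P])
    show "has_op_derivative (\<lambda>s. P (\<Phi> l s \<tau>)) (g l \<tau> \<odot>\<^bsub>\<epsilon>\<^esub> P \<tau>) 0"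
      using flows by (simp add: additional_flows_def)
  qed simp
  show "op_family (-1) (\<lambda>s. Pb (\<Phi> l s \<tau>)) (gb l \<tau> \<odot>\<^bsub>\<epsilon>\<^esub> Pb \<tau>)"
  proof (rule smooth_along_flows_op_family[OF smPb \<Phi>0 _ _ supported_Pb])
    show "has_op_derivative (\<lambda>s. Pb (\<Phi> l s \<tau>)) (gb l \<tau> \<odot>\<^bsub>\<epsilon>\<^esub> Pb \<tau>) 0"
      using flows by (simp add: additional_flows_def)
  qed simp
qed

lemma op_family_conj_low: "diff_op 1 X \<Longrightarrow> op_family 1 (\<lambda>s. P (\<Phi> l s \<tau>) \<odot>\<^bsub>\<epsilon>\<^esub> X \<odot>\<^bsub>\<epsilon>\<^esub> Q (\<Phi> l s \<tau>))
    (comm_op \<epsilon> (g l \<tau>) (P \<tau> \<odot>\<^bsub>\<epsilon>\<^esub> X \<odot>\<^bsub>\<epsilon>\<^esub> Q \<tau>))"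
  using low.op_family_conj[of "\<lambda>s. P (\<Phi> l s \<tau>)" "g l \<tau>" X "\<lambda>s. Q (\<Phi> l s \<tau>)"] op_family_P[of l \<tau>]
  by (simp add: \<Phi>0 supported_P Q)

lemma op_family_conj_up: "diff_op (-1) X \<Longrightarrow> op_family (-1) (\<lambda>s. Pb (\<Phi> l s \<tau>) \<odot>\<^bsub>\<epsilon>\<^esub> X \<odot>\<^bsub>\<epsilon>\<^esub> Qb (\<Phi> l s
    \<tau>))
    (comm_op \<epsilon> (gb l \<tau>) (Pb \<tau> \<odot>\<^bsub>\<epsilon>\<^esub> X \<odot>\<^bsub>\<epsilon>\<^esub> Qb \<tau>))"
  using up.op_family_conj[of "\<lambda>s. Pb (\<Phi> l s \<tau>)" "gb l \<tau>" X "\<lambda>s. Qb (\<Phi> l s \<tau>)"] op_family_Pb[of l \<tau>]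
  by (simp add: \<Phi>0 supported_Pb Qb)

lemma op_family_L: "op_family 1 (\<lambda>s. L (\<Phi> l s \<tau>)) (comm_op \<epsilon> (g l \<tau>) (L \<tau>))"
  and op_family_L': "op_family (-1) (\<lambda>s. L (\<Phi> l s \<tau>)) (comm_op \<epsilon> (gb l \<tau>) (L \<tau>))"
  using op_family_conj_low[of "Lam 1" l \<tau>] apply (simp add: L_eq(1))
  using op_family_conj_up[of "Lam (-1)" l \<tau>] apply (simp add: L_eq(2))
  done

text \<open>\<open>M\<close> and \<open>L\<close> are conjugates by P of operators fixed along the
  flow, so both change by the bracket with \<open>g l\<close>; this bracket is a derivation and
  passes to M L^k.\<close>

lemma op_family_A: "op_family 1 (\<lambda>s. A k (\<Phi> l s \<tau>)) (comm_op \<epsilon> (g l \<tau>) (A k \<tau>))"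
  using low.op_family_comm_mult[of "\<lambda>s. M (\<Phi> l s \<tau>)" "g l \<tau>" "\<lambda>s. pow_op \<epsilon> (L (\<Phi> l s \<tau>)) k"]
    low.op_family_pow[of "\<lambda>s. L (\<Phi> l s \<tau>)" "g l \<tau>" k] op_family_L[of l \<tau>] op_family_conj_low[of
        "Gam \<epsilon> t y" l \<tau>]
  by (simp add: \<Phi>0 OS_def Gam_diff_op)

lemma op_family_Ab: "op_family (-1) (\<lambda>s. Ab k (\<Phi> l s \<tau>)) (comm_op \<epsilon> (gb l \<tau>) (Ab k \<tau>))"
  using up.op_family_comm_mult[of "\<lambda>s. Mb (\<Phi> l s \<tau>)" "gb l \<tau>" "\<lambda>s. pow_op \<epsilon> (L (\<Phi> l s \<tau>)) k"]
    up.op_family_pow[of "\<lambda>s. L (\<Phi> l s \<tau>)" "gb l \<tau>" k] op_family_L'[of l \<tau>] op_family_conj_up[of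
        "Gam_bar \<epsilon> y" l \<tau>]
  by (simp add: \<Phi>0 OS_bar_def Gam_bar_diff_op)

text \<open>The derivative of \<open>W k\<close> along flow l, read off from those of
  \<open>A k\<close> and \<open>Ab k\<close>. It is two-sided, so only its negative and nonnegative
  parts enter families of operators.\<close>

definition Y where "Y l k \<tau> = comm_op \<epsilon> (g l \<tau>) (A k \<tau>) - comm_op \<epsilon> (gb l \<tau>) (Ab k \<tau>)"

lemma op_family_g: "op_family 1 (\<lambda>s. g k (\<Phi> l s \<tau>)) (- minus_part (Y l k \<tau>))"
  and op_family_gb: "op_family (-1) (\<lambda>s. gb k (\<Phi> l s \<tau>)) (plus_part (Y l k \<tau>))"
proof -
  show "op_family 1 (\<lambda>s. g k (\<Phi> l s \<tau>)) (- minus_part (Y l k \<tau>))"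
    using op_family_uminus[OF op_family_diff[OF op_family_minus_part[OF op_family_A]
        op_family_minus_part[OF op_family_Ab]], of l \<tau> k l \<tau> k]
    by (simp only: W_eq[of _ k] Y_def part_linear)
  show "op_family (-1) (\<lambda>s. gb k (\<Phi> l s \<tau>)) (plus_part (Y l k \<tau>))"
    using op_family_diff[OF op_family_plus_part[OF op_family_A] op_family_plus_part[OF
        op_family_Ab], of l \<tau> k l \<tau> k]
    by (simp only: W_eq[of _ k] Y_def part_linear)
qed

text \<open>The operator \<open>A i + g i = Ab i + gb i\<close> is banded, hence belongs to both classes. Computing the
  commutator of two such operators in each of them relates the brackets of the \<open>A i\<close> to those of
  the \<open>Ab i\<close>, although the two-sided series \<open>W l\<close> and \<open>W k\<close> themselves cannot be
  multiplied.\<close>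

lemma Y_antisym:
  "Y l k \<tau> - Y k l \<tau> = scale_op (real k - real l) (W (k + l - 1) \<tau>)
     + comm_op \<epsilon> (g k \<tau>) (g l \<tau>) - comm_op \<epsilon> (gb k \<tau>) (gb l \<tau>)"
proof -
  have sum: "A i \<tau> + g i \<tau> = Ab i \<tau> + gb i \<tau>" for i
  proof -
    have "A i \<tau> - Ab i \<tau> = gb i \<tau> + minus_part (W i \<tau>)"
      by (subst W_eq[symmetric]) (rule plus_minus_part)
    then show ?thesis by (simp add: algebra_simps)
  qed
  have "comm_op \<epsilon> (A l \<tau> + g l \<tau>) (A k \<tau> + g k \<tau>) =
      comm_op \<epsilon> (A l \<tau>) (A k \<tau>) + comm_op \<epsilon> (A l \<tau>) (g k \<tau>)
        + comm_op \<epsilon> (g l \<tau>) (A k \<tau>) + comm_op \<epsilon> (g l \<tau>) (g k \<tau>)"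
    by (rule low.comm_add_add) simp_all
  moreover have "comm_op \<epsilon> (Ab l \<tau> + gb l \<tau>) (Ab k \<tau> + gb k \<tau>) =
      comm_op \<epsilon> (Ab l \<tau>) (Ab k \<tau>) + comm_op \<epsilon> (Ab l \<tau>) (gb k \<tau>)
        + comm_op \<epsilon> (gb l \<tau>) (Ab k \<tau>) + comm_op \<epsilon> (gb l \<tau>) (gb k \<tau>)"
    by (rule up.comm_add_add) simp_all
  moreover have "comm_op \<epsilon> (A l \<tau> + g l \<tau>) (A k \<tau> + g k \<tau>) =
      comm_op \<epsilon> (Ab l \<tau> + gb l \<tau>) (Ab k \<tau> + gb k \<tau>)"
    by (simp only: sum)
  ultimately have expanded:
    "comm_op \<epsilon> (A l \<tau>) (A k \<tau>) + comm_op \<epsilon> (A l \<tau>) (g k \<tau>)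
        + comm_op \<epsilon> (g l \<tau>) (A k \<tau>) + comm_op \<epsilon> (g l \<tau>) (g k \<tau>) =
     comm_op \<epsilon> (Ab l \<tau>) (Ab k \<tau>) + comm_op \<epsilon> (Ab l \<tau>) (gb k \<tau>)
        + comm_op \<epsilon> (gb l \<tau>) (Ab k \<tau>) + comm_op \<epsilon> (gb l \<tau>) (gb k \<tau>)"
    by (simp only:)
  have "comm_op \<epsilon> (A l \<tau>) (A k \<tau>) = scale_op (real l - real k) (A (k + l - 1) \<tau>)"
    by (rule low.virasoro_comm) (simp_all add: canonical)
  moreover have "comm_op \<epsilon> (Ab l \<tau>) (Ab k \<tau>) = scale_op (real l - real k) (Ab (k + l - 1) \<tau>)"
    by (rule up.virasoro_comm) (simp_all add: canonical)
  ultimately have "scale_op (real k - real l) (W (k + l - 1) \<tau>) =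
      - (comm_op \<epsilon> (A l \<tau>) (A k \<tau>) - comm_op \<epsilon> (Ab l \<tau>) (Ab k \<tau>))"
    unfolding W_eq by (simp add: scale_op_def fun_eq_iff algebra_simps)
  \<comment> \<open>Additive bookkeeping with brackets as letters: a, x, y, z stand for [A l, A k],
    [A l, g k], [g l, A k], [g l, g k], and the primed letters for their counterparts with
    \<open>Ab\<close> and \<open>gb\<close>.\<close>
  moreover have group: "(y - y') - (- x - - x') = - (a - a') + - z - - z'"
    if "a + x + y + z = a' + x' + y' + z'" for a x y z a' x' y' z' :: oper
  proof -
    have "a = a' + x' + y' + z' - z - y - x"
      using that by (simp add: algebra_simps)
    then show ?thesis by (simp add: algebra_simps)
  qed
  ultimately show ?thesis
    unfolding Y_def low.comm_swap[of "g k \<tau>" "A l \<tau>"] low.comm_swap[of "gb k \<tau>" "Ab l \<tau>"]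
      low.comm_swap[of "g k \<tau>" "g l \<tau>"] low.comm_swap[of "gb k \<tau>" "gb l \<tau>"]
    using group[OF expanded] by (simp only:)
qed

text \<open>[g k, g l] has only negative powers and [gb k, gb l] only nonnegative ones, so each
  projection of \<open>Y_antisym\<close> keeps exactly one of the two brackets, and that one cancels
  against the curvature term.\<close>

lemma zero_curvature:
  "- minus_part (Y l k \<tau>) - - minus_part (Y k l \<tau>) + comm_op \<epsilon> (g k \<tau>) (g l \<tau>) =
     scale_op (real k - real l) (g (k + l - 1) \<tau>)" (is ?low)
  "plus_part (Y l k \<tau>) - plus_part (Y k l \<tau>) + comm_op \<epsilon> (gb k \<tau>) (gb l \<tau>) =
     scale_op (real k - real l) (gb (k + l - 1) \<tau>)" (is ?up)
proof -
  \<comment> \<open>The powers of \<Lambda> in \<open>W i\<close> may be unbounded on both sides,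
    but its order in \<partial> is bounded by those of \<open>A i\<close> and
    \<open>Ab i\<close>.\<close>
  have "\<exists>D. \<forall>j m. m > D \<longrightarrow> W i \<tau> j m = 0" for i
  proof -
    obtain K D K' D' where "supported 1 K D (A i \<tau>)" "supported (-1) K' D' (Ab i \<tau>)"
      using low.diff_opD[of "A i \<tau>"] up.diff_opD[of "Ab i \<tau>"] by (auto simp: bounded_op_def)
    then have "\<forall>j m. m > max D D' \<longrightarrow> W i \<tau> j m = 0"
      unfolding W_eq by (auto simp: supported_def)
    then show ?thesis by blast
  qed
  then obtain D where D: "W i \<tau> j m = 0" if "m > D i" for i j m
    by metis
  have pc:
    "minus_part (comm_op \<epsilon> (minus_part (W k \<tau>)) (minus_part (W l \<tau>))) =
      comm_op \<epsilon> (minus_part (W k \<tau>)) (minus_part (W l \<tau>))"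
    "plus_part (comm_op \<epsilon> (minus_part (W k \<tau>)) (minus_part (W l \<tau>))) = 0"
    "plus_part (comm_op \<epsilon> (gb k \<tau>) (gb l \<tau>)) = comm_op \<epsilon> (gb k \<tau>) (gb l \<tau>)"
    "minus_part (comm_op \<epsilon> (gb k \<tau>) (gb l \<tau>)) = 0"
    by (rule part_comm; erule D)+
  have gg: "comm_op \<epsilon> (g k \<tau>) (g l \<tau>) = comm_op \<epsilon> (minus_part (W k \<tau>)) (minus_part (W l \<tau>))"
    using diff_op_g[of \<tau> k, THEN diff_op_uminus] diff_op_g[of \<tau> l, THEN diff_op_uminus]
    by (simp add: comm_op_def low.mult_uminus_left low.mult_uminus_right)
  have Z: "minus_part (Y l k \<tau>) - minus_part (Y k l \<tau>) =
      scale_op (real k - real l) (minus_part (W (k + l - 1) \<tau>))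
      + comm_op \<epsilon> (g k \<tau>) (g l \<tau>)"
    using arg_cong[OF Y_antisym[of l k \<tau>], of minus_part]
    unfolding part_linear gg pc by simp
  then show ?low by (simp add: scale_op_uminus algebra_simps)
  have Zp: "plus_part (Y l k \<tau>) - plus_part (Y k l \<tau>) =
      scale_op (real k - real l) (plus_part (W (k + l - 1) \<tau>))
      - comm_op \<epsilon> (gb k \<tau>) (gb l \<tau>)"
    using arg_cong[OF Y_antisym[of l k \<tau>], of plus_part]
    unfolding part_linear gg pc by simp
  then show ?up by simp
qed

lemma virasoro:
  "virasoro_relation \<Phi> l k P \<sigma>" "virasoro_relation \<Phi> l k Pb \<sigma>" "virasoro_relation \<Phi> l k L \<sigma>"
  by (rule low.zero_curvature_virasoro(1)[where g = g, OF \<Phi>0 diff_op_g op_family_g op_family_g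
      zero_curvature(1) op_family_P]
      up.zero_curvature_virasoro(1)[where g = gb, OF \<Phi>0 diff_op_gb op_family_gb op_family_gb
          zero_curvature(2) op_family_Pb]
      low.zero_curvature_virasoro(2)[where g = g, OF \<Phi>0 diff_op_g op_family_g op_family_g
          zero_curvature(1) op_family_L])+

end

theorem theorem4p4:
  fixes \<epsilon> :: real
    and P Pb :: "time_seq \<Rightarrow> time_seq \<Rightarrow> 's \<Rightarrow> oper"
    and \<Phi> :: "nat \<Rightarrow> real \<Rightarrow> 's \<Rightarrow> 's"
    and \<sigma> :: 's
    and t y :: time_seq
    and l k :: nat
  assumes "\<epsilon> \<noteq> 0"
    and "\<And>l \<tau>. \<Phi> l 0 \<tau> = \<tau>"
    and "\<And>t y \<tau>. finite_supp t \<Longrightarrow> finite_supp y \<Longrightarrow> dressing \<epsilon> (P t y \<tau>) (Pb t y \<tau>)"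
    and "\<And>t y. finite_supp t \<Longrightarrow> finite_supp y \<Longrightarrow>
           smooth_along_flows \<Phi> (P t y) \<and> smooth_along_flows \<Phi> (Pb t y)"
    and "\<And>t y. finite_supp t \<Longrightarrow> finite_supp y \<Longrightarrow>
           additional_flows \<epsilon> t y (P t y) (Pb t y) \<Phi>"
    and "SCETH \<epsilon> (\<lambda>t y. P t y \<sigma>) (\<lambda>t y. Pb t y \<sigma>)"
    and "finite_supp t" and "finite_supp y"
  shows "virasoro_relation \<Phi> l k (P t y) \<sigma> \<and>
         virasoro_relation \<Phi> l k (Pb t y) \<sigma> \<and>
         virasoro_relation \<Phi> l k (\<lambda>\<tau>. Lax \<epsilon> (P t y \<tau>)) \<sigma>"
proof -
  interpret additional_flow_setting \<epsilon> t y "P t y" "Pb t y" \<Phi>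
    by standard (use assms in auto)
  show ?thesis using virasoro by blast
qed

end
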